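(* Let $\mathbb{K}$ be a field, $S=\mathbb{K}[x_1,\dots,x_n]$, and let $I\subseteq S$ be the smallest strongly stable ideal containing a set of monomials $\{u_i=x_1^{l_{i_1}}\cdots x_n^{l_{i_n}}: i=1,\dots,s\}$. Then for all $r=0,\dots,n-1$, \[ \text{arith-deg}_r(I)=\text{std}_r(I)\leq \binom{L_{n-r}+n-r-1}{n-r}, \] where $L_{n-r}=\max\{l_{i_1}+\cdots+l_{i_{n-r}}: i=1,\dots,s\}$.
   Context: Here $l_{i_k}$ denotes the exponent of $x_k$ in $u_i$. A monomial ideal $I\subseteq S$ is strongly stable if for every monomial $u\in I$, every $i$ with $x_i\mid u$ and every $j\leq i$, one has $x_ju/x_i\in I$. Standard pairs: let $I$ be a monomial ideal, $u$ a monomial, and $Z\subseteq\{x_1,\dots,x_n\}$; let $\operatorname{supp}(u)$ be the set of variables dividing $u$. The pair $(u,Z)$ is a standard pair with respect to $I$ if (1) $Z\cap\operatorname{supp}(u)=\emptyset$; (2) $u\mathbb{K}[Z]\cap I=\{0\}$; (3) if $(u',Z')\neq(u,Z)$ is another pair with $Z'\cap\operatorname{supp}(u')=\emptyset$ and $u'\mathbb{K}[Z']\cap I=\{0\}$, then $u\mathbb{K}[Z]\not\subset u'\mathbb{K}[Z']$. $\text{std}_r(I)$ denotes the number of standard pairs $(u,Z)$ of $I$ with $|Z|=r$. For a finitely generated graded $S$-module $M$, the multiplicity $e(M)$ is the normalized leading coefficient of the Hilbert polynomial of $M$: if $\dim M=m\geq 1$, the Hilbert polynomial has leading term $\frac{e(M)}{(m-1)!}t^{m-1}$;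 if $\dim M=0$, $e(M)=\dim_{\mathbb{K}}M$. For a prime ideal $P$, the length-multiplicity $\text{mult}_I(P)$ is the length of the largest submodule of finite length of $(S/I)_P$ (as an $S_P$-module). The $r$-th arithmetic degree of $I$ is $\text{arith-deg}_r(I)=\sum_{P\in \operatorname{Ass}(S/I),\ \dim(S/P)=r}\text{mult}_I(P)\cdot e(S/P)$, where $\operatorname{Ass}(S/I)$ is the set of associated primes of $S/I$. *)

theory Defs
  imports
    "HOL-Library.Poly_Mapping"
    "HOL-Library.Extended_Nat"
    "HOL-Computational_Algebra.Polynomial"
    "HOL-Algebra.Module"
    "HOL-Algebra.QuotRing"
    "HOL-Algebra.Embedded_Algebras"
begin

section \<open>Modules, localization, length and dimension\<close>

text \<open>Modules are records of \<^theory>\<open>HOL-Algebra.Module\<close>, which extend ring records; the ring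
  multiplication and unit of such a record play no role for the module structure.\<close>

definition regular_module :: "'a ring \<Rightarrow> ('a, 'a) module" where
  "regular_module R =
     \<lparr>carrier = carrier R, mult = mult R, one = one R, zero = zero R, add = add R,
      smult = mult R\<rparr>"

definition residue_module :: "'a ring \<Rightarrow> 'a set \<Rightarrow> ('a, 'a set) module" where
  "residue_module R I =
     \<lparr>carrier = carrier (R Quot I), mult = mult (R Quot I), one = one (R Quot I),
      zero = zero (R Quot I), add = add (R Quot I),
      smult = (\<lambda>a X. (I +>\<^bsub>R\<^esub> a) \<otimes>\<^bsub>R Quot I\<^esub> X)\<rparr>"

definition annihilator :: "'a ring \<Rightarrow> ('a, 'm) module \<Rightarrow> 'm \<Rightarrow> 'a set" where
  "annihilator R M m = {a \<in> carrier R. a \<odot>\<^bsub>M\<^esub> m = \<zero>\<^bsub>M\<^esub>}"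

definition associated_primes :: "'a ring \<Rightarrow> ('a, 'm) module \<Rightarrow> 'a set set" where
  "associated_primes R M =
     {P. primeideal P R \<and> (\<exists>m\<in>carrier M. P = annihilator R M m)}"

text \<open>For a multiplicative subset \<open>T\<close> of \<open>R\<close>, the fraction \<open>m / s\<close> is the class of the pair
  \<open>(m, s)\<close>, where \<open>m / s = m' / s'\<close> iff \<open>t s' m = t s m'\<close> for some \<open>t \<in> T\<close>.\<close>

definition frac_rel :: "'a set \<Rightarrow> ('a, 'm) module \<Rightarrow> (('m \<times> 'a) \<times> ('m \<times> 'a)) set" where
  "frac_rel T M =
     {((m, s), (m', s')). m \<in> carrier M \<and> m' \<in> carrier M \<and> s \<in> T \<and> s' \<in> T \<and>
        (\<exists>t\<in>T. t \<odot>\<^bsub>M\<^esub> (s' \<odot>\<^bsub>M\<^esub> m) = t \<odot>\<^bsub>M\<^esub> (s \<odot>\<^bsub>M\<^esub> m'))}"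

definition frac_add :: "'a ring \<Rightarrow> 'a set \<Rightarrow> ('a, 'm) module
    \<Rightarrow> ('m \<times> 'a) set \<Rightarrow> ('m \<times> 'a) set \<Rightarrow> ('m \<times> 'a) set" where
  "frac_add R T M X Y =
     (\<Union>(m, s)\<in>X. \<Union>(m', s')\<in>Y.
        frac_rel T M `` {((s' \<odot>\<^bsub>M\<^esub> m) \<oplus>\<^bsub>M\<^esub> (s \<odot>\<^bsub>M\<^esub> m'), s \<otimes>\<^bsub>R\<^esub> s')})"

definition frac_smult :: "'a ring \<Rightarrow> 'a set \<Rightarrow> ('a, 'm) module
    \<Rightarrow> ('a \<times> 'a) set \<Rightarrow> ('m \<times> 'a) set \<Rightarrow> ('m \<times> 'a) set" where
  "frac_smult R T M A X =
     (\<Union>(a, s)\<in>A. \<Union>(m, s')\<in>X. frac_rel T M `` {(a \<odot>\<^bsub>M\<^esub> m, s \<otimes>\<^bsub>R\<^esub> s')})"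

definition loc_ring :: "'a ring \<Rightarrow> 'a set \<Rightarrow> ('a \<times> 'a) set ring" where
  "loc_ring R T =
     \<lparr>carrier = (carrier R \<times> T) // frac_rel T (regular_module R),
      mult = frac_smult R T (regular_module R),
      one = frac_rel T (regular_module R) `` {(\<one>\<^bsub>R\<^esub>, \<one>\<^bsub>R\<^esub>)},
      zero = frac_rel T (regular_module R) `` {(\<zero>\<^bsub>R\<^esub>, \<one>\<^bsub>R\<^esub>)},
      add = frac_add R T (regular_module R)\<rparr>"

definition loc_module ::
    "'a ring \<Rightarrow> 'a set \<Rightarrow> ('a, 'm) module \<Rightarrow> (('a \<times> 'a) set, ('m \<times> 'a) set) module" where
  "loc_module R T M =
     \<lparr>carrier = (carrier M \<times> T) // frac_rel T M,
      mult = undefined,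
      one = undefined,
      zero = frac_rel T M `` {(\<zero>\<^bsub>M\<^esub>, \<one>\<^bsub>R\<^esub>)},
      add = frac_add R T M,
      smult = frac_smult R T M\<rparr>"

definition module_length :: "'a ring \<Rightarrow> ('a, 'm) module \<Rightarrow> enat" where
  "module_length R M =
     (SUP k \<in> {k. \<exists>N :: nat \<Rightarrow> 'm set. (\<forall>i\<le>k. submodule (N i) R M) \<and> (\<forall>i<k. N i \<subset> N (Suc i))}.
        enat k)"

definition largest_finite_length_submodule :: "'a ring \<Rightarrow> ('a, 'm) module \<Rightarrow> 'm set" where
  "largest_finite_length_submodule R M =
     (GREATEST N. submodule N R M \<and> module_length R (M\<lparr>carrier := N\<rparr>) < \<infinity>)"

definition length_multiplicity :: "'a ring \<Rightarrow> 'a set \<Rightarrow> 'a set \<Rightarrow> nat" where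
  "length_multiplicity R I P =
     (let T = carrier R - P;
          A = loc_ring R T;
          M = loc_module R T (residue_module R I)
      in the_enat (module_length A (M\<lparr>carrier := largest_finite_length_submodule A M\<rparr>)))"

definition krull_dim :: "'a ring \<Rightarrow> enat" where
  "krull_dim R =
     (SUP k \<in> {k. \<exists>P :: nat \<Rightarrow> 'a set. (\<forall>i\<le>k. primeideal (P i) R) \<and> (\<forall>i<k. P i \<subset> P (Suc i))}.
        enat k)"


section \<open>Polynomial rings\<close>

text \<open>A monomial is represented by its exponent vector of type \<^typ>\<open>nat \<Rightarrow>\<^sub>0 nat\<close>, so that the
  finitely supported functions on exponent vectors, with convolution as multiplication, are the
  polynomials in the variables \<open>x\<^sub>0, x\<^sub>1, \<dots>\<close>. The polynomial ring over a set \<open>Z\<close> of variables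
  consists of those polynomials in which only the \<open>x\<^sub>i\<close> with \<open>i \<in> Z\<close> occur.\<close>

type_synonym 'k mpoly = "(nat \<Rightarrow>\<^sub>0 nat) \<Rightarrow>\<^sub>0 'k"

definition monomial :: "(nat \<Rightarrow>\<^sub>0 nat) \<Rightarrow> 'k::field mpoly" where
  "monomial u = Poly_Mapping.single u 1"

definition polys_in :: "nat set \<Rightarrow> 'k::field mpoly set" where
  "polys_in Z = {p. \<forall>u\<in>Poly_Mapping.keys p. Poly_Mapping.keys u \<subseteq> Z}"

definition poly_ring :: "nat \<Rightarrow> 'k::field mpoly ring" where
  "poly_ring n = \<lparr>carrier = polys_in {1..n}, mult = (*), one = 1, zero = 0, add = (+)\<rparr>"

definition mon_degree :: "(nat \<Rightarrow>\<^sub>0 nat) \<Rightarrow> nat" where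
  "mon_degree u = (\<Sum>i\<in>Poly_Mapping.keys u. Poly_Mapping.lookup u i)"

definition homogeneous_part :: "nat \<Rightarrow> nat \<Rightarrow> 'k::field mpoly set" where
  "homogeneous_part n t =
     {p \<in> polys_in {1..n}. \<forall>u\<in>Poly_Mapping.keys p. mon_degree u = t}"

text \<open>The dimension over \<open>\<bbbK>\<close> of the image of \<open>V \<subseteq> S\<close> in \<open>S/J\<close>, for a proper ideal \<open>J\<close> of
  \<open>S = \<bbbK>[x\<^sub>1,\<dots>,x\<^sub>n]\<close>; the field \<open>\<bbbK>\<close> is identified with the image of the constants in \<open>S/J\<close>.\<close>

definition residue_dim :: "nat \<Rightarrow> 'k::field mpoly set \<Rightarrow> 'k mpoly set \<Rightarrow> nat" where
  "residue_dim n J V =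
     (let \<pi> = (\<lambda>p. J +>\<^bsub>poly_ring n\<^esub> p)
      in THE d. ring.dimension (poly_ring n Quot J) d
                  (\<pi> ` {Poly_Mapping.single 0 c | c. True}) (\<pi> ` V))"

definition hilbert_function :: "nat \<Rightarrow> 'k::field mpoly set \<Rightarrow> nat \<Rightarrow> nat" where
  "hilbert_function n J t = residue_dim n J (homogeneous_part n t)"

definition hilbert_polynomial :: "nat \<Rightarrow> 'k::field mpoly set \<Rightarrow> rat poly" where
  "hilbert_polynomial n J =
     (THE q. \<forall>\<^sub>F t in sequentially. poly q (of_nat t) = of_nat (hilbert_function n J t))"

text \<open>The multiplicity \<open>e(S/J)\<close> of the graded module \<open>S/J\<close>, for a homogeneous proper ideal \<open>J\<close>.
  The dimension of the module \<open>S/J\<close> is the Krull dimension of the ring \<open>S/J\<close>.\<close>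

definition hilbert_multiplicity :: "nat \<Rightarrow> 'k::field mpoly set \<Rightarrow> rat" where
  "hilbert_multiplicity n J =
     (let m = the_enat (krull_dim (poly_ring n Quot J))
      in if m = 0 then of_nat (residue_dim n J (carrier (poly_ring n)))
         else fact (m - 1) * lead_coeff (hilbert_polynomial n J))"

definition arith_deg :: "nat \<Rightarrow> nat \<Rightarrow> 'k::field mpoly set \<Rightarrow> rat" where
  "arith_deg n r I =
     (let S = poly_ring n
      in \<Sum>P | P \<in> associated_primes S (residue_module S I) \<and> krull_dim (S Quot P) = enat r.
           of_nat (length_multiplicity S I P) * hilbert_multiplicity n P)"


section \<open>Monomial ideals\<close>

definition monomial_ideal :: "nat \<Rightarrow> 'k::field mpoly set \<Rightarrow> bool" where
  "monomial_ideal n I \<longleftrightarrow>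
     (\<exists>U. (\<forall>u\<in>U. Poly_Mapping.keys u \<subseteq> {1..n}) \<and> I = Idl\<^bsub>poly_ring n\<^esub> (monomial ` U))"

text \<open>The exponent vector of \<open>x\<^sub>j u / x\<^sub>i\<close> is \<open>u - e\<^sub>i + e\<^sub>j\<close>; the subtraction is exact when
  \<open>x\<^sub>i\<close> divides \<open>u\<close>.\<close>

definition strongly_stable :: "nat \<Rightarrow> 'k::field mpoly set \<Rightarrow> bool" where
  "strongly_stable n I \<longleftrightarrow>
     monomial_ideal n I \<and>
     (\<forall>u i j. Poly_Mapping.keys u \<subseteq> {1..n} \<and> monomial u \<in> I \<and>
        i \<in> Poly_Mapping.keys u \<and> 1 \<le> j \<and> j \<le> i \<longrightarrow>
        monomial (u - Poly_Mapping.single i 1 + Poly_Mapping.single j 1) \<in> I)"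

text \<open>The set \<open>u \<bbbK>[Z]\<close>.\<close>

definition mon_cone :: "(nat \<Rightarrow>\<^sub>0 nat) \<Rightarrow> nat set \<Rightarrow> 'k::field mpoly set" where
  "mon_cone u Z = (\<lambda>f. monomial u * f) ` polys_in Z"

text \<open>Pairs \<open>(u, Z)\<close> subject to conditions (1) and (2) of the definition of standard pairs.\<close>

definition admissible_pair ::
    "nat \<Rightarrow> 'k::field mpoly set \<Rightarrow> (nat \<Rightarrow>\<^sub>0 nat) \<times> nat set \<Rightarrow> bool" where
  "admissible_pair n I = (\<lambda>(u, Z).
     Poly_Mapping.keys u \<subseteq> {1..n} \<and> Z \<subseteq> {1..n} \<and>
     Z \<inter> Poly_Mapping.keys u = {} \<and> mon_cone u Z \<inter> I = {0})"

definition standard_pairs ::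
    "nat \<Rightarrow> 'k::field mpoly set \<Rightarrow> ((nat \<Rightarrow>\<^sub>0 nat) \<times> nat set) set" where
  "standard_pairs n I =
     {(u, Z). admissible_pair n I (u, Z) \<and>
        (\<forall>u' Z'. admissible_pair n I (u', Z') \<and> (u', Z') \<noteq> (u, Z) \<longrightarrow>
           \<not> (mon_cone u Z :: 'k mpoly set) \<subseteq> mon_cone u' Z')}"

definition std :: "nat \<Rightarrow> nat \<Rightarrow> 'k::field mpoly set \<Rightarrow> nat" where
  "std n r I = card {(u, Z) \<in> standard_pairs n I. card Z = r}"

end

theory Submission
  imports Defs
begin

text \<open>Write \<open>I\<close> for a monomial ideal, let \<open>A \<union> Z\<close> be a
  partition of the variables and \<open>P\<close> the prime generated by \<open>A\<close>.
  Submodules of \<open>(S/I)\<^sub>P\<close> correspond to the ideals of \<open>S\<close> that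
  contain \<open>I\<close> and are saturated with respect to \<open>S - P\<close>. Among them are
  the ideals given by conditions on the \<open>A\<close>-parts of exponents; they yield a
  composition series of the largest submodule of finite length whose factors are indexed by the
  monomials \<open>a\<close> in the variables \<open>A\<close> that are nonzero in
  \<open>(S/I)\<^sub>P\<close> but annihilated by a power of \<open>P\<close>. These are exactly the
  \<open>a\<close> for which \<open>(a, Z)\<close> is a standard pair. As associated primes of
  \<open>I\<close> are generated by variables and \<open>S/P\<close> is a polynomial ring, of
  multiplicity one, arithmetic degrees count standard pairs. If \<open>I\<close> is strongly stable,
  then \<open>Z\<close> can only be a final segment of the variables, and comparing partial degrees
  with those of the generators bounds the degree of \<open>a\<close>, so that it remains to count
  monomials.\<close>

section \<open>Submodules of localized residue modules\<close>

text \<open>After localization the nonzero polynomials in the variables \<open>Z\<close> are units,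
  so each monomial in the variables \<open>A\<close> contributes one simple factor; this is why
  conditions on \<open>A\<close>-parts alone give a composition series. Length is a supremum over
  chains, so a series is not enough: chains inside the finite part are bounded by counting the
  factors in which a submodule is visible, and a submodule outside it needs chains of every length.
  Cancellation of elements outside \<open>P\<close> rests on initial terms: grading by
  \<open>A\<close>-parts, an element outside \<open>P\<close> has lowest grade 0 and does not move
  the lowest grade of a product. The dimension of S/P needs an upper bound on chains of primes.
  Elements picked from the successive steps of a chain satisfy no polynomial relation, while
  \<open>card Z + 1\<close> polynomials in \<open>card Z\<close> variables always do. In the
  strongly stable case, minimality of the ideal shows that each of its exponents has all partial
  degrees at least those of some generator. Conversely, exchange moves show that such exponents lie
  in any stable ideal containing the generators. Both directions enter the degree bound.\<close>

lemma submodule_iff: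
  fixes M (structure)
  shows "submodule H R M \<longleftrightarrow>
    H \<subseteq> carrier M \<and> \<zero> \<in> H \<and> (\<forall>x\<in>H. \<forall>y\<in>H. x \<oplus> y \<in> H) \<and> (\<forall>x\<in>H. \<ominus> x \<in> H) \<and>
    (\<forall>a\<in>carrier R. \<forall>x\<in>H. a \<odot> x \<in> H)"
  by (auto simp: submodule_def subgroup_def submodule_axioms_def a_inv_def)

text \<open>\<open>frac_add\<close> and \<open>frac_smult\<close> are unions over all
  representatives. Independence of the representatives, together with one existing pair, collapses
  such a union to a single class.\<close>

lemma UN_pairs_const:
  assumes "x \<in> X" "y \<in> Y"
    and "\<And>a b c d. (a, b) \<in> X \<Longrightarrow> (c, d) \<in> Y \<Longrightarrow> F a b c d = C"
  shows "(\<Union>(a, b)\<in>X. \<Union>(c, d)\<in>Y. F a b c d) = C"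
  using assms by (force split: prod.splits)

locale residue_localization = cring R + quot: ideal I R for R :: "'a ring" (structure) and I +
  fixes T
  assumes T_subset: "T \<subseteq> carrier R"
    and T_one: "\<one> \<in> T"
    and T_mult: "\<lbrakk>s \<in> T; t \<in> T\<rbrakk> \<Longrightarrow> s \<otimes> t \<in> T"
begin

abbreviation "M \<equiv> residue_module R I"
abbreviation "A \<equiv> loc_ring R T"
abbreviation "L \<equiv> loc_module R T M"

definition frac where "frac p s = frac_rel T M `` {(I +> p, s)}"
definition ring_frac where "ring_frac a s = frac_rel T (regular_module R) `` {(a, s)}"

lemma T_carrier [simp]: "t \<in> T \<Longrightarrow> t \<in> carrier R"
  using T_subset by blast

lemma ideal_comb:
  "\<lbrakk>ideal J R; x \<in> J; y \<in> J; a \<in> carrier R; b \<in> carrier R\<rbrakk> \<Longrightarrow> a \<otimes> x \<oplus> b \<otimes> y \<in> J"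
  by (meson additive_subgroup.a_closed ideal.I_l_closed ideal.axioms(1))

lemma carrier_M: "carrier M = {I +> p | p. p \<in> carrier R}"
  by (auto simp: residue_module_def FactRing_def A_RCOSETS_def')

lemma coset_in_M [simp]: "p \<in> carrier R \<Longrightarrow> I +> p \<in> carrier M"
  by (auto simp: carrier_M)

lemma M_add [simp]: "\<lbrakk>p \<in> carrier R; q \<in> carrier R\<rbrakk> \<Longrightarrow> (I +> p) \<oplus>\<^bsub>M\<^esub> (I +> q) = I +> (p \<oplus> q)"
  by (simp add: residue_module_def FactRing_def quot.a_rcos_sum)

lemma M_smult [simp]: "\<lbrakk>a \<in> carrier R; p \<in> carrier R\<rbrakk> \<Longrightarrow> a \<odot>\<^bsub>M\<^esub> (I +> p) = I +> (a \<otimes> p)"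
  by (simp add: residue_module_def FactRing_def quot.rcoset_mult_add)

lemma M_zero: "\<zero>\<^bsub>M\<^esub> = I +> \<zero>"
  using quot.a_subset by (simp add: residue_module_def FactRing_def)

lemma coset_eq_iff: "\<lbrakk>p \<in> carrier R; q \<in> carrier R\<rbrakk> \<Longrightarrow> I +> p = I +> q \<longleftrightarrow> p \<ominus> q \<in> I"
  using quotient_eq_iff_same_a_r_cos[OF quot.is_ideal] by blast

lemma frac_rel_iff:
  assumes "p \<in> carrier R" "q \<in> carrier R"
  shows "((I +> p, s), (I +> q, s')) \<in> frac_rel T M \<longleftrightarrow>
    s \<in> T \<and> s' \<in> T \<and> (\<exists>t\<in>T. t \<otimes> (s' \<otimes> p \<ominus> s \<otimes> q) \<in> I)"
proof -
  have "t \<otimes> (s' \<otimes> p) \<ominus> t \<otimes> (s \<otimes> q) = t \<otimes> (s' \<otimes> p \<ominus> s \<otimes> q)"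
    if "s \<in> T" "s' \<in> T" "t \<in> T" for t
  proof -
    note carr = assms that[THEN T_carrier]
    from carr show ?thesis by algebra
  qed
  then show ?thesis
    using assms by (auto simp: frac_rel_def coset_eq_iff)
qed

lemma equiv_frac_rel: "equiv (carrier M \<times> T) (frac_rel T M)"
proof (rule equivI)
  show "frac_rel T M \<subseteq> (carrier M \<times> T) \<times> (carrier M \<times> T)"
    by (auto simp: frac_rel_def)
  show "refl_on (carrier M \<times> T) (frac_rel T M)"
    using T_one by (auto simp: refl_on_def frac_rel_def)
  show "sym (frac_rel T M)"
    unfolding sym_def frac_rel_def by (auto intro: sym)
  show "trans (frac_rel T M)"
  proof (rule transI)
    fix x y z assume xy: "(x, y) \<in> frac_rel T M" and yz: "(y, z) \<in> frac_rel T M"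
    from xy obtain p q s s' where *: "x = (I +> p, s)" "y = (I +> q, s')" "p \<in> carrier R" "q \<in> carrier R"
      unfolding frac_rel_def carrier_M by blast
    from yz obtain r s'' where **: "z = (I +> r, s'')" "r \<in> carrier R"
      unfolding frac_rel_def carrier_M by blast
    from xy * obtain t where t: "s \<in> T" "s' \<in> T" "t \<in> T" "t \<otimes> (s' \<otimes> p \<ominus> s \<otimes> q) \<in> I"
      by (auto simp: frac_rel_iff)
    from yz * ** obtain t' where t': "s'' \<in> T" "t' \<in> T" "t' \<otimes> (s'' \<otimes> q \<ominus> s' \<otimes> r) \<in> I"
      by (auto simp: frac_rel_iff)
    note carr = *(3,4) **(2) t(1-3)[THEN T_carrier] t'(1,2)[THEN T_carrier]
    \<comment> \<open>The multiplier is \<open>t \<otimes> t' \<otimes> s'\<close>: with the factors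
      \<open>t' \<otimes> s''\<close> and \<open>t \<otimes> s\<close> the terms in \<open>q\<close>
      of the two relations cancel.\<close>
    have "(t \<otimes> t' \<otimes> s') \<otimes> (s'' \<otimes> p \<ominus> s \<otimes> r) =
        (t' \<otimes> s'') \<otimes> (t \<otimes> (s' \<otimes> p \<ominus> s \<otimes> q)) \<oplus> (t \<otimes> s) \<otimes> (t' \<otimes> (s'' \<otimes> q \<ominus> s' \<otimes> r))"
      using carr by algebra
    also have "\<dots> \<in> I"
      using carr by (intro ideal_comb[OF quot.is_ideal t(4) t'(3)]) auto
    finally show "(x, z) \<in> frac_rel T M"
      unfolding * ** frac_rel_iff[OF *(3) **(2)] using T_mult t t' by blast
  qed
qed

lemma frac_eq_iff:
  assumes "p \<in> carrier R" "q \<in> carrier R" "s \<in> T" "s' \<in> T"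
  shows "frac p s = frac q s' \<longleftrightarrow> (\<exists>t\<in>T. t \<otimes> (s' \<otimes> p \<ominus> s \<otimes> q) \<in> I)"
  unfolding frac_def using eq_equiv_class_iff[OF equiv_frac_rel, of "(I +> p, s)" "(I +> q, s')"] assms
  by (simp add: frac_rel_iff)

lemma frac_eqI:
  assumes "t \<otimes> (s' \<otimes> p \<ominus> s \<otimes> q) \<in> I" "t \<in> T" "p \<in> carrier R" "q \<in> carrier R" "s \<in> T" "s' \<in> T"
  shows "frac p s = frac q s'"
  using assms by (auto simp: frac_eq_iff)

lemma frac_memD:
  assumes "x \<in> frac p s" "p \<in> carrier R" "s \<in> T"
  obtains q s' where "x = (I +> q, s')" "q \<in> carrier R" "s' \<in> T" "frac q s' = frac p s"
proof -
  have "((I +> p, s), x) \<in> frac_rel T M" using assms by (simp add: frac_def)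
  moreover from this obtain q s' where "x = (I +> q, s')" "q \<in> carrier R" "s' \<in> T"
    unfolding frac_rel_def carrier_M by blast
  ultimately show ?thesis
    using that[of q s'] equiv_class_eq[OF equiv_frac_rel] unfolding frac_def by metis
qed

lemma frac_self: "\<lbrakk>p \<in> carrier R; s \<in> T\<rbrakk> \<Longrightarrow> (I +> p, s) \<in> frac p s"
  unfolding frac_def using equiv_class_self[OF equiv_frac_rel, of "(I +> p, s)"] by simp

lemma carrier_L: "carrier L = {frac p s | p s. p \<in> carrier R \<and> s \<in> T}"
  by (auto simp: loc_module_def quotient_def frac_def carrier_M)

lemma L_zero: "\<zero>\<^bsub>L\<^esub> = frac \<zero> \<one>"
  by (simp add: loc_module_def frac_def M_zero)

lemma L_add:
  assumes "p \<in> carrier R" "q \<in> carrier R" "s \<in> T" "s' \<in> T"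
  shows "frac p s \<oplus>\<^bsub>L\<^esub> frac q s' = frac (s' \<otimes> p \<oplus> s \<otimes> q) (s \<otimes> s')"
proof -
  have *: "frac_rel T M `` {((s2 \<odot>\<^bsub>M\<^esub> m) \<oplus>\<^bsub>M\<^esub> (s1 \<odot>\<^bsub>M\<^esub> m'), s1 \<otimes> s2)} = frac (s' \<otimes> p \<oplus> s \<otimes> q) (s \<otimes> s')"
    if m: "(m, s1) \<in> frac p s" "(m', s2) \<in> frac q s'" for m s1 m' s2
  proof -
    obtain p1 where 1: "m = I +> p1" "p1 \<in> carrier R" "s1 \<in> T" "frac p1 s1 = frac p s"
      using frac_memD[OF m(1)] assms by (metis Pair_inject)
    obtain q1 where 2: "m' = I +> q1" "q1 \<in> carrier R" "s2 \<in> T" "frac q1 s2 = frac q s'"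
      using frac_memD[OF m(2)] assms by (metis Pair_inject)
    from 1 assms obtain t where t: "t \<in> T" "t \<otimes> (s \<otimes> p1 \<ominus> s1 \<otimes> p) \<in> I"
      by (auto simp: frac_eq_iff)
    from 2 assms obtain t' where t': "t' \<in> T" "t' \<otimes> (s' \<otimes> q1 \<ominus> s2 \<otimes> q) \<in> I"
      by (auto simp: frac_eq_iff)
    note carr = 1(2) 2(2) assms(1,2) assms(3,4)[THEN T_carrier] 1(3)[THEN T_carrier] 2(3)[THEN T_carrier]
      t(1)[THEN T_carrier] t'(1)[THEN T_carrier]
    have "(t \<otimes> t') \<otimes> ((s \<otimes> s') \<otimes> (s2 \<otimes> p1 \<oplus> s1 \<otimes> q1) \<ominus> (s1 \<otimes> s2) \<otimes> (s' \<otimes> p \<oplus> s \<otimes> q))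
      = (t' \<otimes> s' \<otimes> s2) \<otimes> (t \<otimes> (s \<otimes> p1 \<ominus> s1 \<otimes> p)) \<oplus> (t \<otimes> s \<otimes> s1) \<otimes> (t' \<otimes> (s' \<otimes> q1 \<ominus> s2 \<otimes> q))"
      using carr by algebra
    also have "\<dots> \<in> I"
      using carr by (intro ideal_comb[OF quot.is_ideal t(2) t'(2)]) auto
    finally have "frac (s2 \<otimes> p1 \<oplus> s1 \<otimes> q1) (s1 \<otimes> s2) = frac (s' \<otimes> p \<oplus> s \<otimes> q) (s \<otimes> s')"
      by (rule frac_eqI) (use carr T_mult 1(3) 2(3) assms t(1) t'(1) in simp_all)
    then show ?thesis using carr 1(1) 2(1) by (simp add: frac_def)
  qed
  have ne: "(I +> p, s) \<in> frac p s" "(I +> q, s') \<in> frac q s'" using assms frac_self by auto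
  have "frac_add R T M (frac p s) (frac q s') = frac (s' \<otimes> p \<oplus> s \<otimes> q) (s \<otimes> s')"
    unfolding frac_add_def using ne * by (rule UN_pairs_const)
  then show ?thesis by (simp add: loc_module_def)
qed

lemma ring_frac_memD:
  assumes "x \<in> ring_frac a s"
  obtains b s' t where "x = (b, s')" "b \<in> carrier R" "s' \<in> T" "t \<in> T" "t \<otimes> (s' \<otimes> a) = t \<otimes> (s \<otimes> b)"
  using assms by (auto simp: ring_frac_def frac_rel_def regular_module_def)

lemma carrier_A: "carrier A = {ring_frac a s | a s. a \<in> carrier R \<and> s \<in> T}"
  by (auto simp: loc_ring_def quotient_def ring_frac_def)

lemma L_smult:
  assumes "a \<in> carrier R" "q \<in> carrier R" "s \<in> T" "s' \<in> T"
  shows "ring_frac a s \<odot>\<^bsub>L\<^esub> frac q s' = frac (a \<otimes> q) (s \<otimes> s')"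
proof -
  have *: "frac_rel T M `` {(b \<odot>\<^bsub>M\<^esub> m, s1 \<otimes> s2)} = frac (a \<otimes> q) (s \<otimes> s')"
    if m: "(b, s1) \<in> ring_frac a s" "(m, s2) \<in> frac q s'" for b s1 m s2
  proof -
    obtain t where 1: "b \<in> carrier R" "s1 \<in> T" "t \<in> T" "t \<otimes> (s1 \<otimes> a) = t \<otimes> (s \<otimes> b)"
      using ring_frac_memD[OF m(1)] by (metis Pair_inject)
    obtain q1 where 2: "m = I +> q1" "q1 \<in> carrier R" "s2 \<in> T" "frac q1 s2 = frac q s'"
      using frac_memD[OF m(2)] assms by (metis Pair_inject)
    from 2 assms obtain t' where t': "t' \<in> T" "t' \<otimes> (s' \<otimes> q1 \<ominus> s2 \<otimes> q) \<in> I"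
      by (auto simp: frac_eq_iff)
    note carr = 1(1) 2(2) assms(1,2) assms(3,4)[THEN T_carrier] 1(2,3)[THEN T_carrier] 2(3)[THEN
        T_carrier]
      t'(1)[THEN T_carrier]
    have "(t \<otimes> t') \<otimes> ((s \<otimes> s') \<otimes> (b \<otimes> q1) \<ominus> (s1 \<otimes> s2) \<otimes> (a \<otimes> q))
      = (t' \<otimes> s' \<otimes> q1) \<otimes> (t \<otimes> (s \<otimes> b)) \<ominus> (t' \<otimes> s2 \<otimes> q) \<otimes> (t \<otimes> (s1 \<otimes> a))"
      using carr by algebra
    also have "\<dots> = (t \<otimes> s1 \<otimes> a) \<otimes> (t' \<otimes> (s' \<otimes> q1 \<ominus> s2 \<otimes> q))"
      unfolding 1(4)[symmetric] using carr by algebra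
    also have "\<dots> \<in> I" using carr by (intro quot.I_l_closed[OF t'(2)]) auto
    finally have "frac (b \<otimes> q1) (s1 \<otimes> s2) = frac (a \<otimes> q) (s \<otimes> s')"
      by (rule frac_eqI) (use carr T_mult 1(2,3) 2(3) assms t'(1) in simp_all)
    then show ?thesis using carr 2(1) by (simp add: frac_def)
  qed
  have ne: "(a, s) \<in> ring_frac a s" "(I +> q, s') \<in> frac q s'"
    using assms frac_self T_one by (auto simp: ring_frac_def frac_rel_def regular_module_def)
  have "frac_smult R T M (ring_frac a s) (frac q s') = frac (a \<otimes> q) (s \<otimes> s')"
    unfolding frac_smult_def using ne * by (rule UN_pairs_const)
  then show ?thesis by (simp add: loc_module_def)
qed

definition saturated where
  "saturated Q \<longleftrightarrow> ideal Q R \<and> I \<subseteq> Q \<and> (\<forall>t\<in>T. \<forall>p\<in>carrier R. t \<otimes> p \<in> Q \<longrightarrow> p \<in> Q)"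

lemma saturatedD: "\<lbrakk>saturated Q; t \<otimes> p \<in> Q; t \<in> T; p \<in> carrier R\<rbrakk> \<Longrightarrow> p \<in> Q"
  by (auto simp: saturated_def)

definition fracs where "fracs Q = {frac p s | p s. p \<in> Q \<and> s \<in> T}"

lemma fracsI: "\<lbrakk>p \<in> Q; s \<in> T\<rbrakk> \<Longrightarrow> frac p s \<in> fracs Q"
  by (auto simp: fracs_def)

lemma saturated_carrier: "saturated (carrier R)"
  using quot.a_subset by (simp add: saturated_def oneideal)

lemma fracs_carrier: "fracs (carrier R) = carrier L"
  by (simp add: fracs_def carrier_L)

text \<open>Saturation makes membership independent of the representative: an equality p/s = q/s'
  with \<open>q\<close> in \<open>Q\<close> puts a multiple of \<open>p\<close> by an element of
  \<open>T\<close> into \<open>Q\<close>, and that element cancels.\<close>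

lemma frac_in_fracs_iff:
  assumes Q: "saturated Q" and "p \<in> carrier R" "s \<in> T"
  shows "frac p s \<in> fracs Q \<longleftrightarrow> p \<in> Q"
proof
  interpret Q: ideal Q R using Q by (simp add: saturated_def)
  assume "frac p s \<in> fracs Q"
  then obtain q s' where q: "q \<in> Q" "s' \<in> T" "frac p s = frac q s'" by (auto simp: fracs_def)
  have q_carr: "q \<in> carrier R" using q(1) by (rule Q.a_Hcarr)
  obtain t where t: "t \<in> T" "t \<otimes> (s' \<otimes> p \<ominus> s \<otimes> q) \<in> I"
    using q(3) frac_eq_iff[OF assms(2) q_carr assms(3) q(2)] by blast
  note carr = assms(2) assms(3)[THEN T_carrier] q_carr q(2)[THEN T_carrier] t(1)[THEN T_carrier]
  have "(t \<otimes> s') \<otimes> p = t \<otimes> (s' \<otimes> p \<ominus> s \<otimes> q) \<oplus> (t \<otimes> s) \<otimes> q" using carr by algebra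
  also have "\<dots> \<in> Q"
    using Q t(2) q(1) carr by (intro Q.a_closed) (auto simp: saturated_def Q.I_l_closed)
  finally show "p \<in> Q" by (rule saturatedD[OF Q]) (use carr T_mult t q in simp_all)
qed (use assms in \<open>auto simp: fracs_def\<close>)

lemma fracs_subset_iff:
  assumes "saturated Q" "saturated Q'"
  shows "fracs Q \<subseteq> fracs Q' \<longleftrightarrow> Q \<subseteq> Q'"
proof
  assume *: "fracs Q \<subseteq> fracs Q'"
  interpret Q: ideal Q R using assms by (simp add: saturated_def)
  show "Q \<subseteq> Q'"
  proof
    fix p assume p: "p \<in> Q"
    then have "frac p \<one> \<in> fracs Q" using T_one by (auto simp: fracs_def)
    then show "p \<in> Q'" using * frac_in_fracs_iff[OF assms(2) _ T_one] p Q.a_Hcarr by blast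
  qed
qed (auto simp: fracs_def)

text \<open>\<open>submodule\<close> speaks of negation through \<open>m_inv\<close>, a definite
  description over the carrier of the record, and no group structure on \<open>L\<close> has been
  established. The inverse is therefore computed inside the record with carrier
  \<open>fracs Q\<close>, including its uniqueness.\<close>

lemma L_neg:
  assumes Q: "saturated Q" and p: "p \<in> Q" "s \<in> T"
  shows "\<ominus>\<^bsub>L\<lparr>carrier := fracs Q\<rparr>\<^esub> (frac p s) = frac (\<ominus> p) s"
proof -
  interpret Q: ideal Q R using Q by (simp add: saturated_def)
  have carr: "p \<in> carrier R" "s \<in> carrier R" using p Q.a_Hcarr by auto
  have zero: "frac x (s \<otimes> s') = frac \<zero> \<one>" if "x = \<zero>" "s' \<in> T" for x s'
    using that carr p T_mult T_one quot.zero_closed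
        by (subst frac_eq_iff) (auto intro!: bexI[of _ \<one>] simp: a_minus_def r_neg)
  have inv: "frac p s \<oplus>\<^bsub>L\<^esub> frac (\<ominus> p) s = frac \<zero> \<one>" "frac (\<ominus> p) s \<oplus>\<^bsub>L\<^esub> frac p s = frac \<zero> \<one>"
    using carr p by (auto simp: L_add r_minus r_neg l_neg intro!: zero)
  have uniq: "y = frac (\<ominus> p) s" if y: "y \<in> fracs Q" "frac p s \<oplus>\<^bsub>L\<^esub> y = frac \<zero> \<one>" for y
  proof -
    from y obtain q s' where q: "y = frac q s'" "q \<in> carrier R" "s' \<in> T" using Q.a_subset
        by (auto simp: fracs_def)
    then have "frac (s' \<otimes> p \<oplus> s \<otimes> q) (s \<otimes> s') = frac \<zero> \<one>" using y carr p by (simp add: L_add)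
    then obtain t where t: "t \<in> T" "t \<otimes> (\<one> \<otimes> (s' \<otimes> p \<oplus> s \<otimes> q) \<ominus> (s \<otimes> s') \<otimes> \<zero>) \<in> I"
      using carr q p T_mult T_one by (subst (asm) frac_eq_iff) auto
    have "t \<otimes> (s \<otimes> q \<ominus> s' \<otimes> (\<ominus> p)) = t \<otimes> (\<one> \<otimes> (s' \<otimes> p \<oplus> s \<otimes> q) \<ominus> (s \<otimes> s') \<otimes> \<zero>)"
      using carr q(2) T_carrier[OF q(3)] T_carrier[OF t(1)] by algebra
    then show ?thesis unfolding q(1) using t carr q p by (intro frac_eqI[of t]) simp_all
  qed
  have "m_inv (add_monoid (L\<lparr>carrier := fracs Q\<rparr>)) (frac p s) = frac (\<ominus> p) s"
    unfolding m_inv_def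
  proof (rule the_equality)
    show "frac (\<ominus> p) s \<in> carrier (add_monoid (L\<lparr>carrier := fracs Q\<rparr>)) \<and>
      frac p s \<otimes>\<^bsub>add_monoid (L\<lparr>carrier := fracs Q\<rparr>)\<^esub> frac (\<ominus> p) s = \<one>\<^bsub>add_monoid (L\<lparr>carrier := fracs Q\<rparr>)\<^esub>
          \<and>
      frac (\<ominus> p) s \<otimes>\<^bsub>add_monoid (L\<lparr>carrier := fracs Q\<rparr>)\<^esub> frac p s = \<one>\<^bsub>add_monoid (L\<lparr>carrier := fracs
          Q\<rparr>)\<^esub>"
      using inv p Q.a_inv_closed by (auto simp: L_zero fracs_def)
  qed (use uniq in \<open>auto simp: L_zero\<close>)
  then show ?thesis unfolding a_inv_def[of "L\<lparr>carrier := fracs Q\<rparr>"] .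
qed

lemma submodule_fracs_iff:
  assumes Q: "saturated Q"
  shows "submodule N A (L\<lparr>carrier := fracs Q\<rparr>) \<longleftrightarrow> (\<exists>Q'. saturated Q' \<and> Q' \<subseteq> Q \<and> N = fracs Q')"
proof
  interpret Q: ideal Q R using Q by (simp add: saturated_def)
  assume N: "submodule N A (L\<lparr>carrier := fracs Q\<rparr>)"
  have sub: "N \<subseteq> fracs Q" and zero: "frac \<zero> \<one> \<in> N" and add: "\<And>x y. x \<in> N \<Longrightarrow> y \<in> N \<Longrightarrow> x \<oplus>\<^bsub>L\<^esub> y \<in> N"
    and smult: "\<And>a x. a \<in> carrier A \<Longrightarrow> x \<in> N \<Longrightarrow> a \<odot>\<^bsub>L\<^esub> x \<in> N"
    using N by (auto simp: submodule_iff L_zero)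
  \<comment> \<open>The contraction of \<open>N\<close> along p -> p/1. By \<open>frac_iff\<close>
    it determines \<open>N\<close>, because s/1 and 1/s both act on \<open>N\<close>.\<close>
  define Q' where "Q' = {p \<in> carrier R. frac p \<one> \<in> N}"
  have smult': "frac (a \<otimes> p) (s \<otimes> s') \<in> N"
      if "frac p s' \<in> N" "a \<in> carrier R" "p \<in> carrier R" "s \<in> T" "s' \<in> T" for a p s s'
    using that smult[of "ring_frac a s" "frac p s'"] by (auto simp: L_smult carrier_A)
  have add': "p \<oplus> q \<in> Q'" if "p \<in> Q'" "q \<in> Q'" for p q
    using that add[of "frac p \<one>" "frac q \<one>"] T_one by (simp add: Q'_def L_add)
  have mult': "a \<otimes> p \<in> Q'" if "p \<in> Q'" "a \<in> carrier R" for a p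
    using that smult'[of p \<one> a \<one>] T_one by (simp add: Q'_def)
  have frac_iff: "frac p s \<in> N \<longleftrightarrow> p \<in> Q'" if "p \<in> carrier R" "s \<in> T" for p s
  proof
    assume "frac p s \<in> N"
    moreover have "frac (s \<otimes> p) (\<one> \<otimes> s) = frac p \<one>"
      using that T_one quot.zero_closed
      by (subst frac_eq_iff) (auto intro!: bexI[of _ \<one>] simp: a_minus_def r_neg)
    ultimately show "p \<in> Q'" using smult'[of p s s \<one>] that T_one by (simp add: Q'_def)
  next
    assume "p \<in> Q'"
    then show "frac p s \<in> N" using smult'[of p \<one> \<one> s] that T_one by (simp add: Q'_def)
  qed
  have "ideal Q' R"
  proof (rule idealI)
    show "ring R" by (rule ring_axioms)
    show "subgroup Q' (add_monoid R)"
    proof (rule add.subgroupI)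
      show "Q' \<subseteq> carrier R" "Q' \<noteq> {}" using zero by (auto simp: Q'_def)
      fix a assume a: "a \<in> Q'"
      then have "(\<ominus> \<one>) \<otimes> a \<in> Q'" by (intro mult') auto
      then show "\<ominus> a \<in> Q'" using a by (simp add: Q'_def l_minus)
    qed (use add' in auto)
  qed (use mult' m_comm in \<open>auto simp: Q'_def\<close>)
  moreover have "I \<subseteq> Q'"
  proof
    fix p assume p: "p \<in> I"
    then have "frac p \<one> = frac \<zero> \<one>"
      using T_one quot.a_Hcarr by (subst frac_eq_iff) (auto intro!: bexI[of _ \<one>] simp: a_minus_def)
    then show "p \<in> Q'" using zero p quot.a_Hcarr by (simp add: Q'_def)
  qed
  moreover have "p \<in> Q'" if "t \<in> T" "p \<in> carrier R" "t \<otimes> p \<in> Q'" for t p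
  proof -
    have "frac (t \<otimes> p) t = frac p \<one>"
      using that T_one quot.zero_closed
      by (subst frac_eq_iff) (auto intro!: bexI[of _ \<one>] simp: a_minus_def r_neg)
    then show ?thesis using frac_iff[of "t \<otimes> p" t] that by (auto simp: Q'_def)
  qed
  ultimately have "saturated Q'" by (auto simp: saturated_def)
  moreover have "Q' \<subseteq> Q"
    using sub frac_in_fracs_iff[OF Q _ T_one] by (auto simp: Q'_def)
  moreover have "N = fracs Q'"
  proof
    show "N \<subseteq> fracs Q'"
    proof
      fix x assume x: "x \<in> N"
      then obtain p s where "x = frac p s" "p \<in> carrier R" "s \<in> T" using sub Q.a_subset
          by (auto simp: fracs_def)
      then show "x \<in> fracs Q'" using frac_iff x by (auto simp: fracs_def)
    qed
    show "fracs Q' \<subseteq> N" using frac_iff by (auto simp: fracs_def Q'_def)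
  qed
  ultimately show "\<exists>Q'. saturated Q' \<and> Q' \<subseteq> Q \<and> N = fracs Q'" by blast
next
  assume "\<exists>Q'. saturated Q' \<and> Q' \<subseteq> Q \<and> N = fracs Q'"
  then obtain Q' where Q': "saturated Q'" "Q' \<subseteq> Q" and N: "N = fracs Q'" by blast
  interpret Q': ideal Q' R using Q' by (simp add: saturated_def)
  have "\<ominus>\<^bsub>L\<lparr>carrier := fracs Q\<rparr>\<^esub> x \<in> N" if "x \<in> N" for x
  proof -
    from that obtain p s where p: "x = frac p s" "p \<in> Q'" "s \<in> T" by (auto simp: N fracs_def)
    then have "\<ominus>\<^bsub>L\<lparr>carrier := fracs Q\<rparr>\<^esub> x = frac (\<ominus> p) s" using Q' L_neg[OF Q] by blast
    then show ?thesis using p Q'.a_inv_closed by (auto simp: N fracs_def)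
  qed
  moreover have "frac p s \<oplus>\<^bsub>L\<^esub> frac q s' \<in> N" if "p \<in> Q'" "q \<in> Q'" "s \<in> T" "s' \<in> T" for p q s s'
  proof -
    have "s' \<otimes> p \<oplus> s \<otimes> q \<in> Q'" using that by (intro Q'.a_closed Q'.I_l_closed) auto
    then show ?thesis using that Q'.a_Hcarr T_mult by (auto simp: N L_add fracs_def)
  qed
  moreover have "ring_frac a s \<odot>\<^bsub>L\<^esub> frac p s' \<in> N" if "a \<in> carrier R" "p \<in> Q'" "s \<in> T" "s' \<in> T"
      for a p s s'
    using that Q'.a_Hcarr Q'.I_l_closed T_mult by (auto simp: N L_smult intro: fracsI)
  moreover have "N \<subseteq> fracs Q" using Q' by (auto simp: N fracs_def)
  moreover have "frac \<zero> \<one> \<in> N" using T_one Q'.zero_closed by (simp add: N fracsI)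
  ultimately show "submodule N A (L\<lparr>carrier := fracs Q\<rparr>)"
    unfolding submodule_iff by (auto simp: L_zero carrier_A) (auto simp: N fracs_def)
qed

lemma submodule_L_iff: "submodule N A L \<longleftrightarrow> (\<exists>Q. saturated Q \<and> N = fracs Q)"
proof -
  have "L\<lparr>carrier := fracs (carrier R)\<rparr> = L" by (simp add: fracs_carrier)
  then show ?thesis
    using submodule_fracs_iff[OF saturated_carrier, of N] 
    by (auto simp: saturated_def dest: ideal.Icarr)
qed

definition saturated_chain where
  "saturated_chain Q k N \<longleftrightarrow> (\<forall>i\<le>k. saturated (N i) \<and> N i \<subseteq> Q) \<and> (\<forall>i<k. N i \<subset> N (Suc i))"

text \<open>The correspondence with saturated ideals preserves and reflects inclusion, so strict
  chains can be carried over in both directions.\<close>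

lemma module_length_fracs:
  assumes Q: "saturated Q"
  shows "module_length A (L\<lparr>carrier := fracs Q\<rparr>) = (SUP k
      \<in> {k. \<exists>N :: nat \<Rightarrow> _. saturated_chain Q k N}. enat k)"
proof -
  have "(\<exists>N :: nat \<Rightarrow> _. (\<forall>i\<le>k. submodule (N i) A (L\<lparr>carrier := fracs Q\<rparr>)) \<and> (\<forall>i<k. N i \<subset> N (Suc i)))
     \<longleftrightarrow> (\<exists>N :: nat \<Rightarrow> _. saturated_chain Q k N)" for k
  proof
    assume "\<exists>N :: nat \<Rightarrow> _. (\<forall>i\<le>k. submodule (N i) A (L\<lparr>carrier := fracs Q\<rparr>)) \<and> (\<forall>i<k. N i \<subset> N (Suc i))"
    then obtain N :: "nat \<Rightarrow> _" where N: "\<And>i. i \<le> k \<Longrightarrow> submodule (N i) A (L\<lparr>carrier := fracs Q\<rparr>)"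
        "\<And>i. i < k \<Longrightarrow> N i \<subset> N (Suc i)"
      by blast
    from N(1) have "\<forall>i. \<exists>Q'. i \<le> k \<longrightarrow> saturated Q' \<and> Q' \<subseteq> Q \<and> N i = fracs Q'"
      unfolding submodule_fracs_iff[OF Q] by blast
    then obtain N' where N': "\<And>i. i \<le> k \<Longrightarrow> saturated (N' i) \<and> N' i \<subseteq> Q \<and> N i = fracs (N' i)" by metis
    have "N' i \<subset> N' (Suc i)" if "i < k" for i
      using N(2)[OF that] N'[of i] N'[of "Suc i"] that fracs_subset_iff[of "N' i" "N' (Suc i)"] by auto
    then show "\<exists>N :: nat \<Rightarrow> _. saturated_chain Q k N" using N' unfolding saturated_chain_def by blast
  next
    assume "\<exists>N :: nat \<Rightarrow> _. saturated_chain Q k N"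
    then obtain N :: "nat \<Rightarrow> _" where N: "saturated_chain Q k N" by blast
    have "fracs (N i) \<subset> fracs (N (Suc i))" if "i < k" for i
    proof -
      have "saturated (N i)" "saturated (N (Suc i))" "N i \<subset> N (Suc i)"
        using N that by (auto simp: saturated_chain_def)
      then show ?thesis
          using fracs_subset_iff[of "N i" "N (Suc i)"] fracs_subset_iff[of "N (Suc i)" "N i"] by auto
    qed
    then show "\<exists>N :: nat \<Rightarrow> _. (\<forall>i\<le>k. submodule (N i) A (L\<lparr>carrier := fracs Q\<rparr>))
        \<and> (\<forall>i<k. N i \<subset> N (Suc i))"
      using N unfolding submodule_fracs_iff[OF Q] saturated_chain_def
      by (intro exI[of _ "\<lambda>i. fracs (N i)"]) blast
  qed
  then show ?thesis by (simp add: module_length_def)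
qed

lemma module_length_fracs_eq:
  assumes Q: "saturated Q" and N: "saturated_chain Q d N"
    and bound: "\<And>k N. saturated_chain Q k N \<Longrightarrow> k \<le> d"
  shows "module_length A (L\<lparr>carrier := fracs Q\<rparr>) = enat d"
  unfolding module_length_fracs[OF Q]
proof (rule antisym)
  show "(SUP k \<in> {k. \<exists>N :: nat \<Rightarrow> _. saturated_chain Q k N}. enat k) \<le> enat d"
    using bound by (auto intro!: SUP_least)
  show "enat d \<le> (SUP k \<in> {k. \<exists>N :: nat \<Rightarrow> _. saturated_chain Q k N}. enat k)"
    using N by (auto intro!: SUP_upper)
qed

lemma module_length_fracs_infinite:
  assumes Q: "saturated Q" and "\<And>k. \<exists>N. saturated_chain Q k N"
  shows "module_length A (L\<lparr>carrier := fracs Q\<rparr>) = \<infinity>"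
  unfolding module_length_fracs[OF Q]
proof (rule ccontr)
  assume "(SUP k \<in> {k. \<exists>N :: nat \<Rightarrow> _. saturated_chain Q k N}. enat k) \<noteq> \<infinity>"
  then obtain d where d: "(SUP k \<in> {k. \<exists>N :: nat \<Rightarrow> _. saturated_chain Q k N}. enat k) = enat d" by blast
  have "enat (Suc d) \<le> (SUP k \<in> {k. \<exists>N :: nat \<Rightarrow> _. saturated_chain Q k N}. enat k)"
    using assms(2) by (intro SUP_upper) auto
  then show False using d by simp
qed

text \<open>This resolves the \<open>GREATEST\<close> in the definition, taken with respect to
  inclusion: \<open>H\<close> has finite length by \<open>bound\<close>, and a submodule of finite
  length cannot come from a saturated ideal that leaves \<open>H\<close>, since such an ideal admits
  chains of every length.\<close>

lemma length_of_largest_finite_length_submodule: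
  assumes H: "saturated H" "saturated_chain H d N"
    and bound: "\<And>k N. saturated_chain H k N \<Longrightarrow> k \<le> d"
    and largest: "\<And>Q. saturated Q \<Longrightarrow> \<not> Q \<subseteq> H \<Longrightarrow> \<forall>k. \<exists>N. saturated_chain Q k N"
  shows "module_length A (L\<lparr>carrier := largest_finite_length_submodule A L\<rparr>) = enat d"
proof -
  have "largest_finite_length_submodule A L = fracs H"
    unfolding largest_finite_length_submodule_def
  proof (rule Greatest_equality)
    show "submodule (fracs H) A L \<and> module_length A (L\<lparr>carrier := fracs H\<rparr>) < \<infinity>"
      using module_length_fracs_eq[OF H bound] H by (auto simp: submodule_L_iff)
  next
    fix Y assume Y: "submodule Y A L \<and> module_length A (L\<lparr>carrier := Y\<rparr>) < \<infinity>"
    then obtain Q where Q: "saturated Q" "Y = fracs Q" by (auto simp: submodule_L_iff)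
    then have "Q \<subseteq> H" using largest[OF Q(1)] module_length_fracs_infinite[OF Q(1)] Y by force
    then show "Y \<subseteq> fracs H" using Q by (auto simp: fracs_def)
  qed
  then show ?thesis using module_length_fracs_eq[OF H bound] by simp
qed

end

section \<open>Polynomials and monomials\<close>

declare One_nat_def [simp del]

abbreviation "keys \<equiv> Poly_Mapping.keys"
abbreviation "lookup \<equiv> Poly_Mapping.lookup"
abbreviation "single \<equiv> Poly_Mapping.single"

text \<open>Polymorphic because it serves two levels: on exponent vectors it keeps the part in
  certain variables, on polynomials it keeps the terms with certain exponents.\<close>

definition pm_restrict :: "'a set \<Rightarrow> ('a \<Rightarrow>\<^sub>0 'b::zero) \<Rightarrow> ('a \<Rightarrow>\<^sub>0 'b)" where
  "pm_restrict X f = Poly_Mapping.mapp (\<lambda>i c. c when i \<in> X) f"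

lemma lookup_pm_restrict: "lookup (pm_restrict X f) i = (if i \<in> X then lookup f i else 0)"
  by (auto simp: pm_restrict_def lookup_mapp when_def in_keys_iff)

lemma keys_pm_restrict [simp]: "keys (pm_restrict X f) = keys f \<inter> X"
  by (auto simp: in_keys_iff lookup_pm_restrict split: if_splits)

lemma pm_restrict_add:
    "pm_restrict X (f + g) = pm_restrict X f + (pm_restrict X g :: 'a \<Rightarrow>\<^sub>0 'b::monoid_add)"
  by (rule poly_mapping_eqI) (simp add: lookup_pm_restrict lookup_add)

lemma pm_restrict_split: "pm_restrict X f + pm_restrict (- X) f = (f :: 'a \<Rightarrow>\<^sub>0 'b::monoid_add)"
  by (rule poly_mapping_eqI) (simp add: lookup_pm_restrict lookup_add)

lemma pm_restrict_id: "keys f \<subseteq> X \<Longrightarrow> pm_restrict X f = f"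
  by (rule poly_mapping_eqI) (auto simp: lookup_pm_restrict in_keys_iff)

lemma pm_restrict_eq_0: "keys f \<inter> X = {} \<Longrightarrow> pm_restrict X f = 0"
  by (rule poly_mapping_eqI) (auto simp: lookup_pm_restrict in_keys_iff)

lemma keys_add_nat: "keys (u + v) = keys u \<union> keys (v :: 'a \<Rightarrow>\<^sub>0 nat)"
  by (auto simp: in_keys_iff lookup_add)

lemma keys_uminus: "keys (- p) = keys (p :: 'a \<Rightarrow>\<^sub>0 'b::ab_group_add)"
  by (auto simp: in_keys_iff)

lemma keys_diff_subset: "keys (p - q) \<subseteq> keys p \<union> keys (q :: 'a \<Rightarrow>\<^sub>0 'b::ab_group_add)"
  by (auto simp: in_keys_iff lookup_minus)

text \<open>The library order on exponent vectors is lexicographic, decided at the smallest index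
  where the vectors differ; a nonzero \<open>v\<close> exceeds 0 at its least key. Being also
  compatible with addition, it is a monomial order.\<close>

lemma expo_nonneg: "0 \<le> (v :: nat \<Rightarrow>\<^sub>0 nat)"
proof (cases "v = 0")
  case False
  then have ne: "keys v \<noteq> {}" by (metis keys_eq_empty)
  define k where "k = Min (keys v)"
  have "k \<in> keys v" "\<And>k'. k' < k \<Longrightarrow> k' \<notin> keys v"
    using ne by (auto simp: k_def)
  then have "less_fun (\<lambda>_. 0) (lookup v)"
    unfolding less_fun_def by (intro exI[of _ k]) (auto simp: in_keys_iff)
  then have "0 < v" by (simp add: less_poly_mapping.rep_eq zero_poly_mapping.rep_eq)
  then show ?thesis by simp
qed simp

lemma poly_eq_sum_single: "p = (\<Sum>v\<in>keys p. single v (lookup p v))"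
proof (rule poly_mapping_eqI)
  fix w
  have "(\<Sum>v\<in>keys p. lookup (single v (lookup p v)) w) =
     (\<Sum>v\<in>keys p. if v = w then lookup p v else 0)"
    by (intro sum.cong) (auto simp: lookup_single when_def)
  then show "lookup p w = lookup (\<Sum>v\<in>keys p. single v (lookup p v)) w"
    by (simp add: lookup_sum in_keys_iff)
qed

lemma keys_single_mult:
  fixes p :: "'k::field mpoly"
  assumes "c \<noteq> 0"
  shows "keys (single u c * p) = (+) u ` keys p"
proof
  have eq: "single u c * p = (\<Sum>v\<in>keys p. single (u + v) (c * lookup p v))"
    by (subst (1) poly_eq_sum_single[of p]) (simp add: sum_distrib_left mult_single)
  show "keys (single u c * p) \<subseteq> (+) u ` keys p"
    unfolding eq by (rule order.trans[OF keys_sum]) (auto split: if_splits)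
  show "(+) u ` keys p \<subseteq> keys (single u c * p)"
  proof safe
    fix w assume w: "w \<in> keys p"
    have "lookup (single u c * p) (u + w) =
        (\<Sum>v\<in>keys p. if v = w then c * lookup p v else 0)"
      unfolding eq lookup_sum by (intro sum.cong) (auto simp: lookup_single when_def)
    also have "\<dots> = c * lookup p w" using w by simp
    finally show "u + w \<in> keys (single u c * p)"
      using w assms by (simp add: in_keys_iff)
  qed
qed

lemma keys_monomial_mult: "keys (monomial u * p) = (+) u ` keys (p :: 'k::field mpoly)"
  by (simp add: monomial_def keys_single_mult)

lemma keys_monomial [simp]: "keys (monomial u) = {u}"
  by (simp add: monomial_def)

lemma monomial_mult: "monomial u * monomial v = monomial (u + v)"
  by (simp add: monomial_def mult_single)

lemma keys_mult_memE:
  assumes "v \<in> keys (p * q :: 'k::field mpoly)"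
  obtains a b where "v = a + b" "a \<in> keys p" "b \<in> keys q"
  using assms keys_mult[of p q] by blast

lemma factor_monomial:
  fixes p :: "'k::field mpoly"
  assumes "\<And>v. v \<in> keys p \<Longrightarrow> \<exists>z\<in>W. v = u + z"
  obtains f where "keys f \<subseteq> W" "p = monomial u * f"
proof
  have W: "v - u \<in> W \<and> v = u + (v - u)" if v: "v \<in> keys p" for v
    using assms[OF v] by auto
  let ?f = "\<Sum>v\<in>keys p. single (v - u) (lookup p v)"
  show "keys ?f \<subseteq> W"
    by (rule order.trans[OF keys_sum]) (use W in \<open>auto split: if_splits\<close>)
  have "monomial u * ?f = (\<Sum>v\<in>keys p. single v (lookup p v))"
    unfolding sum_distrib_left
    by (intro sum.cong) (use W in \<open>auto simp: monomial_def mult_single\<close>)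
  then show "p = monomial u * ?f" by (simp flip: poly_eq_sum_single)
qed

text \<open>Initial terms: exponent vectors are graded by their part in the variables of
  \<open>A\<close>, and the grades are compared in the library's linear order on exponent
  vectors.\<close>

lemma mult_key:
  fixes p t :: "'k::field mpoly"
  assumes t: "t \<noteq> 0" and p: "p \<noteq> 0"
  obtains v where "v \<in> keys (t * p)"
    "pm_restrict A v = Min (pm_restrict A ` keys t) + Min (pm_restrict A ` keys p)"
proof -
  define a where "a = Min (pm_restrict A ` keys p)"
  define c where "c = Min (pm_restrict A ` keys t)"
  have ne: "keys p \<noteq> {}" "keys t \<noteq> {}" using p t by (metis keys_eq_empty)+
  have a_in: "a \<in> pm_restrict A ` keys p" unfolding a_def using ne by (intro Min_in) auto
  have c_in: "c \<in> pm_restrict A ` keys t" unfolding c_def using ne by (intro Min_in) auto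
  have a_le: "a \<le> pm_restrict A v" if "v \<in> keys p" for v
    unfolding a_def using that by (intro Min_le) auto
  have c_le: "c \<le> pm_restrict A v" if "v \<in> keys t" for v
    unfolding c_def using that by (intro Min_le) auto
  \<comment> \<open>Split off the parts \<open>p1\<close> and \<open>t1\<close> of lowest grade.
    Their product is nonzero and has pure grade \<open>c + a\<close>; the three other products
    contain only terms of strictly larger grade, so a key of \<open>t1 * p1\<close> survives in
    \<open>t * p\<close>.\<close>
  let ?X = "{v. pm_restrict A v = a}" and ?Y = "{v. pm_restrict A v = c}"
  define p1 where "p1 = pm_restrict ?X p"
  define p2 where "p2 = pm_restrict (- ?X) p"
  define t1 where "t1 = pm_restrict ?Y t"
  define t2 where "t2 = pm_restrict (- ?Y) t"
  have keys: "keys p1 = keys p \<inter> ?X" "keys p2 = keys p \<inter> - ?X"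
    "keys t1 = keys t \<inter> ?Y" "keys t2 = keys t \<inter> - ?Y"
    by (simp_all add: p1_def p2_def t1_def t2_def)
  have "p1 \<noteq> 0" "t1 \<noteq> 0"
    using a_in c_in keys(1,3) by auto
  then have "t1 * p1 \<noteq> 0" by simp
  then obtain v where v: "v \<in> keys (t1 * p1)" by (metis keys_eq_empty ex_in_conv)
  then have va: "pm_restrict A v = c + a"
    by (elim keys_mult_memE) (simp add: keys pm_restrict_add)
  have "a1 + b1 \<noteq> c + a" if "c \<le> a1" "a \<le> b1" "a1 \<noteq> c \<or> b1 \<noteq> a" for a1 b1 :: "nat \<Rightarrow>\<^sub>0 nat"
  proof -
    have "c + a < a1 + b1"
      using that by (metis add_le_less_mono add_less_le_mono order.not_eq_order_implies_strict)
    then show ?thesis by simp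
  qed
  then have sum_ne: "\<lbrakk>c \<le> a1; a \<le> b1; a1 + b1 = c + a\<rbrakk> \<Longrightarrow> a1 = c \<and> b1 = a" for a1 b1 by blast
  have no: "v \<notin> keys (t' * p')"
    if "keys t' \<subseteq> keys t" "keys p' \<subseteq> keys p"
      "keys t' \<inter> ?Y = {} \<or> keys p' \<inter> ?X = {}" for t' p' :: "'k mpoly"
  proof
    assume "v \<in> keys (t' * p')"
    then obtain x y where xy: "v = x + y" "x \<in> keys t'" "y \<in> keys p'"
      by (rule keys_mult_memE)
    then have "pm_restrict A x = c \<and> pm_restrict A y = a"
      using va that c_le[of x] a_le[of y] by (intro sum_ne) (auto simp: pm_restrict_add)
    then show False using xy that by auto
  qed
  have "t * p = (t1 + t2) * (p1 + p2)"
    by (simp add: p1_def p2_def t1_def t2_def pm_restrict_split)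
  also have "\<dots> = t1 * p1 + t1 * p2 + t2 * p1 + t2 * p2" by (simp add: algebra_simps)
  finally have "lookup (t * p) v = lookup (t1 * p1) v"
    using no[of t1 p2] no[of t2 p1] no[of t2 p2] keys by (auto simp: lookup_add in_keys_iff)
  then show ?thesis using that[of v] v va by (simp add: a_def c_def in_keys_iff)
qed

text \<open>This is how elements outside the prime enter: a term free of the variables
  \<open>A\<close> has grade 0, the least possible. By \<open>mult_key\<close>, multiplication by
  such a \<open>t\<close> then keeps the lowest grade of a polynomial.\<close>

lemma Min_restrict_eq_0:
  fixes t :: "'k::field mpoly"
  assumes "u \<in> keys t" "keys u \<inter> A = {}"
  shows "Min (pm_restrict A ` keys t) = 0"
proof (rule antisym)
  have "pm_restrict A u = 0" using assms(2) by (rule pm_restrict_eq_0)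
  then show "Min (pm_restrict A ` keys t) \<le> 0" using assms(1) by (intro Min_le) force+
qed (rule expo_nonneg)

section \<open>Polynomials with prescribed exponents, and monomial ideals as sets of
  exponents\<close>

definition exps :: "nat set \<Rightarrow> (nat \<Rightarrow>\<^sub>0 nat) set" where
  "exps Z = {v. keys v \<subseteq> Z}"

definition polys_over :: "(nat \<Rightarrow>\<^sub>0 nat) set \<Rightarrow> 'k::field mpoly set" where
  "polys_over X = {p. keys p \<subseteq> X}"

lemma polys_in_eq: "polys_in Z = polys_over (exps Z)"
  by (auto simp: polys_in_def polys_over_def exps_def)

lemma zero_in_exps [simp]: "0 \<in> exps Z"
  by (simp add: exps_def)

lemma exps_add_iff [simp]: "u + v \<in> exps Z \<longleftrightarrow> u \<in> exps Z \<and> v \<in> exps Z"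
  by (simp add: exps_def keys_add_nat)

lemma single_in_exps: "j \<in> Z \<Longrightarrow> single j m \<in> exps Z"
  by (simp add: exps_def)

lemma exps_mono: "Y \<subseteq> Z \<Longrightarrow> exps Y \<subseteq> exps Z"
  by (auto simp: exps_def)

lemma polys_over_zero [simp]: "0 \<in> polys_over X"
  by (simp add: polys_over_def)

lemma polys_over_add: "\<lbrakk>p \<in> polys_over X; q \<in> polys_over X\<rbrakk> \<Longrightarrow> p + q \<in> polys_over X"
  using keys_add[of p q] by (auto simp: polys_over_def)

lemma polys_over_uminus: "p \<in> polys_over X \<Longrightarrow> - p \<in> polys_over X"
  by (simp add: polys_over_def keys_uminus)

lemma polys_over_diff: "\<lbrakk>p \<in> polys_over X; q \<in> polys_over X\<rbrakk> \<Longrightarrow> p - q \<in> polys_over X"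
  using keys_diff_subset[of p q] by (auto simp: polys_over_def)

lemma polys_over_mono: "X \<subseteq> Y \<Longrightarrow> polys_over X \<subseteq> polys_over Y"
  by (auto simp: polys_over_def)

lemma polys_over_sum: "(\<And>i. i \<in> F \<Longrightarrow> f i \<in> polys_over X) \<Longrightarrow> sum f F \<in> polys_over X"
  by (induction F rule: infinite_finite_induct) (auto intro: polys_over_add)

lemma monomial_in_polys_over [simp]: "monomial u \<in> polys_over X \<longleftrightarrow> u \<in> X"
  by (simp add: polys_over_def)

lemma single_in_polys_over: "u \<in> X \<Longrightarrow> single u c \<in> polys_over X"
  by (simp add: polys_over_def)

lemma polys_over_mult:
  "\<lbrakk>p \<in> polys_over X; q \<in> polys_over Y; \<And>u v. u \<in> X \<Longrightarrow> v \<in> Y \<Longrightarrow> u + v \<in> W\<rbrakk> \<Longrightarrow> p * q \<in> polys_over W"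
  using keys_mult[of p q] by (fastforce simp: polys_over_def)

lemma one_in_polys_over: "0 \<in> X \<Longrightarrow> 1 \<in> polys_over X"
  by (simp add: polys_over_def)

lemma polys_in_closed:
  assumes "p \<in> polys_in Z" "q \<in> polys_in Z"
  shows "p + q \<in> polys_in Z" "p - q \<in> polys_in Z" "- p \<in> polys_in Z" "p * q \<in> polys_in Z"
  using assms polys_over_mult[of p "exps Z" q "exps Z" "exps Z"]
  by (auto simp: polys_in_eq polys_over_add polys_over_diff polys_over_uminus)

lemma carrier_poly_ring [simp]: "carrier (poly_ring n) = polys_in {1..n}"
  and mult_poly_ring [simp]: "x \<otimes>\<^bsub>poly_ring n\<^esub> y = x * y"
  and one_poly_ring [simp]: "\<one>\<^bsub>poly_ring n\<^esub> = 1"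
  and zero_poly_ring [simp]: "\<zero>\<^bsub>poly_ring n\<^esub> = 0"
  and add_poly_ring [simp]: "x \<oplus>\<^bsub>poly_ring n\<^esub> y = x + y"
  by (simp_all add: poly_ring_def)

lemma domain_poly_ring: "domain (poly_ring n :: 'k::field mpoly ring)"
proof -
  have "cring (poly_ring n :: 'k mpoly ring)"
  proof (rule cringI)
    show "abelian_group (poly_ring n :: 'k mpoly ring)"
    proof (rule abelian_groupI)
      fix x :: "'k mpoly" assume "x \<in> carrier (poly_ring n)"
      then show "\<exists>y\<in>carrier (poly_ring n). y \<oplus>\<^bsub>poly_ring n\<^esub> x = \<zero>\<^bsub>poly_ring n\<^esub>"
        by (intro bexI[of _ "- x"]) (auto intro: polys_in_closed)
    qed (auto simp: algebra_simps polys_in_eq polys_over_add)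
    show "comm_monoid (poly_ring n :: 'k mpoly ring)"
      by (rule comm_monoidI) (auto simp: algebra_simps polys_in_closed polys_in_eq[of
          "{1..n}"] one_in_polys_over
          intro: polys_over_mult)
  qed (auto simp: algebra_simps)
  then show ?thesis
    by (intro domain.intro domain_axioms.intro) auto
qed

interpretation poly_ring: domain "poly_ring n :: 'k::field mpoly ring" for n
  by (rule domain_poly_ring)

lemma a_inv_poly_ring [simp]: "p \<in> polys_in {1..n} \<Longrightarrow> \<ominus>\<^bsub>poly_ring n\<^esub> p = - p"
  by (rule poly_ring.minus_equality) (simp_all add: polys_in_closed)

lemma a_minus_poly_ring [simp]:
  "\<lbrakk>p \<in> polys_in {1..n}; q \<in> polys_in {1..n}\<rbrakk> \<Longrightarrow> p \<ominus>\<^bsub>poly_ring n\<^esub> q = p - q"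
  by (simp add: a_minus_def)

lemma ideal_poly_ringI:
  fixes J :: "'k::field mpoly set"
  assumes "J \<subseteq> polys_in {1..n}" "0 \<in> J" "\<And>p q. p \<in> J \<Longrightarrow> q \<in> J \<Longrightarrow> p + q \<in> J"
    and mult: "\<And>f p. f \<in> polys_in {1..n} \<Longrightarrow> p \<in> J \<Longrightarrow> f * p \<in> J"
  shows "ideal J (poly_ring n)"
proof (rule idealI)
  show "ring (poly_ring n)" by (rule poly_ring.ring_axioms)
  show "subgroup J (add_monoid (poly_ring n))"
  proof (rule poly_ring.add.subgroupI)
    fix a assume a: "a \<in> J"
    have "- 1 \<in> polys_in {1..n}"
      by (simp add: polys_in_eq polys_over_uminus one_in_polys_over)
    then have "- 1 * a \<in> J" using a by (rule mult)
    moreover have "a \<in> polys_in {1..n}" using a assms by blast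
    ultimately show "\<ominus>\<^bsub>poly_ring n\<^esub> a \<in> J" by simp
  qed (use assms in auto)
next
  fix a x :: "'k mpoly" assume "a \<in> J" "x \<in> carrier (poly_ring n)"
  then show "x \<otimes>\<^bsub>poly_ring n\<^esub> a \<in> J" "a \<otimes>\<^bsub>poly_ring n\<^esub> x \<in> J"
    using mult[of x a] by (simp_all add: mult.commute)
qed

lemma ideal_poly_ringD:
  fixes J :: "'k::field mpoly set"
  assumes "ideal J (poly_ring n)"
  shows "J \<subseteq> polys_in {1..n}" "0 \<in> J" "\<And>p q. p \<in> J \<Longrightarrow> q \<in> J \<Longrightarrow> p + q \<in> J"
    "\<And>p q. p \<in> J \<Longrightarrow> q \<in> J \<Longrightarrow> p - q \<in> J"
    "\<And>f p. f \<in> polys_in {1..n} \<Longrightarrow> p \<in> J \<Longrightarrow> f * p \<in> J"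
    "\<And>f F. (\<And>i. i \<in> F \<Longrightarrow> f i \<in> J) \<Longrightarrow> sum f F \<in> J"
proof -
  interpret J: ideal J "poly_ring n" by fact
  show sub: "J \<subseteq> polys_in {1..n}" using J.a_subset by simp
  show zero: "0 \<in> J" using J.zero_closed by simp
  show add: "p + q \<in> J" if "p \<in> J" "q \<in> J" for p q using J.a_closed that by simp
  show "f * p \<in> J" if "f \<in> polys_in {1..n}" "p \<in> J" for f p using J.I_l_closed that by simp
  have uminus: "- q \<in> J" if "q \<in> J" for q using J.a_inv_closed[OF that] subsetD[OF sub that] by simp
  show "p - q \<in> J" if "p \<in> J" "q \<in> J" for p q using add[OF that(1) uminus[OF that(2)]] by simp
  show "sum f F \<in> J" if "\<And>i. i \<in> F \<Longrightarrow> f i \<in> J" for f and F :: "'c set"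
    using that by (induction F rule: infinite_finite_induct) (auto intro: zero add)
qed

lemma monomial_closed_poly:
  assumes J: "ideal J (poly_ring n)" and p: "p \<in> polys_in {1..n}"
    and *: "\<And>v. v \<in> keys p \<Longrightarrow> monomial v \<in> J"
  shows "p \<in> J"
proof -
  have "single v c \<in> J" if "v \<in> keys p" for v c
  proof -
    have "single 0 c * monomial v \<in> J"
      using *[OF that] by (intro ideal_poly_ringD(5)[OF J]) (auto simp: polys_in_eq single_in_polys_over)
    then show ?thesis by (simp add: monomial_def mult_single)
  qed
  then show ?thesis
    by (subst poly_eq_sum_single) (auto intro: ideal_poly_ringD(6)[OF J])
qed

text \<open>Ideals of the additive monoid \<open>exps Z\<close>. With \<open>Z = {1..n}\<close> they
  are the exponent sets of monomial ideals; with the variables \<open>A\<close> in place of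
  \<open>Z\<close> they are the conditions on \<open>A\<close>-parts that cut out ideals of the
  composition series.\<close>

definition expo_ideal :: "nat set \<Rightarrow> (nat \<Rightarrow>\<^sub>0 nat) set \<Rightarrow> bool" where
  "expo_ideal Z E \<longleftrightarrow> E \<subseteq> exps Z \<and> (\<forall>u\<in>E. \<forall>v\<in>exps Z. u + v \<in> E)"

lemma expo_idealD: "\<lbrakk>expo_ideal Z E; u \<in> E; v \<in> exps Z\<rbrakk> \<Longrightarrow> u + v \<in> E"
  by (simp add: expo_ideal_def)

lemma ideal_polys_over:
  assumes "expo_ideal {1..n} E"
  shows "ideal (polys_over E) (poly_ring n :: 'k::field mpoly ring)"
proof (rule ideal_poly_ringI)
  show "polys_over E \<subseteq> polys_in {1..n}"
    using assms by (auto simp: polys_in_eq expo_ideal_def polys_over_def)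
  show "f * p \<in> polys_over E" if "f \<in> polys_in {1..n}" "p \<in> polys_over E" for f p :: "'k mpoly"
  proof (rule polys_over_mult)
    show "f \<in> polys_over (exps {1..n})" "p \<in> polys_over E" using that by (simp_all add: polys_in_eq)
    show "u + v \<in> E" if "u \<in> exps {1..n}" "v \<in> E" for u v
      using expo_idealD[OF assms that(2,1)] by (simp add: add.commute)
  qed
qed (auto intro: polys_over_add)

definition expo_gen :: "nat set \<Rightarrow> (nat \<Rightarrow>\<^sub>0 nat) set \<Rightarrow> (nat \<Rightarrow>\<^sub>0 nat) set" where
  "expo_gen Z U = {u + v | u v. u \<in> U \<and> v \<in> exps Z}"

lemma expo_genI: "\<lbrakk>u \<in> U; v \<in> exps Z\<rbrakk> \<Longrightarrow> u + v \<in> expo_gen Z U"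
  by (auto simp: expo_gen_def)

lemma expo_gen_superset: "U \<subseteq> expo_gen Z U"
  using expo_genI[of _ U 0 Z] by auto

lemma expo_ideal_generated: "U \<subseteq> exps Z \<Longrightarrow> expo_ideal Z (expo_gen Z U)"
  unfolding expo_ideal_def by (auto simp: expo_gen_def add.assoc subset_iff) (metis exps_add_iff)

lemma expo_gen_id: "expo_ideal Z E \<Longrightarrow> expo_gen Z E = E"
  using expo_gen_superset[of E Z] by (auto simp: expo_gen_def expo_ideal_def)

lemma Idl_monomials:
  assumes U: "U \<subseteq> exps {1..n}"
  shows "Idl\<^bsub>poly_ring n\<^esub> (monomial ` U :: 'k::field mpoly set) = polys_over (expo_gen {1..n} U)"
    (is "?I = polys_over ?E")
proof
  have U': "monomial ` U \<subseteq> carrier (poly_ring n :: 'k mpoly ring)" using U by (auto simp: polys_in_eq)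
  have E: "expo_ideal {1..n} ?E" using U by (rule expo_ideal_generated)
  show "?I \<subseteq> polys_over ?E"
    by (rule poly_ring.genideal_minimal[OF ideal_polys_over[OF E]]) (use expo_gen_superset[of U
        "{1..n}"] in auto)
  show "polys_over ?E \<subseteq> ?I"
  proof
    fix p :: "'k mpoly" assume p: "p \<in> polys_over ?E"
    have I: "ideal ?I (poly_ring n)" using U' by (rule poly_ring.genideal_ideal)
    show "p \<in> ?I"
    proof (rule monomial_closed_poly[OF I])
      show "p \<in> polys_in {1..n}" using p E by (auto simp: polys_over_def polys_in_eq expo_ideal_def)
      fix v assume "v \<in> keys p"
      then obtain u w where v: "v = w + u" "u \<in> U" "w \<in> exps {1..n}"
        using p by (auto simp: polys_over_def expo_gen_def add.commute)
      have "monomial u \<in> ?I" using poly_ring.genideal_self[OF U'] v by blast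
      then have "monomial w * monomial u \<in> ?I"
        using v by (intro ideal_poly_ringD(5)[OF I]) (auto simp: polys_in_eq)
      then show "monomial v \<in> ?I" by (simp add: monomial_mult v)
    qed
  qed
qed

text \<open>From here on a monomial ideal is handled through \<open>E\<close>, the set of all its
  exponents and not only those of generators.\<close>

lemma monomial_ideal_iff:
  "monomial_ideal n (I :: 'k::field mpoly set) \<longleftrightarrow> (\<exists>E. expo_ideal {1..n} E \<and> I = polys_over E)"
proof
  assume "monomial_ideal n I"
  then obtain U where "U \<subseteq> exps {1..n}" "I = Idl\<^bsub>poly_ring n\<^esub> (monomial ` U)"
    by (auto simp: monomial_ideal_def exps_def)
  then show "\<exists>E. expo_ideal {1..n} E \<and> I = polys_over E"
    using Idl_monomials[of U n] expo_ideal_generated[of U "{1..n}"] by metis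
next
  assume "\<exists>E. expo_ideal {1..n} E \<and> I = polys_over E"
  then obtain E where E: "expo_ideal {1..n} E" "I = polys_over E" by blast
  then have sub: "E \<subseteq> exps {1..n}" by (simp add: expo_ideal_def)
  then show "monomial_ideal n I"
    unfolding monomial_ideal_def using E Idl_monomials[OF sub, where 'k='k] expo_gen_id[OF E(1)]
    by (intro exI[of _ E]) (auto simp: exps_def)
qed

section \<open>Saturated ideals and the length multiplicity\<close>

text \<open>Dickson's lemma in terms of sequences, by treating one coordinate after the other: a
  sequence of naturals has a monotone subsequence, and a nonincreasing one is eventually constant,
  hence nondecreasing from some index on.\<close>

lemma monotone_subsequence_exps:
  fixes f :: "nat \<Rightarrow> (nat \<Rightarrow>\<^sub>0 nat)"
  assumes "finite A"
  shows "\<exists>g :: nat \<Rightarrow> nat. strict_mono g \<and> (\<forall>j\<in>A. mono (\<lambda>i. lookup (f (g i)) j))"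
  using assms
proof induction
  case empty
  show ?case by (intro exI[of _ id]) (simp add: strict_mono_def)
next
  case (insert j A)
  then obtain g :: "nat \<Rightarrow> nat" where g: "strict_mono g" "\<And>j. j \<in> A \<Longrightarrow> mono (\<lambda>i. lookup (f (g i)) j)"
      by blast
  let ?s = "\<lambda>i. lookup (f (g i)) j"
  obtain h :: "nat \<Rightarrow> nat" where h: "strict_mono h" "monoseq (\<lambda>i. ?s (h i))" using seq_monosub[of ?s]
      by blast
  obtain h' :: "nat \<Rightarrow> nat" where h': "strict_mono h'" "mono (\<lambda>i. ?s (h (h' i)))"
  proof (cases "\<forall>m. \<forall>n\<ge>m. ?s (h m) \<le> ?s (h n)")
    case True
    then show ?thesis using that[of id] by (auto simp: strict_mono_def mono_def)
  next
    case False
    then have dec: "?s (h n) \<le> ?s (h m)" if "m \<le> n" for m n using h(2) that unfolding monoseq_def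
        by blast
    define m where "m = (LEAST c. \<exists>i. ?s (h i) = c)"
    have "\<exists>i. ?s (h i) = m" unfolding m_def by (rule LeastI_ex) blast
    then obtain i where i: "?s (h i) = m" by blast
    have "?s (h (i + k)) = m" for k
    proof (rule antisym)
      show "?s (h (i + k)) \<le> m" using dec[of i "i + k"] i by simp
      show "m \<le> ?s (h (i + k))" unfolding m_def by (rule Least_le) blast
    qed
    then show ?thesis using that[of "\<lambda>k. i + k"] by (auto simp: strict_mono_def mono_def)
  qed
  have "strict_mono (g \<circ> h \<circ> h')" using g h h' by (intro strict_mono_o)
  moreover have "mono (\<lambda>i. lookup (f ((g \<circ> h \<circ> h') i)) j')" if "j' \<in> insert j A" for j'
  proof (cases "j' = j")
    case True
    then show ?thesis using h' by simp
  next
    case False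
    have "mono (h \<circ> h')" using h h' strict_mono_o strict_mono_mono by metis
    then show ?thesis using g(2)[of j'] False that by (auto simp: mono_def)
  qed
  ultimately show ?case by blast
qed

text \<open>The coefficient field occurs neither in \<open>E\<close> nor in \<open>A\<close>;
  \<open>field_type\<close> supplies one fixed coefficient type for the ideals of the
  locale.\<close>

locale monomial_localization =
  fixes n :: nat and E :: "(nat \<Rightarrow>\<^sub>0 nat) set" and A :: "nat set" and field_type :: "'k::field itself"
  assumes E: "expo_ideal {1..n} E" and A: "A \<subseteq> {1..n}"
begin

definition Z where "Z = {1..n} - A"

text \<open>\<open>E\<close> is the set of exponents of the monomials of an ideal \<open>I\<close>,
  and \<open>P\<close> is the ideal generated by the variables of \<open>A\<close>. Then
  \<open>sat_exps\<close> and \<open>std_exps\<close> are the exponents \<open>a\<close> of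
  monomials in the variables of \<open>A\<close> that vanish in the localization
  \<open>(S/I)\<^sub>P\<close>, and that do not vanish there but are annihilated by a power of
  \<open>P\<close>.\<close>

definition sat_exps where "sat_exps = {a \<in> exps A. \<exists>z\<in>exps Z. a + z \<in> E}"

definition std_exps where
  "std_exps = {a \<in> exps A. a \<notin> sat_exps \<and> (\<forall>j\<in>A. \<exists>N. a + single j N \<in> sat_exps)}"

text \<open>When \<open>expo_ideal A G\<close> holds, this is the ideal of the polynomial ring
  generated by the monomials with exponents in \<open>G\<close>, since the part of an exponent in
  the variables \<open>Z\<close> is unrestricted.\<close>

definition cone :: "(nat \<Rightarrow>\<^sub>0 nat) set \<Rightarrow> 'k mpoly set" where
  "cone G = {p \<in> polys_in {1..n}. \<forall>v\<in>keys p. pm_restrict A v \<in> G}"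

definition P :: "'k mpoly set" where
  "P = {p \<in> polys_in {1..n}. \<forall>v\<in>keys p. keys v \<inter> A \<noteq> {}}"

definition T where "T = carrier (poly_ring n) - P"

lemma finite_A: "finite A"
  using A finite_subset by blast

lemma exps_A_sub: "exps A \<subseteq> exps {1..n}" and exps_Z_sub: "exps Z \<subseteq> exps {1..n}"
  using A by (auto simp: exps_def Z_def)

lemma restrict_A: "v \<in> exps {1..n} \<Longrightarrow> pm_restrict A v \<in> exps A"
  and restrict_Z: "v \<in> exps {1..n} \<Longrightarrow> pm_restrict (- A) v \<in> exps Z"
  by (auto simp: exps_def Z_def)

lemma restrict_exps_A [simp]: "a \<in> exps A \<Longrightarrow> pm_restrict A a = a"
  by (rule pm_restrict_id) (simp add: exps_def)

lemma restrict_exps_Z [simp]: "z \<in> exps Z \<Longrightarrow> pm_restrict A z = 0"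
  by (rule pm_restrict_eq_0) (auto simp: exps_def Z_def)

lemma key_exps: "\<lbrakk>p \<in> polys_in Y; v \<in> keys p\<rbrakk> \<Longrightarrow> v \<in> exps Y"
  by (auto simp: polys_in_eq polys_over_def)

lemma T_iff: "t \<in> T \<longleftrightarrow> t \<in> polys_in {1..n} \<and> (\<exists>u\<in>keys t. keys u \<inter> A = {})"
  by (auto simp: T_def P_def)

lemma one_in_T: "1 \<in> T"
  by (auto simp: T_iff polys_in_eq one_in_polys_over)

lemma T_mult: "\<lbrakk>s \<in> T; t \<in> T\<rbrakk> \<Longrightarrow> s * t \<in> T"
proof -
  assume s: "s \<in> T" and t: "t \<in> T"
  obtain u where u: "u \<in> keys s" "keys u \<inter> A = {}" using s by (auto simp: T_iff)
  obtain w where w: "w \<in> keys t" "keys w \<inter> A = {}" using t by (auto simp: T_iff)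
  have "s \<noteq> 0" "t \<noteq> 0" using u w by auto
  then obtain v where v: "v \<in> keys (s * t)" "pm_restrict A v = 0"
    by (rule mult_key[where A=A]) (simp add: Min_restrict_eq_0[OF u] Min_restrict_eq_0[OF w])
  then have "keys v \<inter> A = {}" by (metis keys_pm_restrict keys_zero)
  then show "s * t \<in> T" using v s t by (auto simp: T_iff intro: polys_in_closed)
qed

lemma monomial_in_T: "z \<in> exps Z \<Longrightarrow> monomial z \<in> T"
  using exps_Z_sub by (auto simp: T_iff polys_in_eq exps_def Z_def)

section \<open>Ideals given by conditions on the \<open>A\<close>-parts of exponents\<close>

lemma cone_ideal: "expo_ideal A G \<Longrightarrow> ideal (cone G) (poly_ring n)"
proof (rule ideal_poly_ringI)
  assume G: "expo_ideal A G"
  show "p + q \<in> cone G" if "p \<in> cone G" "q \<in> cone G" for p q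
    using that keys_add[of p q] by (auto simp: cone_def intro: polys_in_closed)
  show "f * p \<in> cone G" if "f \<in> polys_in {1..n}" "p \<in> cone G" for f p
  proof -
    have "pm_restrict A v \<in> G" if v: "v \<in> keys (f * p)" for v
    proof -
      obtain a b where ab: "v = a + b" "a \<in> keys f" "b \<in> keys p"
        using v by (rule keys_mult_memE)
      have "pm_restrict A b \<in> G" using ab \<open>p \<in> cone G\<close> by (simp add: cone_def)
      moreover have "pm_restrict A a \<in> exps A" using ab \<open>f \<in> _\<close> key_exps restrict_A by blast
      ultimately have "pm_restrict A b + pm_restrict A a \<in> G" by (rule expo_idealD[OF G])
      then show ?thesis by (simp add: ab pm_restrict_add add.commute)
    qed
    then show ?thesis using that by (auto simp: cone_def intro: polys_in_closed)
  qed
qed (auto simp: cone_def polys_in_eq)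

text \<open>Discard the terms of \<open>p\<close> that already lie in the cone. If something
  remained, its lowest grade would lie outside \<open>G\<close>, and multiplication by
  \<open>t\<close>, whose lowest grade is 0, would leave a term of that grade in the
  product.\<close>

lemma cone_saturated:
  assumes G: "expo_ideal A G" and t: "t \<in> T" and p: "p \<in> polys_in {1..n}" "t * p \<in> cone G"
  shows "p \<in> cone G"
proof -
  let ?X = "{v. pm_restrict A v \<in> G}"
  define p1 where "p1 = pm_restrict ?X p"
  define p2 where "p2 = pm_restrict (- ?X) p"
  have keys: "keys p1 = keys p \<inter> ?X" "keys p2 = keys p \<inter> - ?X"
    by (simp_all add: p1_def p2_def)
  have p_eq: "p = p1 + p2" by (simp add: p1_def p2_def pm_restrict_split)
  have p1: "p1 \<in> cone G" using p keys by (auto simp: cone_def polys_in_eq polys_over_def)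
  have tc: "t \<in> polys_in {1..n}" using t by (simp add: T_iff)
  have "t * p - t * p1 \<in> cone G"
    using p(2) ideal_poly_ringD(5)[OF cone_ideal[OF G] tc p1]
        by (rule ideal_poly_ringD(4)[OF cone_ideal[OF G]])
  then have tp2: "t * p2 \<in> cone G" by (simp add: p_eq algebra_simps)
  have "p2 = 0"
  proof (rule ccontr)
    assume ne: "p2 \<noteq> 0"
    obtain u where u: "u \<in> keys t" "keys u \<inter> A = {}" using t by (auto simp: T_iff)
    then have "t \<noteq> 0" by auto
    then obtain v where v: "v \<in> keys (t * p2)" "pm_restrict A v = Min (pm_restrict A ` keys p2)"
      using ne by (rule mult_key[where A=A]) (simp add: Min_restrict_eq_0[OF u])
    have "keys p2 \<noteq> {}" using ne by (metis keys_eq_empty)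
    then have "Min (pm_restrict A ` keys p2) \<in> pm_restrict A ` keys p2" by (intro Min_in) auto
    then have "pm_restrict A v \<notin> G" using keys v by auto
    then show False using tp2 v by (auto simp: cone_def)
  qed
  then show ?thesis using p1 p_eq by simp
qed

lemma cone_mono: "G \<subseteq> G' \<Longrightarrow> cone G \<subseteq> cone G'"
  by (auto simp: cone_def)

lemma monomial_in_cone: "a \<in> exps A \<Longrightarrow> monomial a \<in> cone G \<longleftrightarrow> a \<in> G"
  using exps_A_sub by (auto simp: cone_def polys_in_eq)

text \<open>The factor belonging to \<open>b\<close> is simple after localization. Modulo
  \<open>cone G\<close>, \<open>x\<close> and \<open>y\<close> are the monomial of \<open>b\<close>
  times polynomials \<open>g\<close> and \<open>f\<close> in the variables \<open>Z\<close>; as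
  \<open>f\<close> is nonzero it lies in \<open>T\<close>, and \<open>f * x - g * y\<close> vanishes
  modulo \<open>cone G\<close>.\<close>

lemma cone_simple:
  assumes G: "expo_ideal A G" and x: "x \<in> cone (insert b G)" and y: "y \<in> cone (insert b G)" "y \<notin> cone G"
  obtains t a where "t \<in> T" "a \<in> polys_in {1..n}" "t * x - a * y \<in> cone G"
proof -
  have dec: "\<exists>f r. p = monomial b * f + r \<and> keys f \<subseteq> exps Z \<and> r \<in> cone G" if p: "p \<in> cone (insert b G)"
      for p
  proof -
    let ?X = "{v. pm_restrict A v \<notin> G}"
    have "\<exists>z\<in>exps Z. v = b + z" if "v \<in> keys (pm_restrict ?X p)" for v
    proof -
      have "pm_restrict A v = b" "v \<in> exps {1..n}" using p that by (auto simp: cone_def intro: key_exps)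
      then show ?thesis using pm_restrict_split[of A v] restrict_Z by metis
    qed
    then obtain f where f: "keys f \<subseteq> exps Z" "pm_restrict ?X p = monomial b * f"
      by (rule factor_monomial)
    have "pm_restrict (- ?X) p \<in> cone G"
      using p by (auto simp: cone_def polys_in_eq polys_over_def)
    then show ?thesis using f pm_restrict_split[of ?X p] by metis
  qed
  obtain f r where f: "y = monomial b * f + r" "keys f \<subseteq> exps Z" "r \<in> cone G" using dec[OF y(1)] by blast
  obtain g s where g: "x = monomial b * g + s" "keys g \<subseteq> exps Z" "s \<in> cone G" using dec[OF x] by blast
  have "f \<noteq> 0" using f y by auto
  then obtain u where "u \<in> keys f" by (metis keys_eq_empty ex_in_conv)
  moreover have fg: "f \<in> polys_in {1..n}" "g \<in> polys_in {1..n}"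
    using f g exps_Z_sub by (auto simp: polys_in_eq polys_over_def)
  ultimately have "f \<in> T" using f(2) by (force simp: T_iff exps_def Z_def)
  moreover have "f * x - g * y = f * s - g * r" by (simp add: f g algebra_simps)
  moreover have "f * s - g * r \<in> cone G"
    using fg f(3) g(3) by (intro ideal_poly_ringD(4,5)[OF cone_ideal[OF G]])
  ultimately show ?thesis using that[of f g] fg by simp
qed

lemma sat_exps_ideal: "expo_ideal A sat_exps"
proof -
  have "u + v \<in> sat_exps" if u: "u \<in> sat_exps" and v: "v \<in> exps A" for u v
  proof -
    obtain z where z: "z \<in> exps Z" "u + z \<in> E" using u by (auto simp: sat_exps_def)
    then have "u + z + v \<in> E" using v exps_A_sub by (intro expo_idealD[OF E z(2)]) auto
    then have "u + v + z \<in> E" by (simp add: ac_simps)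
    then show ?thesis using u v z by (auto simp: sat_exps_def)
  qed
  then show ?thesis by (auto simp: expo_ideal_def sat_exps_def)
qed

text \<open>The part of a monomial in the variables \<open>Z\<close> becomes a unit, so only its
  \<open>A\<close>-part decides whether it dies in the localization.\<close>

lemma restrict_sat_iff:
  assumes v: "v \<in> exps {1..n}"
  shows "pm_restrict A v \<in> sat_exps \<longleftrightarrow> (\<exists>z\<in>exps Z. v + z \<in> E)"
proof
  assume "pm_restrict A v \<in> sat_exps"
  then obtain z where z: "z \<in> exps Z" "pm_restrict A v + z \<in> E" by (auto simp: sat_exps_def)
  then have "pm_restrict A v + z + pm_restrict (- A) v \<in> E"
    using restrict_Z[OF v] exps_Z_sub by (intro expo_idealD[OF E z(2)]) auto
  moreover have "pm_restrict A v + z + pm_restrict (- A) v = v + z"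
    by (metis add.assoc add.commute pm_restrict_split)
  ultimately show "\<exists>z\<in>exps Z. v + z \<in> E" using z by auto
next
  assume "\<exists>z\<in>exps Z. v + z \<in> E"
  then obtain z where z: "z \<in> exps Z" "v + z \<in> E" by blast
  moreover have "pm_restrict A v + (pm_restrict (- A) v + z) = v + z"
    by (metis add.assoc pm_restrict_split)
  ultimately show "pm_restrict A v \<in> sat_exps"
    using restrict_A[OF v] restrict_Z[OF v]
        by (auto simp: sat_exps_def intro!: bexI[of _ "pm_restrict (- A) v + z"])
qed

lemma std_exps_add:
  assumes "a \<in> std_exps" "w \<in> exps A"
  shows "a + w \<in> sat_exps \<union> std_exps"
proof -
  have "\<exists>N. a + w + single j N \<in> sat_exps" if j: "j \<in> A" for j
  proof -
    obtain N where N: "a + single j N \<in> sat_exps" using assms(1) j by (auto simp: std_exps_def)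
    have "a + single j N + w \<in> sat_exps" using assms(2) by (rule expo_idealD[OF sat_exps_ideal N])
    then show ?thesis by (auto simp: ac_simps)
  qed
  then show ?thesis using assms by (auto simp: std_exps_def)
qed

text \<open>An infinite set would contain an injective sequence that is nondecreasing in each
  coordinate. Since some \<open>h 0 + single j N\<close> is in \<open>sat_exps\<close>, and later
  members dominate \<open>h 0\<close>, a large \<open>j\<close>-th exponent would push a member into
  \<open>sat_exps\<close>. All coordinates are thus bounded, leaving only finitely many
  values.\<close>

lemma finite_std_exps: "finite std_exps"
proof (rule ccontr)
  assume "infinite std_exps"
  then obtain f :: "nat \<Rightarrow> _" where f: "inj f" "range f \<subseteq> std_exps" using infinite_countable_subset
      by blast
  obtain g :: "nat \<Rightarrow> nat" where g: "strict_mono g" "\<And>j. j \<in> A \<Longrightarrow> mono (\<lambda>i. lookup (f (g i)) j)"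
    using monotone_subsequence_exps[OF finite_A, of f] by blast
  define h where "h = f \<circ> g"
  have h_std: "h i \<in> std_exps" for i using f by (auto simp: h_def)
  then have h_A: "h i \<in> exps A" for i by (simp add: std_exps_def)
  have h_0: "lookup (h i) j = 0" if "j \<notin> A" for i j
  proof -
    have "keys (h i) \<subseteq> A" using h_A by (simp add: exps_def)
    then show ?thesis using that by (metis in_keys_iff subsetD)
  qed
  have inj: "inj h" unfolding h_def using f(1) g(1) by (simp add: inj_compose strict_mono_imp_inj_on)
  have mono: "lookup (h i) j \<le> lookup (h k) j" if "i \<le> k" for i j k
    using that g(2)[of j] h_0[of j] by (cases "j \<in> A") (auto simp: h_def mono_def)
  have le: "\<exists>w\<in>exps A. h k = a + w" if "\<And>j. lookup a j \<le> lookup (h k) j" for k a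
  proof (intro bexI)
    show "h k = a + (h k - a)" using that by (intro poly_mapping_eqI) (simp add: lookup_add lookup_minus)
    then show "h k - a \<in> exps A" using h_A[of k] by (metis exps_add_iff)
  qed
  have bound: "\<exists>N. \<forall>k. lookup (h k) j < N" if j: "j \<in> A" for j
  proof -
    obtain N where N: "h 0 + single j N \<in> sat_exps" using h_std[of 0] j by (auto simp: std_exps_def)
    have "lookup (h k) j < lookup (h 0) j + N" for k
    proof (rule ccontr)
      assume *: "\<not> lookup (h k) j < lookup (h 0) j + N"
      have "\<exists>w\<in>exps A. h k = (h 0 + single j N) + w"
        using * mono[of 0 k] by (intro le) (auto simp: lookup_add lookup_single when_def)
      then have "h k \<in> sat_exps" using expo_idealD[OF sat_exps_ideal N] by auto
      then show False using h_std[of k] by (simp add: std_exps_def)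
    qed
    then show ?thesis by blast
  qed
  then obtain N where N: "\<And>j k. j \<in> A \<Longrightarrow> lookup (h k) j < N j" by metis
  have "lookup ` range h \<subseteq> {l. \<forall>j. (j \<in> A \<longrightarrow> l j \<in> {..Max (insert 0 (N ` A))}) \<and> (j \<notin> A \<longrightarrow> l j = 0)}"
  proof (clarsimp, intro conjI allI impI)
    fix k j assume "j \<in> A"
    then have "N j \<le> Max (insert 0 (N ` A))" using finite_A by (intro Max_ge) auto
    then show "lookup (h k) j \<le> Max (insert 0 (N ` A))" using N[OF \<open>j \<in> A\<close>, of k] by simp
  qed (use h_0 in auto)
  then have "finite (lookup ` range h)"
    using finite_set_of_finite_funs[OF finite_A, of "{..Max (insert 0 (N ` A))}" 0] finite_subset by auto
  then have "finite (range h)" by (rule finite_imageD) (simp add: inj_on_def)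
  then show False using inj range_inj_infinite by blast
qed

sublocale loc: residue_localization "poly_ring n :: 'k mpoly ring" "polys_over E :: 'k mpoly set" T
proof (intro residue_localization.intro residue_localization_axioms.intro)
  show "cring (poly_ring n :: 'k mpoly ring)" by (rule poly_ring.is_cring)
  show "ideal (polys_over E) (poly_ring n :: 'k mpoly ring)" by (rule ideal_polys_over[OF E])
qed (use one_in_T T_mult in \<open>auto simp: T_def\<close>)

lemma saturated_cone:
  assumes G: "expo_ideal A G" "sat_exps \<subseteq> G"
  shows "loc.saturated (cone G)"
proof -
  have "pm_restrict A v \<in> sat_exps" if "v \<in> E" for v
  proof -
    have "v \<in> exps {1..n}" using that E by (auto simp: expo_ideal_def)
    then show ?thesis using that restrict_sat_iff[of v] by (auto intro!: bexI[of _ 0])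
  qed
  then have "polys_over E \<subseteq> cone G"
    using G E by (auto simp: polys_over_def cone_def polys_in_eq expo_ideal_def subset_iff)
  then show ?thesis
    unfolding loc.saturated_def using cone_ideal[OF G(1)] cone_saturated[OF G(1)] by auto
qed

text \<open>\<open>cone sat_exps\<close> is the kernel of the localization map, so it corresponds to
  the zero submodule and starts the composition series.\<close>

lemma cone_sat_least:
  assumes Q: "loc.saturated Q"
  shows "cone sat_exps \<subseteq> Q"
proof
  fix p assume p: "p \<in> cone sat_exps"
  have Q': "ideal Q (poly_ring n)" using Q by (simp add: loc.saturated_def)
  show "p \<in> Q"
  proof (rule monomial_closed_poly[OF Q'])
    show pc: "p \<in> polys_in {1..n}" using p by (simp add: cone_def)
    fix v assume v: "v \<in> keys p"
    then have v': "v \<in> exps {1..n}" using pc key_exps by blast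
    then obtain z where z: "z \<in> exps Z" "v + z \<in> E" using v p restrict_sat_iff by (auto simp: cone_def)
    then have "monomial z * monomial v \<in> Q"
      using Q by (auto simp: loc.saturated_def monomial_mult add.commute)
    then show "monomial v \<in> Q"
      using loc.saturatedD[OF Q, of "monomial z" "monomial v"] monomial_in_T[OF z(1)] v'
          by (simp add: polys_in_eq)
  qed
qed

lemma saturated_inter:
  assumes "loc.saturated Q" "loc.saturated Q'"
  shows "loc.saturated (Q \<inter> Q')"
  using assms poly_ring.i_intersect unfolding loc.saturated_def by blast

text \<open>Since the linear order on exponents is compatible with addition, adding the standard
  exponents in decreasing order yields a composition series of the largest submodule of finite length.\<close>

definition std_upset where "std_upset D \<longleftrightarrow> D \<subseteq> std_exps \<and> (\<forall>b\<in>D. \<forall>c\<in>std_exps. b \<le> c \<longrightarrow> c \<in> D)"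

text \<open>Since 0 is the least exponent, multiplication never lowers an exponent in the linear
  order, and by \<open>std_exps_add\<close> the result is standard or dies. Closure upwards in the
  order therefore gives closure under multiplication.\<close>

lemma expo_ideal_upset:
  assumes D: "std_upset D"
  shows "expo_ideal A (sat_exps \<union> D)"
proof -
  have "u + v \<in> sat_exps \<union> D" if u: "u \<in> D" and v: "v \<in> exps A" for u v
  proof -
    have "u + 0 \<le> u + v" by (intro add_left_mono expo_nonneg)
    then have "u \<le> u + v" by simp
    moreover have "u + v \<in> sat_exps \<union> std_exps" using u v D
        by (intro std_exps_add) (auto simp: std_upset_def)
    ultimately show ?thesis using D u by (auto simp: std_upset_def)
  qed
  moreover have "D \<subseteq> exps A" using D by (auto simp: std_upset_def std_exps_def)
  ultimately show ?thesis using sat_exps_ideal by (auto simp: expo_ideal_def)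
qed

lemma saturated_upset: "std_upset D \<Longrightarrow> loc.saturated (cone (sat_exps \<union> D))"
  by (rule saturated_cone[OF expo_ideal_upset]) auto

lemma std_upset_finite: "std_upset D \<Longrightarrow> finite D"
  using finite_std_exps finite_subset by (auto simp: std_upset_def)

text \<open>An upset is determined by its minimum. The last two equations allow a factor of the
  series to be named by the single exponent \<open>Min D\<close>, without reference to
  \<open>D\<close>.\<close>

lemma std_upset_remove:
  assumes D: "std_upset D" "D \<noteq> {}"
  shows "Min D \<in> D" "std_upset (D - {Min D})" "D = {c \<in> std_exps. Min D \<le> c}"
      "D - {Min D} = {c \<in> std_exps. Min D < c}"
proof -
  have fin: "finite D" using D by (simp add: std_upset_finite)
  show m: "Min D \<in> D" using fin D by simp
  have le: "Min D \<le> b" if "b \<in> D" for b using fin that by simp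
  show "D = {c \<in> std_exps. Min D \<le> c}" using D m le by (auto simp: std_upset_def)
  show "D - {Min D} = {c \<in> std_exps. Min D < c}"
    using D m le unfolding std_upset_def by (fastforce simp: less_le)
  show "std_upset (D - {Min D})"
    using D le unfolding std_upset_def
        by (metis DiffE DiffI Diff_subset antisym order.trans singletonD singletonI)
qed

lemma std_chain:
  "std_upset D \<Longrightarrow> \<exists>N. loc.saturated_chain (cone (sat_exps \<union> D)) (card D) N \<and> N (card D)
      = cone (sat_exps \<union> D)"
proof (induction "card D" arbitrary: D)
  case 0
  then have "D = {}" using std_upset_finite by simp
  then show ?case using saturated_upset[OF 0(2)]
      by (intro exI[of _ "\<lambda>_. cone sat_exps"]) (simp add: loc.saturated_chain_def)
next
  case (Suc d)
  define D' where "D' = D - {Min D}"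
  have ne: "D \<noteq> {}" using Suc(2) by auto
  note D = std_upset_remove[OF Suc(3) ne]
  have card: "card D' = d" using Suc(2) D(1) std_upset_finite[OF Suc(3)] by (simp add: D'_def)
  obtain N where N: "loc.saturated_chain (cone (sat_exps \<union> D')) d N" "N d = cone (sat_exps \<union> D')"
    using Suc(1)[of D'] card D(2) unfolding D'_def by metis
  have "monomial (Min D) \<in> cone (sat_exps \<union> D)" "monomial (Min D) \<notin> cone (sat_exps \<union> D')"
    using D(1) Suc(3) by (auto simp: std_upset_def std_exps_def D'_def monomial_in_cone)
  moreover have sub: "cone (sat_exps \<union> D') \<subseteq> cone (sat_exps \<union> D)" by (rule cone_mono) (auto simp: D'_def)
  ultimately have strict: "cone (sat_exps \<union> D') \<subset> cone (sat_exps \<union> D)" by blast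
  define N' where "N' = N(Suc d := cone (sat_exps \<union> D))"
  have "loc.saturated_chain (cone (sat_exps \<union> D)) (Suc d) N'"
    unfolding loc.saturated_chain_def
  proof (intro conjI allI impI)
    fix i assume "i \<le> Suc d"
    then show "loc.saturated (N' i)" "N' i \<subseteq> cone (sat_exps \<union> D)"
      using N(1) saturated_upset[OF Suc(3)] sub unfolding N'_def loc.saturated_chain_def
          by (auto simp: le_Suc_eq)
  next
    fix i assume "i < Suc d"
    then show "N' i \<subset> N' (Suc i)"
      using N strict unfolding N'_def loc.saturated_chain_def by (auto simp: less_Suc_eq)
  qed
  then show ?case by (intro exI[of _ N']) (simp add: N'_def flip: Suc(2))
qed

text \<open>The factors of the standard series in which \<open>N\<close> has nonzero image. Their
  number replaces the length of \<open>N\<close> in the bound on chains, so no theorem of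
  Jordan-Hoelder type is invoked.\<close>

definition composition_factors :: "'k mpoly set \<Rightarrow> (nat \<Rightarrow>\<^sub>0 nat) set" where
  "composition_factors N = {b \<in> std_exps. \<exists>y\<in>N. y \<in> cone (sat_exps \<union> {c \<in> std_exps. b \<le> c}) \<and>
     y \<notin> cone (sat_exps \<union> {c \<in> std_exps. b < c})}"

text \<open>Along the series, let \<open>x\<close> in \<open>N'\<close> be nonzero in the factor of
  \<open>b\<close>. Then \<open>N\<close> contains some \<open>y\<close> nonzero in the same factor,
  and by simplicity \<open>t * x - a * y\<close> falls into the next smaller step, hence into
  \<open>N\<close> by induction. So \<open>t * x\<close> lies in \<open>N\<close>, and saturation
  cancels \<open>t\<close>.\<close>

lemma composition_factors_eqD:
  assumes N: "loc.saturated N" "loc.saturated N'" "N \<subseteq> N'"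
      "composition_factors N = composition_factors N'"
  shows "std_upset D \<Longrightarrow> N' \<inter> cone (sat_exps \<union> D) \<subseteq> N"
proof (induction "card D" arbitrary: D)
  case 0
  then have "D = {}" using std_upset_finite by simp
  then show ?case using cone_sat_least[OF N(1)] by auto
next
  case (Suc d)
  define b where "b = Min D"
  define D' where "D' = D - {b}"
  have ne: "D \<noteq> {}" using Suc(2) by auto
  note D = std_upset_remove[OF Suc(3) ne, folded b_def, folded D'_def]
  have card: "card D' = d" using Suc(2) D(1) std_upset_finite[OF Suc(3)] by (simp add: D'_def)
  then have IH: "N' \<inter> cone (sat_exps \<union> D') \<subseteq> N" using Suc(1) D(2) by blast
  have ins: "insert b (sat_exps \<union> D') = sat_exps \<union> D" using D(1) by (auto simp: D'_def)
  have N_ideal: "ideal N (poly_ring n)" "ideal N' (poly_ring n)" using N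
      by (simp_all add: loc.saturated_def)
  have factors_iff: "b \<in> composition_factors Q \<longleftrightarrow>
      b \<in> std_exps \<and> (\<exists>y\<in>Q. y \<in> cone (sat_exps \<union> D) \<and> y \<notin> cone (sat_exps \<union> D'))" for Q
    by (simp add: composition_factors_def D(3)[symmetric] D(4)[symmetric])
  show ?case
  proof safe
    fix x assume x: "x \<in> N'" "x \<in> cone (sat_exps \<union> D)"
    show "x \<in> N"
    proof (cases "x \<in> cone (sat_exps \<union> D')")
      case True
      then show ?thesis using IH x by blast
    next
      case False
      then have "b \<in> composition_factors N'"
        using x D(1) Suc(3) unfolding factors_iff by (auto simp: std_upset_def)
      then obtain y where y: "y \<in> N" "y \<in> cone (sat_exps \<union> D)" "y \<notin> cone (sat_exps \<union> D')"
        unfolding N(4)[symmetric] factors_iff by blast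
      obtain t a where ta: "t \<in> T" "a \<in> polys_in {1..n}" "t * x - a * y \<in> cone (sat_exps \<union> D')"
        by (rule cone_simple[OF expo_ideal_upset[OF D(2)], of x b y]) (use x y ins in auto)
      have t: "t \<in> polys_in {1..n}" using ta by (simp add: T_iff)
      have xc: "x \<in> polys_in {1..n}" using x by (simp add: cone_def)
      have ay: "a * y \<in> N" using ta y by (intro ideal_poly_ringD(5)[OF N_ideal(1)])
      have "t * x \<in> N'" using t x by (intro ideal_poly_ringD(5)[OF N_ideal(2)])
      then have "t * x - a * y \<in> N'" using ay N(3) by (intro ideal_poly_ringD(4)[OF N_ideal(2)]) auto
      then have "t * x - a * y \<in> N" using IH ta by blast
      then have "t * x - a * y + a * y \<in> N" using ay by (rule ideal_poly_ringD(3)[OF N_ideal(1)])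
      then show ?thesis using loc.saturatedD[OF N(1), of t x] ta xc by simp
    qed
  qed
qed

definition finite_part where "finite_part = cone (sat_exps \<union> std_exps)"

lemma std_upset_all: "std_upset std_exps"
  by (simp add: std_upset_def)

text \<open>By \<open>composition_factors_eqD\<close>, each strict inclusion inside
  \<open>finite_part\<close> strictly enlarges the set of visible factors, a subset of
  \<open>std_exps\<close>.\<close>

lemma chain_bound:
  assumes "loc.saturated_chain finite_part k N"
  shows "k \<le> card std_exps"
proof -
  have "i \<le> k \<Longrightarrow> i \<le> card (composition_factors (N i))" for i
  proof (induction i)
    case (Suc i)
    have sat: "loc.saturated (N i)" "loc.saturated (N (Suc i))" "N i \<subset> N (Suc i)"
        "N (Suc i) \<subseteq> finite_part"
      using assms Suc by (auto simp: loc.saturated_chain_def)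
    have "composition_factors (N i) \<noteq> composition_factors (N (Suc i))"
      using composition_factors_eqD[OF sat(1,2) _ _ std_upset_all] sat(3,4) unfolding finite_part_def
          by blast
    moreover have "composition_factors (N i) \<subseteq> composition_factors (N (Suc i))"
      using sat by (auto simp: composition_factors_def)
    moreover have "finite (composition_factors (N (Suc i)))"
      using finite_std_exps by (auto simp: composition_factors_def)
    ultimately have "card (composition_factors (N i)) < card (composition_factors (N (Suc i)))"
      by (intro psubset_card_mono) auto
    then show ?case using Suc by simp
  qed simp
  then have "k \<le> card (composition_factors (N k))" by simp
  also have "\<dots> \<le> card std_exps"
    using finite_std_exps by (intro card_mono) (auto simp: composition_factors_def)
  finally show ?thesis .
qed

text \<open>Some term of an element \<open>p\<close> of \<open>Q\<close> has an
  \<open>A\<close>-part \<open>a\<close> that no power of a certain variable \<open>x_j\<close>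
  kills. The multiples of \<open>p\<close> by powers of \<open>x_j\<close> are then separated by
  lower bounds on the exponent of \<open>x_j\<close>.\<close>

lemma infinite_chain:
  assumes Q: "loc.saturated Q" and "\<not> Q \<subseteq> finite_part"
  shows "\<exists>N. loc.saturated_chain Q k N"
proof -
  have Q': "ideal Q (poly_ring n)" using Q by (simp add: loc.saturated_def)
  obtain p where p: "p \<in> Q" "p \<notin> finite_part" using assms by blast
  have pc: "p \<in> polys_in {1..n}" using p ideal_poly_ringD(1)[OF Q'] by auto
  then obtain v where v: "v \<in> keys p" "pm_restrict A v \<notin> sat_exps \<union> std_exps"
    using p by (auto simp: finite_part_def cone_def)
  define a where "a = pm_restrict A v"
  have a: "a \<in> exps A" using v pc key_exps restrict_A by (auto simp: a_def)
  then obtain j where j: "j \<in> A" "\<And>N. a + single j N \<notin> sat_exps"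
    using v by (auto simp: a_def std_exps_def)
  \<comment> \<open>One more than the exponent of \<open>x_j\<close> in \<open>a\<close>: then
    \<open>x_j^m p\<close> satisfies the condition \<open>G m\<close>, but its term over
    \<open>a\<close> violates \<open>G (m + c)\<close>.\<close>
  define c where "c = Suc (lookup a j)"
  define G where "G m = sat_exps \<union> {b \<in> exps A. m \<le> lookup b j}" for m
  have G: "expo_ideal A (G m)" for m
    using sat_exps_ideal by (auto simp: G_def expo_ideal_def lookup_add)
  \<comment> \<open>The conditions weaken as their bound decreases, so counting down with
    \<open>k - i\<close> turns the descending family into an ascending chain.\<close>
  define N where "N i = Q \<inter> cone (G (c * (k - i)))" for i
  have "loc.saturated_chain Q k N"
    unfolding loc.saturated_chain_def
  proof (intro conjI allI impI)
    fix i
    show "loc.saturated (N i)" unfolding N_def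
        by (intro saturated_inter Q saturated_cone G) (auto simp: G_def)
    show "N i \<subseteq> Q" by (simp add: N_def)
  next
    fix i assume i: "i < k"
    define m where "m = c * (k - Suc i)"
    have m': "c * (k - i) = m + c" using i
        by (simp add: m_def Suc_diff_Suc flip: mult_Suc_right) (simp add: mult_Suc_right flip:
            Suc_diff_Suc)
    define u where "u = single j m"
    have u: "u \<in> exps A" "u \<in> exps {1..n}" using j A by (auto simp: u_def single_in_exps)
    have q: "monomial u * p \<in> Q" using u p by (intro ideal_poly_ringD(5)[OF Q']) (auto simp: polys_in_eq)
    have qc: "monomial u * p \<in> polys_in {1..n}" using q ideal_poly_ringD(1)[OF Q'] by blast
    have keys: "keys (monomial u * p) = (+) u ` keys p" by (rule keys_monomial_mult)
    have "pm_restrict A (u + w) \<in> G m" if "w \<in> keys p" for w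
      using u restrict_A[OF key_exps[OF pc that]] by (simp add: G_def pm_restrict_add lookup_add u_def)
    then have "monomial u * p \<in> cone (G m)" using qc keys by (auto simp: cone_def)
    moreover have "monomial u * p \<notin> cone (G (m + c))"
    proof
      assume "monomial u * p \<in> cone (G (m + c))"
      then have "pm_restrict A (u + v) \<in> G (m + c)" using v keys by (auto simp: cone_def)
      then have "u + a \<in> G (m + c)" using u by (simp add: pm_restrict_add a_def)
      moreover have "u + a \<notin> sat_exps" using j(2)[of m] by (simp add: u_def add.commute)
      ultimately show False by (simp add: G_def lookup_add u_def c_def)
    qed
    moreover have "cone (G (m + c)) \<subseteq> cone (G m)" by (rule cone_mono) (auto simp: G_def)
    ultimately show "N i \<subset> N (Suc i)" using q unfolding N_def m' m_def[symmetric] by blast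
  qed
  then show ?thesis by blast
qed

lemma length_multiplicity_eq: "length_multiplicity (poly_ring n) (polys_over E) P = card std_exps"
proof -
  obtain N where N: "loc.saturated_chain finite_part (card std_exps) N"
    using std_chain[OF std_upset_all] unfolding finite_part_def by blast
  have "module_length loc.A (loc.L\<lparr>carrier := largest_finite_length_submodule loc.A loc.L\<rparr>)
      = enat (card std_exps)"
  proof (rule loc.length_of_largest_finite_length_submodule)
    show "loc.saturated finite_part" using saturated_upset[OF std_upset_all]
        by (simp add: finite_part_def)
    show "loc.saturated_chain finite_part (card std_exps) N" by (rule N)
  qed (auto intro: chain_bound infinite_chain)
  then show ?thesis by (simp add: length_multiplicity_def Let_def T_def)
qed

end

section \<open>Standard pairs\<close>

lemma polys_over_subset_iff: "(polys_over X :: 'k::field mpoly set) \<subseteq> polys_over Y \<longleftrightarrow> X \<subseteq> Y"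
proof
  assume *: "(polys_over X :: 'k mpoly set) \<subseteq> polys_over Y"
  show "X \<subseteq> Y"
  proof
    fix x assume "x \<in> X"
    then have "(monomial x :: 'k mpoly) \<in> polys_over X" by simp
    then have "(monomial x :: 'k mpoly) \<in> polys_over Y" using * by blast
    then show "x \<in> Y" by simp
  qed
qed (rule polys_over_mono)

lemma mon_cone_eq: "(mon_cone u Y :: 'k::field mpoly set) = polys_over ((+) u ` exps Y)"
proof
  show "(mon_cone u Y :: 'k mpoly set) \<subseteq> polys_over ((+) u ` exps Y)"
    by (auto simp: mon_cone_def polys_in_eq polys_over_def keys_monomial_mult intro!: imageI)
  show "polys_over ((+) u ` exps Y) \<subseteq> (mon_cone u Y :: 'k mpoly set)"
  proof
    fix p :: "'k mpoly" assume "p \<in> polys_over ((+) u ` exps Y)"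
    then have "\<exists>z\<in>exps Y. v = u + z" if "v \<in> keys p" for v
      using that by (auto simp: polys_over_def)
    then obtain f where "keys f \<subseteq> exps Y" "p = monomial u * f"
      by (rule factor_monomial)
    then show "p \<in> mon_cone u Y" by (auto simp: mon_cone_def polys_in_eq polys_over_def)
  qed
qed

lemma mon_cone_subset_iff:
  "(mon_cone u Y :: 'k::field mpoly set) \<subseteq> mon_cone u' Y' \<longleftrightarrow> (\<forall>z\<in>exps Y. \<exists>z'\<in>exps Y'. u + z = u' + z')"
  by (auto simp: mon_cone_eq polys_over_subset_iff)

lemma admissible_pair_iff:
  "admissible_pair n (polys_over E :: 'k::field mpoly set) (u, Y) \<longleftrightarrow>
     u \<in> exps {1..n} \<and> Y \<subseteq> {1..n} \<and> Y \<inter> keys u = {} \<and> (\<forall>z\<in>exps Y. u + z \<notin> E)"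
proof -
  have "(mon_cone u Y :: 'k mpoly set) \<inter> polys_over E = polys_over ((+) u ` exps Y \<inter> E)"
    by (auto simp: mon_cone_eq polys_over_def)
  moreover have "(polys_over X :: 'k mpoly set) = {0} \<longleftrightarrow> X = {}" for X
  proof
    assume *: "(polys_over X :: 'k mpoly set) = {0}"
    have "x \<notin> X" for x
    proof
      assume "x \<in> X"
      then have "(monomial x :: 'k mpoly) \<in> polys_over X" by simp
      then have "(monomial x :: 'k mpoly) = 0" using * by blast
      then show False by (metis keys_monomial keys_zero insert_not_empty)
    qed
    then show "X = {}" by blast
  qed (auto simp: polys_over_def)
  moreover have "(+) u ` exps Y \<inter> E = {} \<longleftrightarrow> (\<forall>z\<in>exps Y. u + z \<notin> E)" by blast
  ultimately show ?thesis
    by (simp add: admissible_pair_def exps_def[of "{1..n}"])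
qed

lemma restrict_single_split:
  fixes v :: "nat \<Rightarrow>\<^sub>0 nat"
  shows "v = pm_restrict (- {j}) v + single j (lookup v j)"
  by (rule poly_mapping_eqI) (simp add: lookup_add lookup_pm_restrict lookup_single when_def)

lemma minus_single_add:
  fixes v :: "nat \<Rightarrow>\<^sub>0 nat"
  assumes "j \<in> keys v"
  shows "v = single j 1 + (v - single j 1)"
  using assms
      by (intro poly_mapping_eqI) (auto simp: lookup_add lookup_minus lookup_single when_def in_keys_iff)

context monomial_localization
begin

text \<open>If no power of some \<open>x_j\<close> with \<open>j\<close> in \<open>A\<close> kills
  \<open>u\<close>, then \<open>j\<close> can be added to \<open>Z\<close>, so the pair is not
  maximal. Conversely, a different admissible pair with a larger cone has a strictly larger set
  \<open>Z'\<close> of free variables; a new variable in it has a power that kills \<open>u\<close>,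
  against admissibility.\<close>

lemma standard_pair_iff: "(u, Z) \<in> standard_pairs n (polys_over E :: 'k mpoly set) \<longleftrightarrow> u \<in> std_exps"
proof
  assume std: "(u, Z) \<in> standard_pairs n (polys_over E :: 'k mpoly set)"
  then have "admissible_pair n (polys_over E :: 'k mpoly set) (u, Z)" by (simp add: standard_pairs_def)
  then have u: "u \<in> exps {1..n}" "Z \<inter> keys u = {}" "\<And>z. z \<in> exps Z \<Longrightarrow> u + z \<notin> E"
    by (auto simp: admissible_pair_iff)
  have uA: "u \<in> exps A" using u(1,2) by (auto simp: exps_def Z_def)
  have "\<exists>N. u + single j N \<in> sat_exps" if j: "j \<in> A" for j
  proof (rule ccontr)
    assume no: "\<nexists>N. u + single j N \<in> sat_exps"
    \<comment> \<open>The factor in \<open>x_j\<close> is removed from \<open>u\<close> to keep the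
      monomial disjoint from the enlarged set of variables; the cone only grows.\<close>
    define u' where "u' = pm_restrict (- {j}) u"
    have u_eq: "u = u' + single j (lookup u j)"
      unfolding u'_def by (rule restrict_single_split)
    \<comment> \<open>Membership in \<open>E\<close> survives multiplication by the removed power of
      \<open>x_j\<close>. Splitting \<open>z'\<close> into its power of \<open>x_j\<close> and its
      part in \<open>Z\<close> would then put \<open>u\<close> times a power of \<open>x_j\<close>
      into \<open>sat_exps\<close>.\<close>
    have "u' + z' \<notin> E" if z': "z' \<in> exps (insert j Z)" for z'
    proof
      assume z'E: "u' + z' \<in> E"
      have "u' + z' + single j (lookup u j) \<in> E"
        using j A by (intro expo_idealD[OF E z'E] single_in_exps) auto
      then have "u + z' \<in> E" by (subst u_eq) (simp add: ac_simps)
      then have "u + single j (lookup z' j) + pm_restrict (- {j}) z' \<in> E"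
        by (subst (asm) restrict_single_split[of z' j]) (simp add: ac_simps)
      moreover have "pm_restrict (- {j}) z' \<in> exps Z" using z' by (auto simp: exps_def)
      moreover have "u + single j (lookup z' j) \<in> exps A"
        using uA j by (simp add: single_in_exps)
      ultimately have "u + single j (lookup z' j) \<in> sat_exps"
        by (auto simp: sat_exps_def)
      then show False using no by blast
    qed
    then have "admissible_pair n (polys_over E :: 'k mpoly set) (u', insert j Z)"
      using u j A by (auto simp: admissible_pair_iff u'_def exps_def Z_def)
    moreover have "(u', insert j Z) \<noteq> (u, Z)" using j by (auto simp: Z_def)
    moreover have "(mon_cone u Z :: 'k mpoly set) \<subseteq> mon_cone u' (insert j Z)"
      unfolding mon_cone_subset_iff
    proof
      fix z assume "z \<in> exps Z"
      then have "single j (lookup u j) + z \<in> exps (insert j Z)"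
        by (auto simp: exps_def keys_add_nat split: if_splits)
      moreover have "u + z = u' + (single j (lookup u j) + z)"
        by (subst (1) u_eq) (simp add: add.assoc)
      ultimately show "\<exists>z'\<in>exps (insert j Z). u + z = u' + z'" by blast
    qed
    ultimately show False using std unfolding standard_pairs_def by blast
  qed
  then show "u \<in> std_exps" using uA u(3) by (auto simp: std_exps_def sat_exps_def)
next
  assume u: "u \<in> std_exps"
  then have uA: "u \<in> exps A" and no: "\<And>z. z \<in> exps Z \<Longrightarrow> u + z \<notin> E"
      by (auto simp: std_exps_def sat_exps_def)
  have adm: "admissible_pair n (polys_over E :: 'k mpoly set) (u, Z)"
    using uA no exps_A_sub by (auto simp: admissible_pair_iff exps_def Z_def)
  have False if adm': "admissible_pair n (polys_over E :: 'k mpoly set) (u', Z')"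
      and ne: "(u', Z') \<noteq> (u, Z)"
    and sub: "(mon_cone u Z :: 'k mpoly set) \<subseteq> mon_cone u' Z'" for u' Z'
  proof -
    have sub': "\<exists>z'\<in>exps Z'. u + z = u' + z'" if "z \<in> exps Z" for z using sub that
        by (simp add: mon_cone_subset_iff)
    obtain z0 where z0: "z0 \<in> exps Z'" "u = u' + z0" using sub'[of 0] by auto
    have "Z \<subseteq> Z'"
    proof
      fix i assume i: "i \<in> Z"
      then obtain z' where "z' \<in> exps Z'" "u + single i 1 = u' + z'"
        using sub'[of "single i 1"] by (auto simp: single_in_exps)
      then have "z0 + single i 1 \<in> exps Z'" using z0 by (simp add: add.assoc)
      then show "i \<in> Z'" by (simp add: exps_def keys_add_nat)
    qed
    moreover have "Z \<noteq> Z'"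
    proof
      assume eq: "Z = Z'"
      have "z0 \<in> exps A" using z0 uA by simp
      then have "keys z0 \<subseteq> A \<inter> ({1..n} - A)" using z0(1) eq by (simp add: exps_def Z_def)
      then have "z0 = 0" by simp
      then show False using ne eq z0 by simp
    qed
    ultimately obtain j where j: "j \<in> Z'" "j \<notin> Z" by blast
    have "Z' \<subseteq> {1..n}" using adm' by (simp add: admissible_pair_iff)
    then have "j \<in> A" using j by (auto simp: Z_def)
    then obtain N where "u + single j N \<in> sat_exps" using u by (auto simp: std_exps_def)
    then obtain z where z: "z \<in> exps Z" "u + single j N + z \<in> E" by (auto simp: sat_exps_def)
    have "z0 + single j N + z \<in> exps Z'"
      using z0 z j exps_mono[OF \<open>Z \<subseteq> Z'\<close>] by (auto simp: single_in_exps)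
    then have "u' + (z0 + single j N + z) \<notin> E" using adm' by (auto simp: admissible_pair_iff)
    then show False using z z0 by (simp add: add.assoc)
  qed
  then show "(u, Z) \<in> standard_pairs n (polys_over E :: 'k mpoly set)"
    using adm unfolding standard_pairs_def by blast
qed

end

lemma std_eq_sum:
  assumes E: "expo_ideal {1..n} E"
  shows "std n r (polys_over E :: 'k::field mpoly set) =
    (\<Sum>Y | Y \<subseteq> {1..n} \<and> card Y = r. card (monomial_localization.std_exps n E ({1..n} - Y)))"
proof -
  let ?B = "\<lambda>Y. monomial_localization.std_exps n E ({1..n} - Y)"
  let ?F = "{Y. Y \<subseteq> {1..n} \<and> card Y = r}"
  have loc: "monomial_localization n E ({1..n} - Y)" for Y
    using E by (simp add: monomial_localization_def)
  have iff: "(u, Y) \<in> standard_pairs n (polys_over E :: 'k mpoly set) \<longleftrightarrow> u \<in> ?B Y" if "Y \<subseteq> {1..n}" for u Y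
    using monomial_localization.standard_pair_iff[OF loc[of Y], where 'k='k] that
    by (simp add: monomial_localization.Z_def[OF loc] double_diff)
  have sub: "Y \<subseteq> {1..n}" if "(u, Y) \<in> standard_pairs n (polys_over E :: 'k mpoly set)" for u Y
    using that by (auto simp: standard_pairs_def admissible_pair_def)
  have "{(u, Y) \<in> standard_pairs n (polys_over E :: 'k mpoly set). card Y = r}
      = (\<Union>Y\<in>?F. (\<lambda>u. (u, Y)) ` ?B Y)"
    (is "?L = ?R")
  proof (rule Set.set_eqI)
    fix x :: "(nat \<Rightarrow>\<^sub>0 nat) \<times> nat set"
    obtain u Y where x: "x = (u, Y)" by (cases x)
    show "x \<in> ?L \<longleftrightarrow> x \<in> ?R"
      using iff[of Y u] sub[of u Y] by (auto simp: x)
  qed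
  moreover have "card (\<Union>Y\<in>?F. (\<lambda>u. (u, Y)) ` ?B Y) = (\<Sum>Y\<in>?F. card ((\<lambda>u. (u, Y)) ` ?B Y))"
  proof (rule card_UN_disjoint)
    show "finite ?F" by (rule finite_subset[of _ "Pow {1..n}"]) auto
    show "\<forall>Y\<in>?F. finite ((\<lambda>u. (u, Y)) ` ?B Y)"
      using monomial_localization.finite_std_exps[OF loc] by blast
  qed auto
  moreover have "card ((\<lambda>u. (u, Y)) ` ?B Y) = card (?B Y)" for Y
      by (rule card_image) (auto intro: inj_onI)
  ultimately show ?thesis by (simp add: std_def)
qed

section \<open>Associated primes\<close>

lemma Min_keys_mult:
  fixes p t :: "'k::field mpoly"
  assumes "t \<noteq> 0" "p \<noteq> 0"
  shows "Min (keys t) + Min (keys p) \<in> keys (t * p)"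
proof -
  have [simp]: "pm_restrict UNIV v = v" for v :: "nat \<Rightarrow>\<^sub>0 nat" by (rule pm_restrict_id) simp
  show ?thesis using assms by (rule mult_key[where A=UNIV]) simp
qed

context monomial_localization
begin

lemma P_eq_cone: "P = cone (exps A - {0})"
proof -
  have "pm_restrict A v \<noteq> 0 \<longleftrightarrow> keys v \<inter> A \<noteq> {}" for v :: "nat \<Rightarrow>\<^sub>0 nat"
    by (metis keys_eq_empty keys_pm_restrict)
  then show ?thesis using key_exps restrict_A by (fastforce simp: P_def cone_def)
qed

lemma primeideal_P: "primeideal P (poly_ring n)"
proof (rule primeidealI)
  have "u + v \<noteq> 0" if "u \<noteq> 0" for u v :: "nat \<Rightarrow>\<^sub>0 nat"
    using that by (metis keys_add_nat keys_eq_empty keys_zero Un_empty)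
  then have "expo_ideal A (exps A - {0})" by (auto simp: expo_ideal_def)
  then show "ideal P (poly_ring n)" unfolding P_eq_cone by (rule cone_ideal)
  show "carrier (poly_ring n) \<noteq> P" using one_in_T by (auto simp: T_def)
  fix a b assume "a \<in> carrier (poly_ring n)" "b \<in> carrier (poly_ring n)" "a \<otimes>\<^bsub>poly_ring n\<^esub> b \<in> P"
  then show "a \<in> P \<or> b \<in> P" using T_mult[of a b] by (auto simp: T_def)
qed (rule poly_ring.is_cring)

lemma associated_primes_iff:
  "Q \<in> associated_primes (poly_ring n) (residue_module (poly_ring n) (polys_over E :: 'k mpoly set)) \<longleftrightarrow>
     primeideal Q (poly_ring n) \<and> (\<exists>p\<in>polys_in {1..n}. Q = {f \<in> polys_in {1..n}. f * p \<in> polys_over E})"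
proof -
  have "annihilator (poly_ring n) loc.M (polys_over E +>\<^bsub>poly_ring n\<^esub> p) = {f \<in> polys_in {1..n}. f * p
      \<in> polys_over E}"
    if p: "p \<in> polys_in {1..n}" for p
  proof -
    have "f \<odot>\<^bsub>loc.M\<^esub> (polys_over E +>\<^bsub>poly_ring n\<^esub> p) = \<zero>\<^bsub>loc.M\<^esub> \<longleftrightarrow> f * p \<in> polys_over E"
      if f: "f \<in> polys_in {1..n}" for f
    proof -
      have "f * p \<in> polys_in {1..n}" using f p by (rule polys_in_closed)
      moreover have "0 \<in> polys_in {1..n}" by (simp add: polys_in_eq)
      ultimately show ?thesis
        using f p loc.coset_eq_iff[of "f * p" 0] loc.M_smult[of f p] by (simp add: loc.M_zero)
    qed
    then show ?thesis by (auto simp: annihilator_def)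
  qed
  then show ?thesis by (auto simp: associated_primes_def loc.carrier_M)
qed

text \<open>\<open>P\<close> is exhibited as the annihilator of the class of a monomial, whose
  exponent \<open>q\<close> is a socle exponent \<open>w\<close> enlarged by variables of
  \<open>Z\<close>.\<close>

lemma P_associated:
  assumes "std_exps \<noteq> {}"
  shows "P \<in> associated_primes (poly_ring n) (residue_module (poly_ring n) (polys_over E :: 'k mpoly
      set))"
proof -
  \<comment> \<open>The largest standard exponent in the linear order: each
    \<open>w + single j 1\<close> is larger, hence no longer standard, hence in
    \<open>sat_exps\<close>.\<close>
  define w where "w = Max std_exps"
  have w: "w \<in> std_exps" unfolding w_def using finite_std_exps assms by (rule Max_in)
  have "\<exists>z\<in>exps Z. w + single j 1 + z \<in> E" if j: "j \<in> A" for j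
  proof -
    have "w + 0 < w + single j 1"
      using expo_nonneg[of "single j 1"]
      by (intro add_strict_left_mono) (metis (full_types) keys_single keys_zero insert_not_empty
          order.not_eq_order_implies_strict zero_neq_one)
    then have "w + single j 1 \<notin> std_exps"
      using Max_ge[OF finite_std_exps, of "w + single j 1"] unfolding w_def by auto
    then have "w + single j 1 \<in> sat_exps" using std_exps_add[OF w, of "single j 1"] j
      by (auto simp: single_in_exps)
    then show ?thesis by (auto simp: sat_exps_def)
  qed
  then obtain z where z: "\<And>j. j \<in> A \<Longrightarrow> z j \<in> exps Z \<and> w + single j 1 + z j \<in> E" by metis
  \<comment> \<open>A single monomial in the variables \<open>Z\<close> that works for every
    \<open>j\<close> at once: each \<open>z j\<close> divides it.\<close>
  define zz where "zz = (\<Sum>j\<in>A. z j)"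
  have sum_Z: "sum z F \<in> exps Z" if "F \<subseteq> A" for F
    using that z by (induction F rule: infinite_finite_induct) auto
  have zz: "zz \<in> exps Z" unfolding zz_def by (rule sum_Z) simp
  define q where "q = w + zz"
  have wA: "w \<in> exps A" "w \<notin> sat_exps" using w by (auto simp: std_exps_def)
  have q_in: "q \<in> exps {1..n}" using wA zz exps_A_sub exps_Z_sub by (auto simp: q_def)
  have "f * monomial q \<in> polys_over E \<longleftrightarrow> f \<in> P" if f: "f \<in> polys_in {1..n}" for f
  proof
    assume fq: "f * monomial q \<in> polys_over E"
    show "f \<in> P"
    proof (rule ccontr)
      assume "f \<notin> P"
      then obtain v where v: "v \<in> keys f" "keys v \<inter> A = {}" using f by (auto simp: P_def)
      then have vZ: "v \<in> exps Z" using key_exps[OF f] by (auto simp: exps_def Z_def)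
      have "keys (monomial q * f) \<subseteq> E" using fq by (simp add: polys_over_def mult.commute)
      then have "q + v \<in> E" using v by (auto simp: keys_monomial_mult)
      then have "w + (zz + v) \<in> E" by (simp add: q_def add.assoc)
      then show False using wA vZ zz by (auto simp: sat_exps_def)
    qed
  next
    assume fP: "f \<in> P"
    have "q + v \<in> E" if v: "v \<in> keys f" for v
    proof -
      obtain j where j: "j \<in> keys v" "j \<in> A" using fP v by (auto simp: P_def)
      have v_eq: "v = single j 1 + (v - single j 1)"
        using j(1) by (rule minus_single_add)
      then have "v - single j 1 \<in> exps {1..n}" using key_exps[OF f v] by (metis exps_add_iff)
      moreover have "sum z (A - {j}) \<in> exps {1..n}" using sum_Z[of "A - {j}"] exps_Z_sub by auto
      ultimately have "w + single j 1 + z j + (sum z (A - {j}) + (v - single j 1)) \<in> E"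
        using z[OF j(2)] by (intro expo_idealD[OF E, of "w + single j 1 + z j"]) auto
      moreover have "zz = z j + sum z (A - {j})" unfolding zz_def using finite_A j
          by (simp add: sum.remove)
      ultimately show ?thesis unfolding q_def by (subst v_eq) (simp add: ac_simps)
    qed
    then have "keys (monomial q * f) \<subseteq> E" by (auto simp: keys_monomial_mult)
    then show "f * monomial q \<in> polys_over E" by (simp add: polys_over_def mult.commute)
  qed
  then have "P = {f \<in> polys_in {1..n}. f * monomial q \<in> polys_over E}" by (auto simp: P_def)
  moreover have "(monomial q :: 'k mpoly) \<in> polys_in {1..n}" using q_in by (simp add: polys_in_eq)
  ultimately show ?thesis unfolding associated_primes_iff using primeideal_P by blast
qed

end

lemma prime_monomial_variable:
  fixes Q :: "'k::field mpoly set"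
  assumes Q: "primeideal Q (poly_ring n)" and "monomial v \<in> Q" "v \<in> exps {1..n}"
  shows "\<exists>j\<in>keys v. monomial (single j 1) \<in> Q"
  using assms(2,3)
proof (induction "\<Sum>i\<in>{1..n}. lookup v i" arbitrary: v rule: less_induct)
  case less
  interpret Q: primeideal Q "poly_ring n" by fact
  have "v \<noteq> 0"
  proof
    assume "v = 0"
    then have "1 \<in> Q" using less(2) by (simp add: monomial_def)
    then show False using Q.one_imp_carrier Q.I_notcarr by simp
  qed
  then obtain j where j: "j \<in> keys v" by (metis keys_eq_empty ex_in_conv)
  define w where "w = v - single j 1"
  have v_eq: "v = single j 1 + w"
    unfolding w_def using j by (rule minus_single_add)
  have in_exps: "single j 1 \<in> exps {1..n}" "w \<in> exps {1..n}" using less(3) v_eq by (metis exps_add_iff)+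
  have "monomial (single j 1) * (monomial w :: 'k mpoly) \<in> Q" using less(2) v_eq
      by (simp add: monomial_mult)
  then consider "(monomial (single j 1) :: 'k mpoly) \<in> Q" | "(monomial w :: 'k mpoly) \<in> Q"
    using Q.I_prime[of "monomial (single j 1)" "monomial w"] in_exps by (auto simp: polys_in_eq)
  then show ?case
  proof cases
    case 1
    then show ?thesis using j by blast
  next
    case 2
    have "j \<in> {1..n}" using j less(3) by (auto simp: exps_def)
    then have "(\<Sum>i\<in>{1..n}. lookup w i) < (\<Sum>i\<in>{1..n}. lookup v i)"
      by (intro sum_strict_mono_ex1) (auto simp: v_eq lookup_add intro!: bexI[of _ j])
    then show ?thesis using less(1)[OF _ 2 in_exps(2)] by (auto simp: v_eq keys_add_nat)
  qed
qed

text \<open>The product of the least terms of \<open>f\<close> and of \<open>p2\<close>, which is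
  \<open>p\<close> without its terms in the ideal, lands in \<open>E\<close>. If the least monomial
  of \<open>f\<close> were not in the prime \<open>Q\<close>, then \<open>Q\<close> would also be
  the annihilator of that monomial times \<open>p\<close>, which has fewer terms outside
  \<open>E\<close>, against \<open>minimal\<close>. So this monomial lies in \<open>Q\<close>;
  subtracting its term from \<open>f\<close> allows induction on the number of terms.\<close>

lemma associated_prime_monomials:
  fixes p :: "'k::field mpoly"
  assumes E: "expo_ideal {1..n} E" and Q: "primeideal Q (poly_ring n)"
    and p: "p \<in> polys_in {1..n}" "Q = {f \<in> polys_in {1..n}. f * p \<in> polys_over E}"
    and minimal: "\<And>p'. p' \<in> polys_in {1..n} \<Longrightarrow> Q = {f \<in> polys_in {1..n}. f * p' \<in> polys_over E} \<Longrightarrow>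
      card (keys p - E) \<le> card (keys p' - E)"
  shows "f \<in> Q \<Longrightarrow> v \<in> keys f \<Longrightarrow> monomial v \<in> Q"
proof (induction "card (keys f)" arbitrary: f v rule: less_induct)
  case less
  interpret Q: primeideal Q "poly_ring n" by fact
  note Qd = ideal_poly_ringD[OF Q.is_ideal]
  note Ed = ideal_poly_ringD[OF ideal_polys_over[OF E, where 'k='k]]
  have fc: "f \<in> polys_in {1..n}" and fp: "f * p \<in> polys_over E" using less(2) p(2) by auto
  define p2 where "p2 = pm_restrict (- E) p"
  have keys_p2: "keys p2 = keys p - E" by (auto simp: p2_def)
  have "pm_restrict E p \<in> polys_over E" by (simp add: polys_over_def)
  then have fE: "f * pm_restrict E p \<in> polys_over E" using fc by (intro Ed(5))
  have "f * p = f * pm_restrict E p + f * p2"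
    unfolding p2_def by (simp flip: distrib_left add: pm_restrict_split)
  then have "f * p2 = f * p - f * pm_restrict E p" by simp
  then have fp2: "f * p2 \<in> polys_over E" using Ed(4)[OF fp fE] by simp
  have "p2 \<noteq> 0"
  proof
    assume "p2 = 0"
    then have "p \<in> polys_over E" using keys_p2 by (auto simp: polys_over_def)
    then have "1 \<in> Q" using p by (simp add: polys_in_eq one_in_polys_over)
    then show False using Q.one_imp_carrier Q.I_notcarr by simp
  qed
  moreover have "f \<noteq> 0" using less(3) by auto
  ultimately have u0: "Min (keys f) + Min (keys p2) \<in> keys (f * p2)"
    by (intro Min_keys_mult)
  define a where "a = Min (keys f)"
  define b where "b = Min (keys p2)"
  have "keys f \<noteq> {}" "keys p2 \<noteq> {}" using \<open>f \<noteq> 0\<close> \<open>p2 \<noteq> 0\<close> by (metis keys_eq_empty)+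
  then have a: "a \<in> keys f" and b: "b \<in> keys p2"
    unfolding a_def b_def by (auto intro: Min_in)
  have abE: "a + b \<in> E" using u0 fp2 unfolding a_def b_def by (auto simp: polys_over_def)
  have a_exps: "a \<in> exps {1..n}" using a fc by (auto simp: polys_in_eq polys_over_def)
  have aQ: "monomial a \<in> Q"
  proof (rule ccontr)
    assume no: "monomial a \<notin> Q"
    let ?p = "monomial a * p"
    have mc: "(monomial a :: 'k mpoly) \<in> polys_in {1..n}" using a_exps by (simp add: polys_in_eq)
    have "g * ?p \<in> polys_over E \<longleftrightarrow> g \<in> Q" if g: "g \<in> polys_in {1..n}" for g
    proof -
      have "g * ?p \<in> polys_over E \<longleftrightarrow> g * monomial a \<in> Q"
        using g mc by (auto simp: p(2) mult.assoc intro: polys_in_closed)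
      also have "\<dots> \<longleftrightarrow> g \<in> Q"
        using Q.I_prime[of g "monomial a"] no g mc Qd(5)[of "monomial a" g] by (auto simp: mult.commute)
      finally show ?thesis .
    qed
    then have "Q = {g \<in> polys_in {1..n}. g * ?p \<in> polys_over E}" using Qd(1) by blast
    then have "card (keys p - E) \<le> card (keys ?p - E)"
      using p(1) mc by (intro minimal polys_in_closed)
    moreover have "keys ?p - E \<subseteq> (+) a ` (keys p2 - {b})"
    proof
      fix x assume x: "x \<in> keys ?p - E"
      then obtain y where y: "x = a + y" "y \<in> keys p" by (auto simp: keys_monomial_mult)
      have "y \<notin> E" using expo_idealD[OF E _ a_exps, of y] x y by (auto simp: add.commute)
      then show "x \<in> (+) a ` (keys p2 - {b})" using x y abE keys_p2 by auto
    qed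
    then have "card (keys ?p - E) \<le> card (keys p2 - {b})"
      by (intro surj_card_le) auto
    moreover have "card (keys p2 - {b}) < card (keys p2)"
      using b by (intro card_Diff1_less) auto
    ultimately show False using keys_p2 by simp
  qed
  show ?case
  proof (cases "v = a")
    case False
    define f' where "f' = pm_restrict (- {a}) f"
    have "pm_restrict {a} f \<in> Q"
      by (rule monomial_closed_poly[OF Q.is_ideal]) (use aQ fc in \<open>auto simp: polys_in_eq
          polys_over_def\<close>)
    moreover have "f' = f - pm_restrict {a} f"
      using pm_restrict_split[of "{a}" f] unfolding f'_def by (metis add_diff_cancel_left')
    ultimately have "f' \<in> Q" using Qd(4) less(2) by simp
    moreover have "card (keys f') < card (keys f)"
      using a by (intro psubset_card_mono) (auto simp: f'_def)
    moreover have "v \<in> keys f'" using less(3) False by (simp add: f'_def)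
    ultimately show ?thesis using less(1) by blast
  qed (use aQ in simp)
qed

lemma associated_prime_is_monomial_prime:
  fixes Q :: "'k::field mpoly set"
  assumes E: "expo_ideal {1..n} E"
    and Q: "Q \<in> associated_primes (poly_ring n) (residue_module (poly_ring n) (polys_over E))"
  obtains A where "A \<subseteq> {1..n}" "Q = monomial_localization.P n A"
proof -
  interpret L0: monomial_localization n E "{}" "TYPE('k)" using E by unfold_locales auto
  have prime: "primeideal Q (poly_ring n)" using Q by (simp add: L0.associated_primes_iff)
  then interpret Q: primeideal Q "poly_ring n" .
  note Qd = ideal_poly_ringD[OF Q.is_ideal]
  let ?K = "\<lambda>p. p \<in> polys_in {1..n} \<and> Q = {f \<in> polys_in {1..n}. f * p \<in> polys_over E}"
  have "\<exists>p. ?K p" using Q by (auto simp: L0.associated_primes_iff)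
  then obtain p0 where "?K p0" ..
  from ex_has_least_nat[of ?K, OF this, of "\<lambda>p. card (keys p - E)"]
  obtain p where "?K p \<and> (\<forall>p'. ?K p' \<longrightarrow> card (keys p - E) \<le> card (keys p' - E))" ..
  then have p: "p \<in> polys_in {1..n}" "Q = {f \<in> polys_in {1..n}. f * p \<in> polys_over E}"
    "\<And>p'. p' \<in> polys_in {1..n} \<Longrightarrow> Q = {f \<in> polys_in {1..n}. f * p' \<in> polys_over E} \<Longrightarrow>
      card (keys p - E) \<le> card (keys p' - E)" by blast+
  have mono: "monomial v \<in> Q" if "f \<in> Q" "v \<in> keys f" for f v
    using associated_prime_monomials[OF E prime p that] by simp
  define A where "A = {j \<in> {1..n}. monomial (single j 1) \<in> Q}"
  interpret LA: monomial_localization n E A "TYPE('k)" using E by unfold_locales (auto simp: A_def)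
  have "Q = LA.P"
  proof
    show "Q \<subseteq> LA.P"
    proof
      fix f assume f: "f \<in> Q"
      then have fc: "f \<in> polys_in {1..n}" using Qd(1) by blast
      have "keys v \<inter> A \<noteq> {}" if v: "v \<in> keys f" for v
      proof -
        have "v \<in> exps {1..n}" using v fc by (auto simp: polys_in_eq polys_over_def)
        moreover from this obtain j where "j \<in> keys v" "monomial (single j 1) \<in> Q"
          using prime_monomial_variable[OF prime mono[OF f v]] by blast
        ultimately have "j \<in> keys v \<inter> A" by (auto simp: A_def exps_def)
        then show ?thesis by blast
      qed
      then show "f \<in> LA.P" using fc by (auto simp: LA.P_def)
    qed
    show "LA.P \<subseteq> Q"
    proof
      fix f assume f: "f \<in> LA.P"
      then have fc: "f \<in> polys_in {1..n}" by (simp add: LA.P_def)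
      show "f \<in> Q"
      proof (rule monomial_closed_poly[OF Q.is_ideal fc])
        fix v assume v: "v \<in> keys f"
        then have vc: "v \<in> exps {1..n}" using fc by (auto simp: polys_in_eq polys_over_def)
        obtain j where j: "j \<in> keys v" "j \<in> A" using f v by (auto simp: LA.P_def)
        have v_eq: "v = single j 1 + (v - single j 1)"
          using j(1) by (rule minus_single_add)
        then have "v - single j 1 \<in> exps {1..n}" using vc by (metis exps_add_iff)
        then have "monomial (v - single j 1) * monomial (single j 1) \<in> Q"
          using j by (intro Qd(5)) (auto simp: A_def polys_in_eq)
        then show "monomial v \<in> Q" by (subst v_eq) (simp add: monomial_mult add.commute)
      qed
    qed
  qed
  with LA.A show ?thesis by (rule that)
qed

section \<open>Krull dimension\<close>

context cring
begin

lemma coset_mem_image_iff: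
  assumes I: "ideal I R" and J: "ideal J R" "I \<subseteq> J" and a: "a \<in> carrier R"
  shows "I +> a \<in> (+>) I ` J \<longleftrightarrow> a \<in> J"
proof
  assume "I +> a \<in> (+>) I ` J"
  then obtain j where j: "j \<in> J" "I +> a = I +> j" by blast
  have jc: "j \<in> carrier R" using J(1) j(1) by (rule ideal.Icarr)
  then have "a \<ominus> j \<in> J" using quotient_eq_iff_same_a_r_cos[OF I a jc] j J by blast
  then have "(a \<ominus> j) \<oplus> j \<in> J"
    using j J(1) by (meson additive_subgroup.a_closed ideal.axioms(1))
  moreover have "(a \<ominus> j) \<oplus> j = a" using a jc by algebra
  ultimately show "a \<in> J" by simp
qed blast

lemma carrier_quot: "carrier (R Quot I) = {I +> a | a. a \<in> carrier R}"
  by (auto simp: FactRing_def A_RCOSETS_def')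

lemma primeideal_image_quot:
  assumes I: "ideal I R" and J: "primeideal J R" "I \<subseteq> J"
  shows "primeideal ((+>) I ` J) (R Quot I)"
proof -
  interpret J: primeideal J R by fact
  interpret I: ideal I R by fact
  note iff = coset_mem_image_iff[OF I J.is_ideal J(2)]
  show ?thesis
  proof (rule primeidealI)
    show "ideal ((+>) I ` J) (R Quot I)" by (rule ring_ideal_imp_quot_ideal[OF I J.is_ideal])
    show "cring (R Quot I)" by (rule I.quotient_is_cring[OF is_cring])
    show "carrier (R Quot I) \<noteq> (+>) I ` J"
    proof
      assume eq: "carrier (R Quot I) = (+>) I ` J"
      have "I +> \<one> \<in> carrier (R Quot I)" by (auto simp: carrier_quot)
      then have "\<one> \<in> J" using iff[of \<one>] eq by simp
      then show False using J.one_imp_carrier J.I_notcarr by simp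
    qed
    fix x y assume "x \<in> carrier (R Quot I)" "y \<in> carrier (R Quot I)"
        and xy: "x \<otimes>\<^bsub>R Quot I\<^esub> y \<in> (+>) I ` J"
    then obtain a b where ab: "a \<in> carrier R" "x = I +> a" "b \<in> carrier R" "y = I +> b"
        by (auto simp: carrier_quot)
    then have "x \<otimes>\<^bsub>R Quot I\<^esub> y = I +> (a \<otimes> b)" by (simp add: FactRing_def I.rcoset_mult_add)
    then have "a \<otimes> b \<in> J" using iff[of "a \<otimes> b"] xy ab by simp
    then have "a \<in> J \<or> b \<in> J" using ab by (intro J.I_prime)
    then show "x \<in> (+>) I ` J \<or> y \<in> (+>) I ` J" using ab by blast
  qed
qed

lemma primeideal_vimage_quot:
  assumes I: "ideal I R" and Q: "primeideal Q (R Quot I)"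
  defines "J \<equiv> {a \<in> carrier R. I +> a \<in> Q}"
  shows "primeideal J R" "I \<subseteq> J" "Q = (+>) I ` J"
proof -
  interpret Q: primeideal Q "R Quot I" by fact
  interpret I: ideal I R by fact
  show "primeideal J R"
  proof (rule primeidealI)
    show J: "ideal J R" unfolding J_def
        by (rule ring_hom_ring.ideal_vimage[OF I.rcos_ring_hom_ring Q.is_ideal])
    show "carrier R \<noteq> J"
    proof
      assume "carrier R = J"
      then have "I +> \<one> \<in> Q" using J_def by blast
      then have "\<one>\<^bsub>R Quot I\<^esub> \<in> Q" by (simp add: FactRing_def)
      then show False using Q.one_imp_carrier Q.I_notcarr by simp
    qed
    fix a b assume ab: "a \<in> carrier R" "b \<in> carrier R" "a \<otimes> b \<in> J"
    then have "(I +> a) \<otimes>\<^bsub>R Quot I\<^esub> (I +> b) \<in> Q"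
      by (simp add: J_def FactRing_def I.rcoset_mult_add)
    then have "I +> a \<in> Q \<or> I +> b \<in> Q" using ab by (intro Q.I_prime) (auto simp: carrier_quot)
    then show "a \<in> J \<or> b \<in> J" using ab by (auto simp: J_def)
  qed (rule is_cring)
  have "I +> a = \<zero>\<^bsub>R Quot I\<^esub>" if "a \<in> I" for a
    using a_rcos_zero[OF I that] by (simp add: FactRing_def)
  then show "I \<subseteq> J" using Q.zero_closed I.a_Hcarr by (auto simp: J_def)
  show "Q = (+>) I ` J"
    using Q.a_subset by (auto simp: J_def carrier_quot)
qed

lemma krull_dim_quot:
  assumes I: "ideal I R"
  shows "krull_dim (R Quot I) = (SUP k \<in> {k. \<exists>P :: nat \<Rightarrow> 'a set.
    (\<forall>i\<le>k. primeideal (P i) R \<and> I \<subseteq> P i) \<and> (\<forall>i<k. P i \<subset> P (Suc i))}. enat k)"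
proof -
  have "(\<exists>Q :: nat \<Rightarrow> _. (\<forall>i\<le>k. primeideal (Q i) (R Quot I)) \<and> (\<forall>i<k. Q i \<subset> Q (Suc i))) \<longleftrightarrow>
     (\<exists>P :: nat \<Rightarrow> 'a set. (\<forall>i\<le>k. primeideal (P i) R \<and> I \<subseteq> P i) \<and> (\<forall>i<k. P i \<subset> P (Suc i)))" for k
  proof
    assume "\<exists>Q :: nat \<Rightarrow> _. (\<forall>i\<le>k. primeideal (Q i) (R Quot I)) \<and> (\<forall>i<k. Q i \<subset> Q (Suc i))"
    then obtain Q :: "nat \<Rightarrow> _" where Q: "\<And>i. i \<le> k \<Longrightarrow> primeideal (Q i) (R Quot I)"
        "\<And>i. i < k \<Longrightarrow> Q i \<subset> Q (Suc i)"
      by blast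
    let ?P = "\<lambda>i. {a \<in> carrier R. I +> a \<in> Q i}"
    have "?P i \<subset> ?P (Suc i)" if "i < k" for i
    proof -
      have "?P i \<noteq> ?P (Suc i)"
        using Q(2)[OF that] primeideal_vimage_quot(3)[OF I Q(1), of i] primeideal_vimage_quot(3)[OF I
            Q(1), of "Suc i"] that
        by force
      then show ?thesis using Q(2)[OF that] by blast
    qed
    then show "\<exists>P :: nat \<Rightarrow> 'a set. (\<forall>i\<le>k. primeideal (P i) R \<and> I \<subseteq> P i) \<and> (\<forall>i<k. P i \<subset> P (Suc i))"
      using primeideal_vimage_quot(1,2)[OF I Q(1)] by (intro exI[of _ ?P]) blast
  next
    assume "\<exists>P :: nat \<Rightarrow> 'a set. (\<forall>i\<le>k. primeideal (P i) R \<and> I \<subseteq> P i) \<and> (\<forall>i<k. P i \<subset> P (Suc i))"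
    then obtain P :: "nat \<Rightarrow> 'a set" where P: "\<And>i. i \<le> k \<Longrightarrow> primeideal (P i) R \<and> I \<subseteq> P i"
        "\<And>i. i < k \<Longrightarrow> P i \<subset> P (Suc i)"
      by blast
    have "(+>) I ` P i \<subset> (+>) I ` P (Suc i)" if i: "i < k" for i
    proof -
      obtain a where a: "a \<in> P (Suc i)" "a \<notin> P i" using P(2)[OF i] by blast
      have pi: "ideal (P i) R" "I \<subseteq> P i" and ps: "ideal (P (Suc i)) R"
        using P(1)[of i] P(1)[of "Suc i"] i by (auto simp: primeideal_def)
      have "I +> a \<notin> (+>) I ` P i"
        using coset_mem_image_iff[OF I pi, of a] a ideal.Icarr[OF ps] by blast
      then show ?thesis using a P(2)[OF i] by blast
    qed
    then show "\<exists>Q :: nat \<Rightarrow> _. (\<forall>i\<le>k. primeideal (Q i) (R Quot I)) \<and> (\<forall>i<k. Q i \<subset> Q (Suc i))"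
      using primeideal_image_quot[OF I] P(1) by (intro exI[of _ "\<lambda>i. (+>) I ` P i"]) blast
  qed
  then show ?thesis by (simp add: krull_dim_def)
qed

end

section \<open>Algebraic dependence by linear algebra and counting\<close>

lemma homogeneous_system_nontrivial:
  fixes a :: "'b \<Rightarrow> 'x \<Rightarrow> 'k::field"
  assumes "finite X" "finite B" "card X < card B"
  shows "\<exists>c. (\<exists>b\<in>B. c b \<noteq> 0) \<and> (\<forall>x\<in>X. (\<Sum>b\<in>B. c b * a b x) = 0)"
  using assms
proof (induction X arbitrary: a B rule: finite_induct)
  case empty
  then obtain b where "b \<in> B" by fastforce
  then show ?case by (intro exI[of _ "\<lambda>_. 1"]) auto
next
  case (insert x X)
  show ?case
  proof (cases "\<forall>b\<in>B. a b x = 0")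
    case True
    have "card X < card B" using insert by simp
    then obtain c where "\<exists>b\<in>B. c b \<noteq> 0" "\<forall>y\<in>X. (\<Sum>b\<in>B. c b * a b y) = 0" using insert by blast
    then show ?thesis using True by (intro exI[of _ c]) simp
  next
    case False
    then obtain b0 where b0: "b0 \<in> B" "a b0 x \<noteq> 0" by blast
    define B' where "B' = B - {b0}"
    have B': "finite B'" "card X < card B'" using insert b0 by (auto simp: B'_def)
    \<comment> \<open>Gaussian elimination: the equation \<open>x\<close> is solved for the unknown
      \<open>b0\<close> and substituted into the others, leaving fewer equations and one unknown
      less.\<close>
    define a' where "a' b y = a b y - a b x / a b0 x * a b0 y" for b y
    obtain c where c: "\<exists>b\<in>B'. c b \<noteq> 0" "\<forall>y\<in>X. (\<Sum>b\<in>B'. c b * a' b y) = 0"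
      using insert(3)[OF B', of a'] by blast
    define c' where "c' = c(b0 := - (\<Sum>b\<in>B'. c b * a b x) / a b0 x)"
    have sum: "(\<Sum>b\<in>B. c' b * a b y) = c' b0 * a b0 y + (\<Sum>b\<in>B'. c b * a b y)" for y
      using insert b0 by (subst sum.remove[of B b0]) (auto simp: B'_def c'_def intro!: sum.cong)
    have "(\<Sum>b\<in>B. c' b * a b y) = 0" if "y \<in> insert x X" for y
    proof (cases "y = x")
      case True
      then show ?thesis unfolding sum using b0 by (simp add: c'_def)
    next
      case False
      have "(\<Sum>b\<in>B'. c b * a' b y) = (\<Sum>b\<in>B'. c b * a b y) - (\<Sum>b\<in>B'. c b * a b x) / a b0 x * a b0 y"
        unfolding sum_divide_distrib sum_distrib_right sum_subtractf[symmetric]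
        by (intro sum.cong refl) (simp add: a'_def right_diff_distrib)
      then show ?thesis using c False that unfolding sum by (simp add: c'_def)
    qed
    moreover have "\<exists>b\<in>B. c' b \<noteq> 0" using c by (auto simp: B'_def c'_def)
    ultimately show ?thesis by blast
  qed
qed

text \<open>Bounding each exponent, rather than the total degree, makes the number of exponents a
  pure power and keeps the later count elementary.\<close>

definition expo_box :: "nat set \<Rightarrow> nat \<Rightarrow> (nat \<Rightarrow>\<^sub>0 nat) set" where
  "expo_box Y d = {v \<in> exps Y. \<forall>i. lookup v i \<le> d}"

lemma bij_betw_expo_box:
  assumes "finite Y"
  shows "bij_betw (\<lambda>v. restrict (lookup v) Y) (expo_box Y d) (Y \<rightarrow>\<^sub>E {..d})"
proof (rule bij_betw_imageI)
  show "inj_on (\<lambda>v. restrict (lookup v) Y) (expo_box Y d)"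
  proof (rule inj_onI)
    fix v w assume v: "v \<in> expo_box Y d" and w: "w \<in> expo_box Y d"
      and eq: "restrict (lookup v) Y = restrict (lookup w) Y"
    show "v = w"
    proof (rule poly_mapping_eqI)
      fix i
      show "lookup v i = lookup w i"
      proof (cases "i \<in> Y")
        case True
        then show ?thesis using fun_cong[OF eq, of i] by simp
      next
        case False
        then have "i \<notin> keys v" "i \<notin> keys w" using v w by (auto simp: expo_box_def exps_def)
        then show ?thesis by (simp add: in_keys_iff)
      qed
    qed
  qed
  show "(\<lambda>v. restrict (lookup v) Y) ` expo_box Y d = Y \<rightarrow>\<^sub>E {..d}"
  proof
    show "(\<lambda>v. restrict (lookup v) Y) ` expo_box Y d \<subseteq> Y \<rightarrow>\<^sub>E {..d}"
      by (auto simp: expo_box_def)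
    show "Y \<rightarrow>\<^sub>E {..d} \<subseteq> (\<lambda>v. restrict (lookup v) Y) ` expo_box Y d"
    proof
      fix f assume f: "f \<in> Y \<rightarrow>\<^sub>E {..d}"
      define g where "g i = (if i \<in> Y then f i else 0)" for i
      have "finite {i. g i \<noteq> 0}" by (rule finite_subset[OF _ assms]) (auto simp: g_def)
      then have lookup: "lookup (Abs_poly_mapping g) = g" by (rule lookup_Abs_poly_mapping)
      have "restrict g Y = f" using f by (auto simp: g_def restrict_def PiE_def extensional_def)
      moreover have "Abs_poly_mapping g \<in> expo_box Y d"
        using f by (auto simp: expo_box_def exps_def in_keys_iff lookup) (auto simp: g_def split:
            if_splits)
      ultimately show "f \<in> (\<lambda>v. restrict (lookup v) Y) ` expo_box Y d"
        by (intro image_eqI[of _ _ "Abs_poly_mapping g"]) (auto simp: lookup)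
    qed
  qed
qed

lemma card_expo_box: "finite Y \<Longrightarrow> card (expo_box Y d) = (d + 1) ^ card Y"
  and finite_expo_box: "finite Y \<Longrightarrow> finite (expo_box Y d)"
proof -
  assume Y: "finite Y"
  note bij = bij_betw_expo_box[OF Y, of d]
  show "card (expo_box Y d) = (d + 1) ^ card Y"
    using bij_betw_same_card[OF bij] Y by (simp add: card_PiE Suc_eq_plus1 del: add_Suc_right)
  show "finite (expo_box Y d)"
    using bij_betw_finite[OF bij] Y by (simp add: finite_PiE)
qed

lemma polys_over_box_mult:
  "\<lbrakk>p \<in> polys_over (expo_box Y d); q \<in> polys_over (expo_box Y e)\<rbrakk> \<Longrightarrow> p * q
      \<in> polys_over (expo_box Y (d + e))"
  by (rule polys_over_mult) (auto simp: expo_box_def lookup_add add_mono)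

lemma one_in_polys_over_box [simp]: "1 \<in> polys_over (expo_box Y d)"
  by (rule one_in_polys_over) (simp add: expo_box_def)

lemma polys_over_box_power: "p \<in> polys_over (expo_box Y d) \<Longrightarrow> p ^ m \<in> polys_over (expo_box Y (m * d))"
  by (induction m) (auto intro: polys_over_box_mult)

lemma polys_over_box_prod:
  "finite F \<Longrightarrow> (\<And>i. i \<in> F \<Longrightarrow> f i \<in> polys_over (expo_box Y (d i))) \<Longrightarrow> prod f F
      \<in> polys_over (expo_box Y (sum d F))"
  by (induction F rule: finite_induct) (auto intro: polys_over_box_mult)

lemma expo_box_mono: "d \<le> e \<Longrightarrow> expo_box Y d \<subseteq> expo_box Y e"
  by (auto simp: expo_box_def intro: order.trans)

lemma polys_in_box:
  assumes "p \<in> polys_in Y"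
  shows "\<exists>d. p \<in> polys_over (expo_box Y d)"
proof -
  let ?M = "(\<Union>v\<in>keys p. lookup v ` keys v)"
  have "finite ?M" by auto
  have "lookup v i \<le> Max (insert 0 ?M)" if "v \<in> keys p" for v i
  proof (cases "i \<in> keys v")
    case True
    then show ?thesis using that by (intro Max_ge) auto
  qed (simp add: in_keys_iff)
  then have "p \<in> polys_over (expo_box Y (Max (insert 0 ?M)))"
    using assms by (auto simp: polys_over_def polys_in_eq expo_box_def)
  then show ?thesis ..
qed

lemma polys_in_sum: "(\<And>i. i \<in> F \<Longrightarrow> f i \<in> polys_in Y) \<Longrightarrow> sum f F \<in> polys_in Y"
  unfolding polys_in_eq by (rule polys_over_sum)

text \<open>Counting: the monomials with exponents at most \<open>m\<close> in \<open>r + 1\<close>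
  polynomials in \<open>r\<close> variables are \<open>(m + 1) ^ (r + 1)\<close> many and lie in a
  space of dimension at most \<open>((m + 1) * C) ^ r\<close>, which is smaller for \<open>m = C ^
  r\<close>.\<close>

lemma algebraic_dependence:
  fixes y :: "nat \<Rightarrow> 'k::field mpoly"
  assumes Y: "finite Y" and y: "\<And>i. i \<le> card Y \<Longrightarrow> y i \<in> polys_in Y"
  obtains F c where "finite F" "F \<noteq> {}" "F \<subseteq> exps {..card Y}" "\<And>\<beta>. \<beta> \<in> F \<Longrightarrow> c \<beta> \<noteq> 0"
    "(\<Sum>\<beta>\<in>F. single 0 (c \<beta>) * (\<Prod>i\<le>card Y. y i ^ lookup \<beta> i)) = 0"
proof -
  define r where "r = card Y"
  have "\<exists>d. \<forall>i\<le>r. y i \<in> polys_over (expo_box Y d)"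
  proof -
    have "\<forall>i. \<exists>d. i \<le> r \<longrightarrow> y i \<in> polys_over (expo_box Y d)"
      using polys_in_box y unfolding r_def by blast
    then obtain d where d: "\<And>i. i \<le> r \<Longrightarrow> y i \<in> polys_over (expo_box Y (d i))" by metis
    have "y i \<in> polys_over (expo_box Y (Max (d ` {..r})))" if "i \<le> r" for i
      using d[OF that] polys_over_mono[OF expo_box_mono[of "d i" "Max (d ` {..r})" Y]] that by auto
    then show ?thesis by blast
  qed
  then obtain d where d: "\<And>i. i \<le> r \<Longrightarrow> y i \<in> polys_over (expo_box Y d)" by blast
  \<comment> \<open>Chosen so that \<open>(r + 1) * (m * d) + 1 \<le> (m + 1) * C\<close> for every
    \<open>m\<close>. With \<open>m = C ^ r\<close>, the number of equations is then at most
    \<open>(m + 1) ^ r * m\<close>, just below the number \<open>(m + 1) ^ (r + 1)\<close> of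
    unknowns.\<close>
  define C where "C = (r + 1) * d + 1"
  define m where "m = C ^ r"
  let ?B = "expo_box {..r} m"
  let ?X = "expo_box Y ((r + 1) * (m * d))"
  let ?f = "\<lambda>\<beta>. \<Prod>i\<le>r. y i ^ lookup \<beta> i"
  have f: "?f \<beta> \<in> polys_over ?X" if \<beta>: "\<beta> \<in> ?B" for \<beta>
  proof -
    have "y i ^ lookup \<beta> i \<in> polys_over (expo_box Y (m * d))" if "i \<le> r" for i
    proof -
      have "lookup \<beta> i * d \<le> m * d" using \<beta> by (simp add: expo_box_def)
      then show ?thesis using polys_over_box_power[OF d[OF that]] polys_over_mono[OF expo_box_mono]
          by blast
    qed
    then have "?f \<beta> \<in> polys_over (expo_box Y (\<Sum>i\<le>r. m * d))"
      by (intro polys_over_box_prod) auto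
    then show ?thesis by (simp add: algebra_simps)
  qed
  have "card ?X = ((r + 1) * (m * d) + 1) ^ r" using Y by (simp add: card_expo_box r_def)
  also have "\<dots> \<le> ((m + 1) * C) ^ r" by (intro power_mono) (simp_all add: C_def algebra_simps)
  also have "\<dots> = (m + 1) ^ r * m" by (simp add: power_mult_distrib m_def)
  also have "\<dots> < (m + 1) ^ r * (m + 1)" by simp
  also have "\<dots> = card ?B" by (simp add: card_expo_box)
  finally have "card ?X < card ?B" .
  then obtain c where c: "\<exists>\<beta>\<in>?B. c \<beta> \<noteq> 0" "\<forall>x\<in>?X. (\<Sum>\<beta>\<in>?B. c \<beta> * lookup (?f \<beta>) x) = 0"
    using homogeneous_system_nontrivial[of ?X ?B "\<lambda>\<beta>. lookup (?f \<beta>)"] Y by (auto simp: finite_expo_box)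
  have lookup_const: "lookup (single 0 e * p) x = e * lookup p x" for e :: 'k and p x
    by (simp flip: mult_map_scale_conv_mult add: map.rep_eq when_def)
  have zero: "(\<Sum>\<beta>\<in>?B. single 0 (c \<beta>) * ?f \<beta>) = 0"
  proof (rule poly_mapping_eqI)
    fix x
    have "(\<Sum>\<beta>\<in>?B. c \<beta> * lookup (?f \<beta>) x) = 0"
    proof (cases "x \<in> ?X")
      case False
      have "lookup (?f \<beta>) x = 0" if "\<beta> \<in> ?B" for \<beta>
        using f[OF that] False by (auto simp: polys_over_def in_keys_iff)
      then show ?thesis by simp
    qed (use c in blast)
    then show "lookup (\<Sum>\<beta>\<in>?B. single 0 (c \<beta>) * ?f \<beta>) x = lookup 0 x"
      by (simp add: lookup_sum lookup_const)
  qed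
  define F where "F = {\<beta> \<in> ?B. c \<beta> \<noteq> 0}"
  have "(\<Sum>\<beta>\<in>F. single 0 (c \<beta>) * ?f \<beta>) = (\<Sum>\<beta>\<in>?B. single 0 (c \<beta>) * ?f \<beta>)"
    by (intro sum.mono_neutral_left) (auto simp: F_def finite_expo_box)
  then have "(\<Sum>\<beta>\<in>F. single 0 (c \<beta>) * ?f \<beta>) = 0" using zero by simp
  moreover have "finite F" "F \<subseteq> exps {..r}"
      by (auto simp: F_def finite_expo_box) (simp add: expo_box_def)
  moreover have "F \<noteq> {}" "\<And>\<beta>. \<beta> \<in> F \<Longrightarrow> c \<beta> \<noteq> 0" using c(1) by (auto simp: F_def)
  ultimately show ?thesis unfolding r_def by (intro that)
qed

lemma prime_power_cancel:
  fixes Q :: "'k::field mpoly set"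
  assumes Q: "primeideal Q (poly_ring n)" and y: "y \<in> polys_in {1..n}" "y \<notin> Q"
      and h: "h \<in> polys_in {1..n}"
  shows "y ^ m * h \<in> Q \<Longrightarrow> h \<in> Q"
proof (induction m)
  case (Suc m)
  interpret Q: primeideal Q "poly_ring n" by fact
  have "y ^ m * h \<in> polys_in {1..n}"
    by (induction m) (auto simp: h y mult.assoc intro: polys_in_closed)
  moreover have "y * (y ^ m * h) \<in> Q" using Suc.prems by (simp add: mult.assoc)
  ultimately have "y ^ m * h \<in> Q" using Q.I_prime[of y "y ^ m * h"] y by auto
  then show ?case by (rule Suc.IH)
qed simp

text \<open>In an algebraic relation between elements \<open>y i \<in> R (Suc i) - R i\<close>,
  cancel powers of \<open>y 0, y 1, \<dots>\<close> in turn: only the lexicographically smallest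
  term survives, and it is a nonzero constant.\<close>

lemma prime_chain_no_relation:
  fixes y :: "nat \<Rightarrow> 'k::field mpoly"
  assumes R: "\<And>i. i \<le> Suc r \<Longrightarrow> primeideal (R i) (poly_ring n)" "\<And>i. i \<le> r \<Longrightarrow> R i \<subset> R (Suc i)"
    and y: "\<And>i. i \<le> r \<Longrightarrow> y i \<in> R (Suc i) \<and> y i \<notin> R i"
    and F: "finite F" "F \<noteq> {}" "F \<subseteq> exps {..r}" "\<And>\<beta>. \<beta> \<in> F \<Longrightarrow> c \<beta> \<noteq> 0"
  shows "(\<Sum>\<beta>\<in>F. single 0 (c \<beta>) * (\<Prod>i\<le>r. y i ^ lookup \<beta> i)) \<noteq> 0"
proof
  assume zero: "(\<Sum>\<beta>\<in>F. single 0 (c \<beta>) * (\<Prod>i\<le>r. y i ^ lookup \<beta> i)) = 0"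
  define \<alpha> where "\<alpha> = Min F"
  have \<alpha>: "\<alpha> \<in> F" "\<And>\<beta>. \<beta> \<in> F \<Longrightarrow> \<alpha> \<le> \<beta>" using F by (auto simp: \<alpha>_def)
  \<comment> \<open>\<open>F' m\<close> keeps the exponents that agree with the least exponent
    \<alpha> in the first \<open>m\<close> coordinates. \<open>G m\<close> is what is left of the
    relation on them once the powers of \<open>y 0\<close>, ..., \<open>y (m - 1)\<close> are
    cancelled; the invariant is \<open>G m \<in> R m\<close>.\<close>
  define F' where "F' m = {\<beta> \<in> F. \<forall>i<m. lookup \<beta> i = lookup \<alpha> i}" for m
  define G where "G m = (\<Sum>\<beta>\<in>F' m. single 0 (c \<beta>) * (\<Prod>i\<in>{m..r}. y i ^ lookup \<beta> i))" for m
  have fin: "finite (F' m)" for m using F by (simp add: F'_def)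
  have Rd: "ideal (R i) (poly_ring n)" if "i \<le> Suc r" for i using R(1)[OF that]
      by (simp add: primeideal_def)
  have yc: "y i \<in> polys_in {1..n}" if "i \<le> r" for i
    using y[OF that] ideal_poly_ringD(1)[OF Rd, of "Suc i"] that by auto
  have one: "(1 :: 'k mpoly) \<in> polys_in {1..n}" by (simp add: polys_in_eq one_in_polys_over)
  have pow: "p ^ e \<in> polys_in {1..n}" if "p \<in> polys_in {1..n}" for p :: "'k mpoly" and e
    using that one by (induction e) (auto intro: polys_in_closed)
  have prods: "prod f X \<in> polys_in {1..n}" if "\<And>i. i \<in> X \<Longrightarrow> f i \<in> polys_in {1..n}"
      for f :: "nat \<Rightarrow> 'k mpoly" and X
    using that one by (induction X rule: infinite_finite_induct) (auto intro: polys_in_closed)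
  have const: "single 0 e \<in> polys_in {1..n}" for e :: 'k
    by (simp add: polys_in_eq single_in_polys_over)
  have "m \<le> Suc r \<Longrightarrow> G m \<in> R m" for m
  proof (induction m)
    case 0
    have "G 0 = 0" using zero by (simp add: G_def F'_def atMost_atLeast0)
    then show ?case using ideal_poly_ringD(2)[OF Rd] by simp
  next
    case (Suc m)
    then have m: "m \<le> r" by simp
    \<comment> \<open>By the lexicographic order, \<alpha> has the least \<open>m\<close>-th
      exponent among those that agree with it before \<open>m\<close>. So this power of
      \<open>y m\<close> divides all of \<open>G m\<close>, and it cancels modulo the prime
      \<open>R m\<close>, which does not contain \<open>y m\<close>.\<close>
    have lex: "lookup \<alpha> m \<le> lookup \<beta> m" if "\<beta> \<in> F' m" for \<beta>
    proof (rule ccontr)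
      assume "\<not> lookup \<alpha> m \<le> lookup \<beta> m"
      then have "less_fun (lookup \<beta>) (lookup \<alpha>)"
        using that unfolding less_fun_def F'_def by (intro exI[of _ m]) auto
      then have "\<beta> < \<alpha>" by (simp add: less_poly_mapping.rep_eq)
      then show False using \<alpha>(2)[of \<beta>] that by (auto simp: F'_def)
    qed
    let ?g = "\<lambda>\<beta>. single 0 (c \<beta>) * (\<Prod>i\<in>{Suc m..r}. y i ^ lookup \<beta> i)"
    let ?e = "\<lambda>\<beta>. lookup \<beta> m - lookup \<alpha> m"
    have gc: "?g \<beta> \<in> polys_in {1..n}" for \<beta>
      by (intro polys_in_closed(4) const prods pow yc) auto
    define H where "H = (\<Sum>\<beta>\<in>F' m. y m ^ ?e \<beta> * ?g \<beta>)"
    have "G m = (\<Sum>\<beta>\<in>F' m. y m ^ lookup \<alpha> m * (y m ^ ?e \<beta> * ?g \<beta>))"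
      unfolding G_def
    proof (intro sum.cong refl)
      fix \<beta> assume "\<beta> \<in> F' m"
      have "(\<Prod>i\<in>{m..r}. y i ^ lookup \<beta> i) =
          y m ^ lookup \<beta> m * (\<Prod>i\<in>{Suc m..r}. y i ^ lookup \<beta> i)"
        using m by (rule prod.atLeast_Suc_atMost)
      moreover have "y m ^ lookup \<beta> m = y m ^ lookup \<alpha> m * y m ^ ?e \<beta>"
        using lex[OF \<open>\<beta> \<in> F' m\<close>] by (simp flip: power_add)
      ultimately show "single 0 (c \<beta>) * (\<Prod>i\<in>{m..r}. y i ^ lookup \<beta> i) =
          y m ^ lookup \<alpha> m * (y m ^ ?e \<beta> * ?g \<beta>)"
        by (simp only: mult.assoc mult.left_commute)
    qed
    then have "G m = y m ^ lookup \<alpha> m * H" by (simp add: H_def sum_distrib_left)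
    moreover have "H \<in> polys_in {1..n}"
      unfolding H_def by (intro polys_in_sum polys_in_closed(4)[OF pow[OF yc[OF m]] gc])
    moreover have "G m \<in> R m" using Suc by simp
    ultimately have "H \<in> R m"
      using prime_power_cancel[OF R(1) yc[OF m], of m H] y[OF m] m by simp
    then have H: "H \<in> R (Suc m)" using R(2)[OF m] by blast
    have sub: "F' (Suc m) \<subseteq> F' m" by (auto simp: F'_def)
    \<comment> \<open>The terms that are dropped at this step still contain a factor
      \<open>y m\<close>, which lies in \<open>R (Suc m)\<close>.\<close>
    have rest: "(\<Sum>\<beta>\<in>F' m - F' (Suc m). y m ^ ?e \<beta> * ?g \<beta>) \<in> R (Suc m)"
    proof (rule ideal_poly_ringD(6)[OF Rd])
      fix \<beta> assume b: "\<beta> \<in> F' m - F' (Suc m)"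
      then have "?e \<beta> \<noteq> 0" using lex[of \<beta>] by (auto simp: F'_def less_Suc_eq)
      then obtain e where "?e \<beta> = Suc e" by (metis not0_implies_Suc)
      then have "y m ^ ?e \<beta> * ?g \<beta> = (y m ^ e * ?g \<beta>) * y m" by (simp add: ac_simps)
      also have "\<dots> \<in> R (Suc m)"
        using m y[OF m]
        by (intro ideal_poly_ringD(5)[OF Rd] polys_in_closed(4)[OF pow[OF yc[OF m]] gc]) auto
      finally show "y m ^ ?e \<beta> * ?g \<beta> \<in> R (Suc m)" .
    qed (use m in simp)
    have "H = (\<Sum>\<beta>\<in>F' m - F' (Suc m). y m ^ ?e \<beta> * ?g \<beta>) + (\<Sum>\<beta>\<in>F' (Suc m). y m ^ ?e \<beta> * ?g \<beta>)"
      unfolding H_def using fin sub by (intro sum.subset_diff) auto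
    also have "(\<Sum>\<beta>\<in>F' (Suc m). y m ^ ?e \<beta> * ?g \<beta>) = G (Suc m)"
      unfolding G_def by (intro sum.cong) (auto simp: F'_def)
    finally have "G (Suc m) = H - (\<Sum>\<beta>\<in>F' m - F' (Suc m). y m ^ ?e \<beta> * ?g \<beta>)" by simp
    then show ?case using ideal_poly_ringD(4)[OF Rd H rest] m by simp
  qed
  then have G: "G (Suc r) \<in> R (Suc r)" by simp
  \<comment> \<open>All exponents are supported in \<open>{..r}\<close>, so only \<alpha> is left
    and \<open>G (Suc r)\<close> is a nonzero constant: a unit inside a prime.\<close>
  have "F' (Suc r) = {\<alpha>}"
  proof -
    have "\<beta> = \<alpha>" if b: "\<beta> \<in> F' (Suc r)" for \<beta>
    proof (rule poly_mapping_eqI)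
      fix i
      show "lookup \<beta> i = lookup \<alpha> i"
      proof (cases "i < Suc r")
        case True
        then show ?thesis using b by (simp add: F'_def)
      next
        case False
        have "\<beta> \<in> exps {..r}" "\<alpha> \<in> exps {..r}" using b \<alpha>(1) F(3) by (auto simp: F'_def)
        then have "i \<notin> keys \<beta>" "i \<notin> keys \<alpha>" using False by (auto simp: exps_def)
        then show ?thesis by (simp add: in_keys_iff)
      qed
    qed
    then show ?thesis using \<alpha>(1) by (auto simp: F'_def)
  qed
  then have "single 0 (c \<alpha>) \<in> R (Suc r)" using G by (simp add: G_def)
  then have "single 0 (inverse (c \<alpha>)) * single 0 (c \<alpha>) \<in> R (Suc r)"
    by (intro ideal_poly_ringD(5)[OF Rd] const) auto
  moreover have "single 0 (inverse (c \<alpha>)) * single 0 (c \<alpha>) = (1 :: 'k mpoly)"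
    using F(4)[OF \<alpha>(1)] by (simp add: mult_single)
  ultimately have one_R: "1 \<in> R (Suc r)" by simp
  interpret Rr: primeideal "R (Suc r)" "poly_ring n" using R(1) by simp
  show False using one_R Rr.one_imp_carrier Rr.I_notcarr by simp
qed

section \<open>Krull dimension of the quotient by a prime generated by variables\<close>

context monomial_localization
begin

text \<open>Every ideal of the chain contains \<open>P\<close>, so an element of
  \<open>R (Suc i)\<close> outside \<open>R i\<close> can be stripped of its terms involving
  \<open>A\<close> and taken in the variables \<open>Z\<close>. A chain longer than
  \<open>card Z\<close> would supply \<open>card Z + 1\<close> such polynomials, and their algebraic
  dependence contradicts \<open>prime_chain_no_relation\<close>.\<close>

lemma prime_chain_bound:
  assumes R: "\<And>i. i \<le> k \<Longrightarrow> primeideal (R i) (poly_ring n) \<and> P \<subseteq> R i" "\<And>i. i < k \<Longrightarrow> R i \<subset> R (Suc i)"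
  shows "k \<le> card Z"
proof (rule ccontr)
  assume "\<not> k \<le> card Z"
  then have k: "Suc (card Z) \<le> k" by simp
  have "\<exists>y. y \<in> R (Suc i) \<and> y \<notin> R i \<and> y \<in> polys_in Z" if i: "i \<le> card Z" for i
  proof -
    obtain y where y: "y \<in> R (Suc i)" "y \<notin> R i" using R(2)[of i] i k by auto
    have Ri: "ideal (R i) (poly_ring n)" "P \<subseteq> R i" "ideal (R (Suc i)) (poly_ring n)" "P \<subseteq> R (Suc i)"
      using R(1)[of i] R(1)[of "Suc i"] i k by (auto simp: primeideal_def)
    have yc: "y \<in> polys_in {1..n}" using y Ri ideal_poly_ringD(1) by blast
    define y1 where "y1 = pm_restrict (exps Z) y"
    define y2 where "y2 = pm_restrict (- exps Z) y"
    have y_eq: "y = y1 + y2" by (simp add: y1_def y2_def pm_restrict_split)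
    have "y2 \<in> P"
      using yc by (auto simp: P_def y2_def polys_in_eq polys_over_def) (auto simp: exps_def Z_def)
    then have "y2 \<in> R i" "y2 \<in> R (Suc i)" using Ri by auto
    then have "y1 \<in> R (Suc i)" "y1 \<notin> R i"
      using y ideal_poly_ringD(4)[OF Ri(3), of y y2] ideal_poly_ringD(3)[OF Ri(1), of y1 y2]
          by (auto simp: y_eq)
    moreover have "y1 \<in> polys_in Z" by (auto simp: y1_def polys_in_eq polys_over_def)
    ultimately show ?thesis by blast
  qed
  then obtain y where y: "\<And>i. i \<le> card Z \<Longrightarrow> y i \<in> R (Suc i) \<and> y i \<notin> R i \<and> y i \<in> polys_in Z" by metis
  have "finite Z" by (simp add: Z_def)
  then obtain F c where F: "finite F" "F \<noteq> {}" "F \<subseteq> exps {..card Z}" "\<And>\<beta>. \<beta> \<in> F \<Longrightarrow> c \<beta> \<noteq> 0"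
    "(\<Sum>\<beta>\<in>F. single 0 (c \<beta>) * (\<Prod>i\<le>card Z. y i ^ lookup \<beta> i)) = 0"
    by (rule algebraic_dependence[of Z y]) (use y in blast)+
  have "(\<Sum>\<beta>\<in>F. single 0 (c \<beta>) * (\<Prod>i\<le>card Z. y i ^ lookup \<beta> i)) \<noteq> 0"
    by (rule prime_chain_no_relation[where R=R and n=n]) (use R y F k in auto)
  then show False using F(5) by contradiction
qed

lemma variable_in_P_iff: "j \<in> {1..n} \<Longrightarrow> monomial (single j 1) \<in> P \<longleftrightarrow> j \<in> A"
  by (auto simp: P_def polys_in_eq single_in_exps)

end

lemma monomial_prime_mono:
  assumes "A \<subseteq> B" "B \<subseteq> {1..n}"
  shows "(monomial_localization.P n A :: 'k::field mpoly set) \<subseteq> monomial_localization.P n B"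
proof -
  interpret LA: monomial_localization n "{}" A "TYPE('k)" using assms
      by unfold_locales (auto simp: expo_ideal_def)
  interpret LB: monomial_localization n "{}" B "TYPE('k)" using assms
      by unfold_locales (auto simp: expo_ideal_def)
  show ?thesis using assms unfolding LA.P_def LB.P_def by blast
qed

context monomial_localization
begin

lemma krull_dim_P: "krull_dim (poly_ring n Quot P) = enat (card Z)"
proof -
  let ?K = "{k. \<exists>R :: nat \<Rightarrow> 'k mpoly set. (\<forall>i\<le>k. primeideal (R i) (poly_ring n) \<and> P \<subseteq> R i)
      \<and> (\<forall>i<k. R i \<subset> R (Suc i))}"
  have P: "ideal P (poly_ring n)" using primeideal_P by (simp add: primeideal_def)
  have "(SUP k\<in>?K. enat k) = enat (card Z)"
  proof (rule antisym)
    show "(SUP k\<in>?K. enat k) \<le> enat (card Z)"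
    proof (rule SUP_least)
      fix k assume "k \<in> ?K"
      then obtain R :: "nat \<Rightarrow> 'k mpoly set" where
        "\<And>i. i \<le> k \<Longrightarrow> primeideal (R i) (poly_ring n) \<and> P \<subseteq> R i" "\<And>i. i < k \<Longrightarrow> R i \<subset> R (Suc i)"
        by blast
      then have "k \<le> card Z" by (rule prime_chain_bound)
      then show "enat k \<le> enat (card Z)" by simp
    qed
    have "finite Z" by (simp add: Z_def)
    then obtain zs where zs: "set zs = Z" "distinct zs" using finite_distinct_list by blast
    \<comment> \<open>For the lower bound the variables of \<open>Z\<close> are adjoined to
      \<open>A\<close> one at a time; the new variable witnesses that the prime grows.\<close>
    define B where "B i = A \<union> set (take i zs)" for i
    have B: "B i \<subseteq> {1..n}" for i using A set_take_subset[of i zs] zs by (auto simp: B_def Z_def)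
    have loc: "monomial_localization n {} (B i)" for i
      using B by unfold_locales (auto simp: expo_ideal_def)
    define R where "R i = (monomial_localization.P n (B i) :: 'k mpoly set)" for i
    have "R i \<subset> R (Suc i)" if i: "i < card Z" for i
    proof -
      have len: "i < length zs" using i zs distinct_card by metis
      have nth: "zs ! i \<in> {1..n}" using nth_mem[OF len] zs by (auto simp: Z_def)
      have "zs ! i \<notin> A" using nth_mem[OF len] zs by (auto simp: Z_def)
      moreover have "zs ! i \<notin> set (take i zs)"
        using zs(2) len by (auto simp: in_set_conv_nth nth_eq_iff_index_eq)
      moreover have "zs ! i \<in> set (take (Suc i) zs)" using len by (simp add: take_Suc_conv_app_nth)
      ultimately have "monomial (single (zs ! i) 1) \<in> R (Suc i)" "monomial (single (zs ! i) 1) \<notin> R i"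
        using monomial_localization.variable_in_P_iff[OF loc nth, where 'k='k] unfolding R_def B_def
            by auto
      moreover have "R i \<subseteq> R (Suc i)"
        unfolding R_def
            by (rule monomial_prime_mono[OF _ B]) (use len in \<open>auto simp: B_def take_Suc_conv_app_nth\<close>)
      ultimately show ?thesis by blast
    qed
    moreover have "primeideal (R i) (poly_ring n) \<and> P \<subseteq> R i" for i
      unfolding R_def
          using monomial_localization.primeideal_P[OF loc] monomial_prime_mono[of A "B i", OF _ B]
      by (auto simp: B_def)
    ultimately have "card Z \<in> ?K" by blast
    then show "enat (card Z) \<le> (SUP k\<in>?K. enat k)" by (rule SUP_upper)
  qed
  then show ?thesis by (simp add: poly_ring.krull_dim_quot[OF P])
qed

end

section \<open>Hilbert functions of monomial primes\<close>

lemma mon_degree_eq_sum: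
  assumes "v \<in> exps Y" "finite Y"
  shows "mon_degree v = (\<Sum>i\<in>Y. lookup v i)"
  unfolding mon_degree_def using assms
  by (intro sum.mono_neutral_left) (auto simp: exps_def in_keys_iff)

text \<open>Stars and bars, by listing the exponents along an enumeration of \<open>Y\<close>. For
  empty \<open>Y\<close> the truncated subtraction still gives the right values: 1 for
  \<open>t = 0\<close> and 0 otherwise.\<close>

lemma card_exps_degree:
  assumes Y: "finite Y"
  shows "card {v \<in> exps Y. mon_degree v = t} = (t + card Y - 1) choose t"
    and "finite {v \<in> exps Y. mon_degree v = t}"
proof -
  obtain zs where zs: "set zs = Y" "distinct zs" using finite_distinct_list[OF Y] by blast
  have len: "length zs = card Y" using zs distinct_card by metis
  let ?f = "\<lambda>v :: nat \<Rightarrow>\<^sub>0 nat. map (lookup v) zs"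
  have degree: "mon_degree v = sum_list (?f v)" if "v \<in> exps Y" for v
    using mon_degree_eq_sum[OF that Y] zs by (simp add: sum_list_distinct_conv_sum_set)
  have bij: "bij_betw ?f {v \<in> exps Y. mon_degree v = t} {l. length l = card Y \<and> sum_list l = t}"
  proof (rule bij_betw_imageI)
    show "inj_on ?f {v \<in> exps Y. mon_degree v = t}"
    proof (rule inj_onI)
      fix v w assume v: "v \<in> {v \<in> exps Y. mon_degree v = t}" and w: "w \<in> {v \<in> exps Y. mon_degree v = t}"
        and eq: "?f v = ?f w"
      show "v = w"
      proof (rule poly_mapping_eqI)
        fix i
        show "lookup v i = lookup w i"
        proof (cases "i \<in> Y")
          case True
          then show ?thesis using eq zs by simp
        next
          case False
          then have "i \<notin> keys v" "i \<notin> keys w" using v w by (auto simp: exps_def)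
          then show ?thesis by (simp add: in_keys_iff)
        qed
      qed
    qed
    show "?f ` {v \<in> exps Y. mon_degree v = t} = {l. length l = card Y \<and> sum_list l = t}"
    proof
      show "?f ` {v \<in> exps Y. mon_degree v = t} \<subseteq> {l. length l = card Y \<and> sum_list l = t}"
        using degree len by auto
      show "{l. length l = card Y \<and> sum_list l = t} \<subseteq> ?f ` {v \<in> exps Y. mon_degree v = t}"
      proof
        fix l assume "l \<in> {l. length l = card Y \<and> sum_list l = t}"
        then have l: "length l = length zs" "sum_list l = t" by (auto simp: len)
        define v where "v = (\<Sum>i<length zs. single (zs ! i) (l ! i))"
        have "lookup v (zs ! k) = l ! k" if k: "k < length zs" for k
        proof -
          have "lookup v (zs ! k) = (\<Sum>i<length zs. if i = k then l ! k else 0)"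
            unfolding v_def lookup_sum using k zs(2)
            by (intro sum.cong) (auto simp: lookup_single when_def nth_eq_iff_index_eq)
          then show ?thesis using k by simp
        qed
        then have fv: "?f v = l" using l by (intro nth_equalityI) auto
        have "v \<in> exps Y"
          using zs(1) keys_sum[of "\<lambda>i. single (zs ! i) (l ! i)" "{..<length zs}"]
          unfolding v_def exps_def by (auto split: if_splits)
        then show "l \<in> ?f ` {v \<in> exps Y. mon_degree v = t}"
          using fv l degree by (intro image_eqI[of _ _ v]) auto
      qed
    qed
  qed
  show "card {v \<in> exps Y. mon_degree v = t} = (t + card Y - 1) choose t"
    using bij_betw_same_card[OF bij] by (simp add: card_length_sum_list)
  have "{l. length l = card Y \<and> sum_list l = t} \<subseteq> {l. set l \<subseteq> {..t} \<and> length l = card Y}"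
    using member_le_sum_list by fastforce
  then have "finite {l :: nat list. length l = card Y \<and> sum_list l = t}"
    by (rule finite_subset) (rule finite_lists_length_eq, simp)
  then show "finite {v \<in> exps Y. mon_degree v = t}"
    using bij_betw_finite[OF bij] by blast
qed

lemma homogeneous_part_eq:
    "(homogeneous_part n t :: 'k::field mpoly set) = polys_over {v \<in> exps {1..n}. mon_degree v = t}"
  by (auto simp: homogeneous_part_def polys_in_eq polys_over_def)

lemma subfield_constants: "subfield {single 0 c | c. True} (poly_ring n :: 'k::field mpoly ring)"
  (is "subfield ?K _")
proof (rule poly_ring.subfieldI)
  have sub: "?K \<subseteq> polys_in {1..n}" by (auto simp: polys_in_eq single_in_polys_over)
  show "subcring ?K (poly_ring n :: 'k mpoly ring)"
  proof (rule poly_ring.subcringI')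
    show "subring ?K (poly_ring n :: 'k mpoly ring)"
    proof (rule poly_ring.subringI)
      show "?K \<subseteq> carrier (poly_ring n)" using sub by simp
      show "\<one>\<^bsub>poly_ring n\<^esub> \<in> ?K" using single_one by (force simp del: single_one)
      fix h :: "'k mpoly" assume h: "h \<in> ?K"
      then obtain c where c: "h = single 0 c" by blast
      then have "- h = single 0 (- c)" by (simp add: single_uminus)
      moreover have "\<ominus>\<^bsub>poly_ring n\<^esub> h = - h" by (rule a_inv_poly_ring) (use h sub in blast)
      ultimately show "\<ominus>\<^bsub>poly_ring n\<^esub> h \<in> ?K" by auto
      fix h' :: "'k mpoly" assume "h' \<in> ?K"
      then obtain c' where "h' = single 0 c'" by blast
      then have "h * h' = single 0 (c * c')" "h + h' = single 0 (c + c')"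
        using c by (simp_all add: mult_single single_add)
      then show "h \<otimes>\<^bsub>poly_ring n\<^esub> h' \<in> ?K" "h \<oplus>\<^bsub>poly_ring n\<^esub> h' \<in> ?K" by auto
    qed
  qed
  have inv: "\<exists>y\<in>?K. y * x = 1 \<and> x * y = 1" if x: "x \<in> ?K" "x \<noteq> 0" for x :: "'k mpoly"
  proof -
    obtain c where c: "x = single 0 c" using x by blast
    then have "c \<noteq> 0" using x by auto
    then show ?thesis using c by (intro bexI[of _ "single 0 (inverse c)"]) (auto simp: mult_single)
  qed
  show "Units (poly_ring n\<lparr>carrier := ?K\<rparr>) = ?K - {\<zero>\<^bsub>poly_ring n\<^esub>}"
    unfolding Units_def using inv by (auto simp: Bex_def)
qed

section \<open>Binomial coefficients as polynomials, and uniqueness of Hilbert polynomials\<close>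

definition binomial_poly :: "nat \<Rightarrow> rat poly" where
  "binomial_poly k = Polynomial.smult (1 / fact k) (\<Prod>i<k. [:of_nat i + 1, 1:])"

lemma poly_binomial_poly: "poly (binomial_poly k) (of_nat t) = of_nat ((t + k) choose k)"
proof -
  have "poly (binomial_poly k) (of_nat t) = (\<Prod>i<k. of_nat t + 1 + of_nat i) / fact k"
    by (simp add: binomial_poly_def poly_prod algebra_simps)
  also have "\<dots> = pochhammer (of_nat t + 1) k / fact k"
    by (simp add: pochhammer_prod atLeast0LessThan)
  also have "\<dots> = of_nat (t + k) gchoose k"
    by (simp add: gbinomial_pochhammer')
  finally show ?thesis by (simp add: binomial_gbinomial)
qed

lemma lead_coeff_binomial_poly: "lead_coeff (binomial_poly k) = 1 / fact k"
proof -
  have "lead_coeff (\<Prod>i<k. [:of_nat i + 1, 1 :: rat:]) = 1"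
    unfolding lead_coeff_prod by simp
  then show ?thesis unfolding binomial_poly_def lead_coeff_smult by simp
qed

text \<open>The difference would have infinitely many roots. This uniqueness is what evaluates the
  definite description in \<open>hilbert_polynomial\<close>.\<close>

lemma poly_eventually_unique:
  fixes p q :: "rat poly"
  assumes "\<forall>\<^sub>F t in sequentially. poly p (of_nat t) = poly q (of_nat t)"
  shows "p = q"
proof (rule ccontr)
  assume "p \<noteq> q"
  then have fin: "finite {x. poly (p - q) x = 0}" by (intro poly_roots_finite) simp
  obtain N where N: "\<And>t. t \<ge> N \<Longrightarrow> poly p (of_nat t) = poly q (of_nat t)"
    using assms by (auto simp: eventually_sequentially)
  have "of_nat ` {N..} \<subseteq> {x. poly (p - q) x = 0}" using N by auto
  then have "finite (of_nat ` {N..} :: rat set)" using fin by (rule finite_subset)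
  then have "finite {N..}" by (rule finite_imageD) (simp add: inj_on_def)
  then show False using infinite_Ici by blast
qed

section \<open>Dimensions and multiplicity of the quotient by \<open>P\<close>\<close>

context monomial_localization
begin

abbreviation "Q \<equiv> poly_ring n Quot P"
abbreviation proj :: "'k mpoly \<Rightarrow> 'k mpoly set" where "proj p \<equiv> P +>\<^bsub>poly_ring n\<^esub> p"
abbreviation consts_Q where "consts_Q \<equiv> proj ` {single 0 c | c. True}"

lemma ideal_P: "ideal P (poly_ring n)"
  using primeideal_P by (simp add: primeideal_def)

lemma domain_Q: "domain Q"
  by (rule primeideal.quotient_is_domain[OF primeideal_P])

lemma proj_eq_iff: "\<lbrakk>p \<in> polys_in {1..n}; q \<in> polys_in {1..n}\<rbrakk> \<Longrightarrow> proj p = proj q \<longleftrightarrow> p - q \<in> P"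
  using poly_ring.quotient_eq_iff_same_a_r_cos[OF ideal_P, of p q] by simp

lemma proj_hom: "ring_hom_ring (poly_ring n) Q proj"
  by (rule ideal.rcos_ring_hom_ring[OF ideal_P])

lemma proj_simps:
  assumes "p \<in> polys_in {1..n}"
  shows "proj p \<in> carrier Q"
    "q \<in> polys_in {1..n} \<Longrightarrow> proj p \<oplus>\<^bsub>Q\<^esub> proj q = proj (p + q)"
    "q \<in> polys_in {1..n} \<Longrightarrow> proj p \<otimes>\<^bsub>Q\<^esub> proj q = proj (p * q)"
  using ring_hom_memE[OF ring_hom_ring.homh[OF proj_hom]] assms by simp_all

lemma proj_zero: "\<zero>\<^bsub>Q\<^esub> = proj 0"
  using poly_ring.a_rcos_zero[OF ideal_P, of 0] ideal_poly_ringD(2)[OF ideal_P]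
      by (simp add: FactRing_def)

lemma subfield_consts_Q: "subfield consts_Q Q"
  using ring_hom_ring.img_is_subfield(2)[OF proj_hom subfield_constants] domain.one_not_zero[OF domain_Q]
      by simp

text \<open>Monomials in the variables \<open>Z\<close> stay linearly independent modulo
  \<open>P\<close>: all terms of an element of \<open>P\<close> involve \<open>A\<close>, whereas
  \<open>monomial w - q\<close> has the term \<open>w\<close>, which does not. Hence each further
  monomial is a proper line extension.\<close>

lemma dimension_proj:
  assumes "finite X" "X \<subseteq> exps Z"
  shows "ring.dimension Q (card X) consts_Q (proj ` polys_over X)"
  using assms
proof (induction X rule: finite_induct)
  case empty
  interpret Q: domain Q by (rule domain_Q)
  have "proj ` polys_over {} = {\<zero>\<^bsub>Q\<^esub>}" by (auto simp: polys_over_def proj_zero)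
  then show ?case using Q.zero_dim[of consts_Q] by simp
next
  case (insert w X)
  interpret Q: domain Q by (rule domain_Q)
  have w: "w \<in> exps {1..n}" and X: "X \<subseteq> exps {1..n}" using insert.prems exps_Z_sub by auto
  have wc: "monomial w \<in> polys_in {1..n}" using w by (simp add: polys_in_eq)
  have Xc: "p \<in> polys_in {1..n}" if "p \<in> polys_over X" for p
    using that X polys_over_mono by (auto simp: polys_in_eq)
  have const: "single 0 c \<in> polys_in {1..n}" for c :: 'k
    by (simp add: polys_in_eq single_in_polys_over)
  have comb: "proj (single 0 c) \<otimes>\<^bsub>Q\<^esub> proj (monomial w) \<oplus>\<^bsub>Q\<^esub> proj q = proj (single w c + q)"
    if "q \<in> polys_over X" for c q
  proof -
    have "single 0 c * monomial w = single w c"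
      by (simp add: monomial_def mult_single)
    moreover from this have "single w c \<in> polys_in {1..n}"
      using polys_in_closed(4)[OF const[of c] wc] by simp
    ultimately show ?thesis
      using proj_simps(3)[OF const[of c] wc] proj_simps(2)[OF _ Xc[OF that]] by metis
  qed
  have "Q.line_extension consts_Q (proj (monomial w)) (proj ` polys_over X)
      = proj ` polys_over (insert w X)"
  proof
    show "Q.line_extension consts_Q (proj (monomial w)) (proj ` polys_over X)
        \<subseteq> proj ` polys_over (insert w X)"
    proof
      fix x assume "x \<in> Q.line_extension consts_Q (proj (monomial w)) (proj ` polys_over X)"
      then obtain c q where "q \<in> polys_over X" "x = proj (single 0 c) \<otimes>\<^bsub>Q\<^esub> proj (monomial w) \<oplus>\<^bsub>Q\<^esub> proj q"
        unfolding Q.line_extension_def set_add_def' r_coset_def by auto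
      then have "x = proj (single w c + q)" "single w c + q \<in> polys_over (insert w X)"
        using comb polys_over_mono[of X "insert w X"]
            by (auto intro!: polys_over_add simp: single_in_polys_over)
      then show "x \<in> proj ` polys_over (insert w X)" by blast
    qed
    show "proj ` polys_over (insert w X)
        \<subseteq> Q.line_extension consts_Q (proj (monomial w)) (proj ` polys_over X)"
    proof
      fix x assume "x \<in> proj ` polys_over (insert w X)"
      then obtain p where p: "p \<in> polys_over (insert w X)" "x = proj p" by blast
      define q where "q = pm_restrict (- {w}) p"
      have q: "q \<in> polys_over X" using p by (auto simp: q_def polys_over_def)
      have "p = single w (lookup p w) + q"
        by (rule poly_mapping_eqI) (simp add: q_def lookup_add lookup_pm_restrict lookup_single when_def)
      then have "x = proj (single 0 (lookup p w)) \<otimes>\<^bsub>Q\<^esub> proj (monomial w) \<oplus>\<^bsub>Q\<^esub> proj q"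
        using comb[OF q] p by metis
      then show "x \<in> Q.line_extension consts_Q (proj (monomial w)) (proj ` polys_over X)"
        using q unfolding Q.line_extension_def set_add_def' r_coset_def by blast
    qed
  qed
  moreover have "proj (monomial w) \<notin> proj ` polys_over X"
  proof
    assume "proj (monomial w) \<in> proj ` polys_over X"
    then obtain q where q: "q \<in> polys_over X" "proj (monomial w) = proj q" by blast
    then have "monomial w - q \<in> P" using proj_eq_iff[OF wc Xc] by simp
    moreover have "w \<notin> keys q" using q(1) insert.hyps by (auto simp: polys_over_def)
    then have "w \<in> keys (monomial w - q)"
      by (simp add: in_keys_iff lookup_minus monomial_def)
    ultimately have "keys w \<inter> A \<noteq> {}" by (auto simp: P_def)
    then show False using insert.prems by (auto simp: exps_def Z_def)
  qed
  moreover have "Q.dimension (card X) consts_Q (proj ` polys_over X)" using insert by simp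
  ultimately show ?case
    using Q.Suc_dim[of "proj (monomial w)" "proj ` polys_over X"
        "card X" consts_Q] proj_simps(1)[OF wc] insert.hyps by simp
qed

text \<open>Terms involving \<open>A\<close> lie in \<open>P\<close> and disappear from the image.
  Only the intersection with \<open>exps Z\<close> is required to be finite, so the whole ring can
  be treated when \<open>Z\<close> is empty.\<close>

lemma residue_dim_P:
  assumes X: "X \<subseteq> exps {1..n}" "finite (X \<inter> exps Z)"
  shows "residue_dim n P (polys_over X) = card (X \<inter> exps Z)"
proof -
  interpret Q: domain Q by (rule domain_Q)
  have "proj ` polys_over X = proj ` polys_over (X \<inter> exps Z)"
  proof
    show "proj ` polys_over X \<subseteq> proj ` polys_over (X \<inter> exps Z)"
    proof safe
      fix p :: "'k mpoly" assume p: "p \<in> polys_over X"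
      define p1 where "p1 = pm_restrict (exps Z) p"
      have p1: "p1 \<in> polys_over (X \<inter> exps Z)" using p by (auto simp: p1_def polys_over_def)
      have pc: "p \<in> polys_in {1..n}" "p1 \<in> polys_in {1..n}"
        using p p1 X by (auto simp: polys_in_eq polys_over_def)
      have "p - p1 = pm_restrict (- exps Z) p"
        using pm_restrict_split[of "exps Z" p] unfolding p1_def by (metis add_diff_cancel_left')
      moreover have "pm_restrict (- exps Z) p \<in> P"
        using pc by (auto simp: P_def polys_in_eq polys_over_def) (auto simp: exps_def Z_def)
      ultimately have "proj p = proj p1" using proj_eq_iff[OF pc] by simp
      then show "proj p \<in> proj ` polys_over (X \<inter> exps Z)" using p1 by blast
    qed
  qed (auto intro!: imageI simp: polys_over_def)
  then have dim: "Q.dimension (card (X \<inter> exps Z)) consts_Q (proj ` polys_over X)"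
    using dimension_proj[OF X(2)] by simp
  show ?thesis
    unfolding residue_dim_def Let_def
    using dim Q.dimension_is_inj[OF subfield_consts_Q _ dim] by (rule the_equality)
qed

lemma finite_Z: "finite Z"
  by (simp add: Z_def)

lemma hilbert_function_P: "hilbert_function n P t = (t + card Z - 1) choose t"
proof -
  have "{v \<in> exps {1..n}. mon_degree v = t} \<inter> exps Z = {v \<in> exps Z. mon_degree v = t}"
    using exps_Z_sub by auto
  then show ?thesis
    unfolding hilbert_function_def homogeneous_part_eq
    by (subst residue_dim_P) (auto simp: card_exps_degree[OF finite_Z])
qed

lemma hilbert_polynomial_P:
  assumes "card Z = Suc k"
  shows "hilbert_polynomial n P = binomial_poly k"
  unfolding hilbert_polynomial_def
proof (rule the_equality)
  have val: "poly (binomial_poly k) (of_nat t) = of_nat (hilbert_function n P t)" for t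
    using assms by (simp add: poly_binomial_poly hilbert_function_P binomial_symmetric[of t "t + k"])
  then show "\<forall>\<^sub>F t in sequentially. poly (binomial_poly k) (of_nat t) = of_nat (hilbert_function n P t)"
      by simp
  fix q :: "rat poly" assume "\<forall>\<^sub>F t in sequentially. poly q (of_nat t) = of_nat (hilbert_function n P t)"
  then show "q = binomial_poly k" by (intro poly_eventually_unique) (simp add: val)
qed

text \<open>In positive dimension the factorial in the normalization cancels the leading coefficient
  of the binomial polynomial. In dimension 0 the quotient is the coefficient field, of dimension one
  over itself.\<close>

lemma hilbert_multiplicity_P: "hilbert_multiplicity n P = 1"
proof (cases "card Z")
  case 0
  then have "exps {1..n} \<inter> exps Z = {0}" using finite_Z by (auto simp: exps_def)
  then have "residue_dim n P (polys_over (exps {1..n})) = 1" by (subst residue_dim_P) auto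
  then show ?thesis by (simp add: hilbert_multiplicity_def krull_dim_P 0 polys_in_eq Let_def)
next
  case (Suc k)
  then show ?thesis
    by (simp add: hilbert_multiplicity_def krull_dim_P Let_def hilbert_polynomial_P
        lead_coeff_binomial_poly)
qed

end

section \<open>The arithmetic degree of a monomial ideal\<close>

text \<open>The primes \<open>?P Y\<close> with \<open>card Y = r\<close> are pairwise distinct and
  include all associated primes of dimension \<open>r\<close>; each associated one contributes the
  number of standard exponents for its \<open>Y\<close>.\<close>

theorem arith_deg_eq_std:
  assumes E: "expo_ideal {1..n} E"
  shows "arith_deg n r (polys_over E :: 'k::field mpoly set)
      = of_nat (std n r (polys_over E :: 'k mpoly set))"
proof -
  let ?S = "poly_ring n :: 'k mpoly ring" and ?I = "polys_over E :: 'k mpoly set"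
  let ?P = "\<lambda>Y. monomial_localization.P n ({1..n} - Y) :: 'k mpoly set"
  let ?F = "{Y. Y \<subseteq> {1..n} \<and> card Y = r}"
  let ?Ass = "associated_primes ?S (residue_module ?S ?I)"
  have loc: "monomial_localization n E ({1..n} - Y)" for Y
    using E by (simp add: monomial_localization_def)
  have Z: "monomial_localization.Z n ({1..n} - Y) = Y" if "Y \<subseteq> {1..n}" for Y
    using that by (simp add: monomial_localization.Z_def[OF loc] double_diff)
  have dim: "krull_dim (?S Quot ?P Y) = enat (card Y)" if "Y \<subseteq> {1..n}" for Y
    using monomial_localization.krull_dim_P[OF loc[of Y], where 'k='k] that by (simp add: Z)
  have inj: "inj_on ?P ?F"
  proof (rule inj_onI)
    fix Y Y' assume Y: "Y \<in> ?F" and Y': "Y' \<in> ?F" and eq: "?P Y = ?P Y'"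
    have "j \<in> Y \<longleftrightarrow> j \<in> Y'" if "j \<in> {1..n}" for j
      using monomial_localization.variable_in_P_iff[OF loc[of Y] that, where 'k='k]
        monomial_localization.variable_in_P_iff[OF loc[of Y'] that, where 'k='k] eq that by simp
    then show "Y = Y'" using Y Y' by blast
  qed
  have sum_set: "{P. P \<in> ?Ass \<and> krull_dim (?S Quot P) = enat r} = ?P ` {Y \<in> ?F. ?P Y \<in> ?Ass}"
  proof
    show "?P ` {Y \<in> ?F. ?P Y \<in> ?Ass} \<subseteq> {P. P \<in> ?Ass \<and> krull_dim (?S Quot P) = enat r}"
      using dim by auto
    show "{P. P \<in> ?Ass \<and> krull_dim (?S Quot P) = enat r} \<subseteq> ?P ` {Y \<in> ?F. ?P Y \<in> ?Ass}"
    proof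
      fix P assume "P \<in> {P. P \<in> ?Ass \<and> krull_dim (?S Quot P) = enat r}"
      then have P: "P \<in> ?Ass" "krull_dim (?S Quot P) = enat r" by auto
      obtain A where A: "A \<subseteq> {1..n}" "P = monomial_localization.P n A"
        using E P(1) by (rule associated_prime_is_monomial_prime)
      have P_eq: "P = ?P ({1..n} - A)" using A by (simp add: double_diff)
      moreover have "card ({1..n} - A) = r" using P(2) dim[of "{1..n} - A"] P_eq by simp
      ultimately show "P \<in> ?P ` {Y \<in> ?F. ?P Y \<in> ?Ass}" using P(1)
          by (intro image_eqI[of _ _ "{1..n} - A"]) auto
    qed
  qed
  let ?t = "\<lambda>Y. of_nat (card (monomial_localization.std_exps n E ({1..n} - Y))) :: rat"
  have "arith_deg n r ?I = (\<Sum>P | P \<in> ?Ass \<and> krull_dim (?S Quot P) = enat r.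
      of_nat (length_multiplicity ?S ?I P) * hilbert_multiplicity n P)"
    by (simp add: arith_deg_def Let_def)
  also have "\<dots> = (\<Sum>Y | Y \<in> ?F \<and> ?P Y
      \<in> ?Ass. of_nat (length_multiplicity ?S ?I (?P Y)) * hilbert_multiplicity n (?P Y))"
    unfolding sum_set by (subst sum.reindex) (auto intro: inj_on_subset[OF inj])
  also have "\<dots> = (\<Sum>Y | Y \<in> ?F \<and> ?P Y \<in> ?Ass. ?t Y)"
    by (simp add: monomial_localization.length_multiplicity_eq[OF loc]
        monomial_localization.hilbert_multiplicity_P[OF loc])
  \<comment> \<open>The sum may run over all \<open>Y\<close> in \<open>?F\<close>: by
    \<open>P_associated\<close> a prime that is not associated has no standard exponents.\<close>
  also have "\<dots> = (\<Sum>Y\<in>?F. ?t Y)"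
  proof (rule sum.mono_neutral_left)
    show "finite ?F" by (rule finite_subset[of _ "Pow {1..n}"]) auto
    show "\<forall>Y\<in>?F - {Y. Y \<in> ?F \<and> ?P Y \<in> ?Ass}. ?t Y = 0"
    proof
      fix Y assume "Y \<in> ?F - {Y. Y \<in> ?F \<and> ?P Y \<in> ?Ass}"
      then have "?P Y \<notin> ?Ass" by blast
      then have "monomial_localization.std_exps n E ({1..n} - Y) = {}"
        using monomial_localization.P_associated[OF loc] by blast
      then show "?t Y = 0" by simp
    qed
  qed auto
  finally show ?thesis by (simp add: std_eq_sum[OF E])
qed

section \<open>Strongly stable ideals\<close>

definition expo_stable :: "(nat \<Rightarrow>\<^sub>0 nat) set \<Rightarrow> bool" where
  "expo_stable E \<longleftrightarrow> (\<forall>u\<in>E. \<forall>i\<in>keys u. \<forall>j. 1 \<le> j \<and> j \<le> i \<longrightarrow>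
     u - single i 1 + single j 1 \<in> E)"

lemma strongly_stable_polys_over:
  assumes "expo_ideal {1..n} E"
  shows "strongly_stable n (polys_over E :: 'k::field mpoly set) \<longleftrightarrow> expo_stable E"
proof -
  have "monomial_ideal n (polys_over E :: 'k mpoly set)" using assms by (auto simp: monomial_ideal_iff)
  moreover have "E \<subseteq> exps {1..n}" using assms by (simp add: expo_ideal_def)
  ultimately show ?thesis
    unfolding strongly_stable_def expo_stable_def by (auto simp: exps_def subset_iff)
qed

lemma expo_stable_move:
  assumes E: "expo_stable E" and "1 \<le> j" "j \<le> i"
  shows "u + single i 1 \<in> E \<Longrightarrow> u + single j 1 \<in> E"
proof -
  assume "u + single i 1 \<in> E"
  moreover have "i \<in> keys (u + single i 1)" by (simp add: keys_add_nat)
  ultimately have "u + single i 1 - single i 1 + single j 1 \<in> E"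
    using assms unfolding expo_stable_def by blast
  then show ?thesis by simp
qed

lemma expo_stable_move_power:
  assumes E: "expo_stable E" and ij: "1 \<le> j" "j \<le> i"
  shows "u + single i N \<in> E \<Longrightarrow> u + single j N \<in> E"
proof (induction N arbitrary: u)
  case (Suc N)
  have "(u + single i N) + single i 1 \<in> E"
    using Suc.prems by (simp add: add.assoc Suc_eq_plus1 flip: single_add)
  then have "(u + single i N) + single j 1 \<in> E"
    by (rule expo_stable_move[OF E ij])
  then have "(u + single j 1) + single j N \<in> E"
    by (intro Suc.IH) (simp add: ac_simps)
  then show ?case by (simp add: add.assoc Suc_eq_plus1_left flip: single_add)
qed simp

text \<open>Let \<open>i\<close> be in \<open>A\<close> and suppose a smaller index \<open>j\<close>
  is in \<open>Z\<close>. Some power of \<open>x_i\<close> kills the standard monomial, stability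
  moves this power to \<open>x_j\<close>, and \<open>x_j\<close> is a unit in the localization; so
  the monomial would already be zero there.\<close>

lemma std_exps_initial:
  assumes E_ideal: "expo_ideal {1..n} E" and E_stable: "expo_stable E" and A: "A \<subseteq> {1..n}"
    and ne: "monomial_localization.std_exps n E A \<noteq> {}"
  shows "A = {1..card A}"
proof -
  interpret monomial_localization n E A using E_ideal A by unfold_locales
  obtain a where a: "a \<in> std_exps" using ne by blast
  have down: "j \<in> A" if i: "i \<in> A" and j: "1 \<le> j" "j \<le> i" for i j
  proof (rule ccontr)
    assume "j \<notin> A"
    then have jZ: "j \<in> Z" using i j A by (auto simp: Z_def)
    obtain N where "a + single i N \<in> sat_exps" using a i by (auto simp: std_exps_def)
    then obtain z where z: "z \<in> exps Z" "a + single i N + z \<in> E" by (auto simp: sat_exps_def)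
    then have "a + z + single j N \<in> E"
      by (intro expo_stable_move_power[OF E_stable j]) (simp add: ac_simps)
    then have "a + (z + single j N) \<in> E" by (simp add: add.assoc)
    moreover have "z + single j N \<in> exps Z" using z jZ by (simp add: single_in_exps)
    ultimately have "a \<in> sat_exps" using a by (auto simp: sat_exps_def std_exps_def)
    then show False using a by (simp add: std_exps_def)
  qed
  show ?thesis
  proof (cases "A = {}")
    case False
    define m where "m = Max A"
    have "m \<in> A" using False finite_A by (simp add: m_def)
    then have "{1..m} \<subseteq> A" using down by auto
    moreover have "A \<subseteq> {1..m}" using A Max_ge[OF finite_A] by (auto simp: m_def)
    ultimately have "A = {1..m}" by blast
    then show ?thesis by simp
  qed simp
qed

section \<open>Partial degrees and the exponents of a smallest strongly stable ideal\<close>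

definition partial_degree :: "nat \<Rightarrow> (nat \<Rightarrow>\<^sub>0 nat) \<Rightarrow> nat" where
  "partial_degree m v = (\<Sum>i=1..m. lookup v i)"

lemma partial_degree_add: "partial_degree m (u + v) = partial_degree m u + partial_degree m v"
  by (simp add: partial_degree_def lookup_add sum.distrib)

lemma partial_degree_single: "1 \<le> j \<Longrightarrow> partial_degree m (single j N) = (if j \<le> m then N else 0)"
  by (simp add: partial_degree_def lookup_single when_def)

lemma partial_degree_mono: "m \<le> m' \<Longrightarrow> partial_degree m v \<le> partial_degree m' v"
  unfolding partial_degree_def by (rule sum_mono2) auto

lemma partial_degree_exps_0: "\<lbrakk>v \<in> exps Y; Y \<inter> {1..m} = {}\<rbrakk> \<Longrightarrow> partial_degree m v = 0"
  unfolding partial_degree_def by (intro sum.neutral) (auto simp: exps_def in_keys_iff)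

text \<open>The Borel order, extended to monomials of different degrees: \<open>w\<close> arises
  from \<open>v\<close> by moving factors to smaller indices and multiplying by further
  variables.\<close>

definition dominates :: "nat \<Rightarrow> (nat \<Rightarrow>\<^sub>0 nat) \<Rightarrow> (nat \<Rightarrow>\<^sub>0 nat) \<Rightarrow> bool" where
  "dominates n w v \<longleftrightarrow> (\<forall>m\<le>n. partial_degree m v \<le> partial_degree m w)"

text \<open>Moving a factor to a smaller index never lowers a partial degree, and neither does
  multiplication. This yields a strongly stable ideal to compare with the smallest one.\<close>

lemma dominating_exps_stable:
  defines "D \<equiv> \<lambda>n U. {w \<in> exps {1..n}. \<exists>u\<in>U. dominates n w u}"
  shows "expo_ideal {1..n} (D n U)" "expo_stable (D n U)"
proof -
  show "expo_ideal {1..n} (D n U)"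
    by (fastforce simp: D_def expo_ideal_def dominates_def partial_degree_add intro: trans_le_add1)
  show "expo_stable (D n U)"
    unfolding expo_stable_def
  proof (intro ballI allI impI)
    fix w i j assume w: "w \<in> D n U" and i: "i \<in> keys w" and j: "1 \<le> j \<and> j \<le> i"
    define w' where "w' = w - single i 1"
    have w_eq: "w = single i 1 + w'" unfolding w'_def using i by (rule minus_single_add)
    obtain u where u: "u \<in> U" "dominates n w u" using w by (auto simp: D_def)
    have wn: "w \<in> exps {1..n}" using w by (simp add: D_def)
    then have "i \<in> {1..n}" using i by (auto simp: exps_def)
    then have "w' + single j 1 \<in> exps {1..n}" using wn w_eq j by (simp add: single_in_exps)
    moreover have "partial_degree m w \<le> partial_degree m (w' + single j 1)" for m
      unfolding w_eq using j by (simp add: partial_degree_add partial_degree_single)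
    then have "dominates n (w' + single j 1) u"
      using u(2) unfolding dominates_def by (meson order.trans)
    ultimately show "w - single i 1 + single j 1 \<in> D n U"
      using u(1) unfolding w'_def by (auto simp: D_def)
  qed
qed

text \<open>Unless \<open>v\<close> divides \<open>w\<close>, let \<open>p\<close> be the first
  index where \<open>v\<close> exceeds \<open>w\<close>. Dominance at \<open>p\<close> forces some
  \<open>q\<close> below \<open>p\<close> with \<open>v\<close> smaller than \<open>w\<close>.
  Moving one factor of \<open>v\<close> from \<open>p\<close> to \<open>q\<close> stays in
  \<open>E\<close> and raises exactly the partial degrees from \<open>q\<close> to
  \<open>p - 1\<close>, where dominance is strict. So dominance persists and the total slack
  drops.\<close>

lemma dominating_in_stable:
  assumes E: "expo_ideal {1..n} E" "expo_stable E" and w: "w \<in> exps {1..n}"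
  shows "v \<in> E \<Longrightarrow> dominates n w v \<Longrightarrow> w \<in> E"
proof (induction "\<Sum>m\<le>n. partial_degree m w - partial_degree m v" arbitrary: v rule: less_induct)
  case less
  have v: "v \<in> exps {1..n}" using less E by (auto simp: expo_ideal_def)
  show ?case
  proof (cases "\<forall>i. lookup v i \<le> lookup w i")
    case True
    then have w_eq: "w = v + (w - v)" by (intro poly_mapping_eqI) (simp add: lookup_add lookup_minus)
    then have "w - v \<in> exps {1..n}" using w by (metis exps_add_iff)
    then show ?thesis using w_eq expo_idealD[OF E(1) less(2)] by metis
  next
    case False
    define p where "p = (LEAST i. lookup w i < lookup v i)"
    have "\<exists>i. lookup w i < lookup v i" using False by (simp add: not_le)
    then have p: "lookup w p < lookup v p"
      unfolding p_def by (rule LeastI_ex)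
    have less_p: "lookup v i \<le> lookup w i" if "i < p" for i
      using not_less_Least[of i "\<lambda>i. lookup w i < lookup v i"] that by (simp add: p_def)
    have pk: "p \<in> keys v" using p by (simp add: in_keys_iff)
    then have pn: "1 \<le> p" "p \<le> n" using v by (auto simp: exps_def)
    have "\<exists>q. 1 \<le> q \<and> q < p \<and> lookup v q < lookup w q"
    proof (rule ccontr)
      assume *: "\<nexists>q. 1 \<le> q \<and> q < p \<and> lookup v q < lookup w q"
      have "partial_degree p w < partial_degree p v"
        unfolding partial_degree_def
      proof (rule sum_strict_mono_ex1)
        show "\<forall>i\<in>{1..p}. lookup w i \<le> lookup v i"
        proof
          fix i assume i: "i \<in> {1..p}"
          show "lookup w i \<le> lookup v i"
          proof (cases "i = p")
            case False
            then have "1 \<le> i" "i < p" using i by auto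
            then show ?thesis using * not_le by blast
          qed (use p in simp)
        qed
        show "\<exists>i\<in>{1..p}. lookup w i < lookup v i"
          using p pn by (intro bexI[of _ p]) auto
      qed simp
      moreover have "partial_degree p v \<le> partial_degree p w" using less(3) pn
          by (simp add: dominates_def)
      ultimately show False by simp
    qed
    then obtain q where q: "1 \<le> q" "q < p" "lookup v q < lookup w q" by blast
    have strict: "partial_degree m v < partial_degree m w" if m: "q \<le> m" "m < p" for m
      unfolding partial_degree_def
    proof (rule sum_strict_mono_ex1)
      show "\<forall>i\<in>{1..m}. lookup v i \<le> lookup w i" using less_p m by auto
      show "\<exists>i\<in>{1..m}. lookup v i < lookup w i" using q m by (intro bexI[of _ q]) auto
    qed simp
    define v0 where "v0 = v - single p 1"
    define v' where "v' = v0 + single q 1"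
    have v_eq: "v = v0 + single p 1"
      using minus_single_add[OF pk] unfolding v0_def by (simp add: add.commute)
    have v'_E: "v' \<in> E"
      using less(2) q expo_stable_move[OF E(2), of q p v0] by (simp add: v_eq v'_def)
    have pd: "partial_degree m v' = partial_degree m v + (if q \<le> m \<and> m < p then 1 else 0)" for m
      using q pn by (simp add: v'_def v_eq partial_degree_add partial_degree_single)
    have dom: "dominates n w v'"
      using less(3) strict unfolding dominates_def pd by (auto simp flip: less_iff_succ_less_eq)
    have "(\<Sum>m\<le>n. partial_degree m w - partial_degree m v') < (\<Sum>m\<le>n. partial_degree m w - partial_degree m
        v)"
    proof (rule sum_strict_mono_ex1)
      show "\<exists>m\<in>{..n}. partial_degree m w - partial_degree m v' < partial_degree m w - partial_degree m v"
        using q pn strict[of q] by (intro bexI[of _ q]) (auto simp: pd)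
    qed (auto simp: pd)
    then show ?thesis using less(1) v'_E dom by blast
  qed
qed

text \<open>Let \<open>a\<close> have degree at least \<open>L\<close>. As some power of
  \<open>x_k\<close> kills \<open>a\<close>, there is a generator \<open>u\<close> dominated by
  \<open>a\<close> times that power and a monomial in \<open>Z\<close>. These factors leave the
  partial degrees below \<open>k\<close> unchanged, and at \<open>k\<close> the bound
  \<open>L\<close> helps, so up to \<open>k\<close> already \<open>a\<close> dominates
  \<open>u\<close>. Beyond \<open>k\<close> a monomial in \<open>Z\<close> makes up the deficit;
  hence \<open>a\<close> would die in the localization.\<close>

lemma std_exps_degree_bound:
  assumes E_ideal: "expo_ideal {1..n} E" and E_stable: "expo_stable E" and U: "U \<subseteq> E"
    and dom: "\<And>w. w \<in> E \<Longrightarrow> \<exists>u\<in>U. dominates n w u"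
    and L: "\<And>u. u \<in> U \<Longrightarrow> partial_degree k u \<le> L" and k: "1 \<le> k" "k \<le> n"
    and a: "a \<in> monomial_localization.std_exps n E {1..k}"
  shows "mon_degree a < L"
proof (rule ccontr)
  assume large: "\<not> mon_degree a < L"
  interpret monomial_localization n E "{1..k}" using E_ideal k by unfold_locales auto
  have aA: "a \<in> exps {1..k}" "a \<notin> sat_exps" using a by (auto simp: std_exps_def)
  have deg: "partial_degree k a = mon_degree a"
    using mon_degree_eq_sum[OF aA(1)] by (simp add: partial_degree_def)
  have "k \<in> {1..k}" using k by simp
  then obtain N where "a + single k N \<in> sat_exps" using a unfolding std_exps_def by blast
  then obtain z where z: "z \<in> exps Z" "a + single k N + z \<in> E" by (auto simp: sat_exps_def)
  obtain u where u: "u \<in> U" "dominates n (a + single k N + z) u" using dom[OF z(2)] by blast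
  have below: "partial_degree m u \<le> partial_degree m a" if m: "m \<le> k" for m
  proof (cases "m = k")
    case True
    then show ?thesis using L[OF u(1)] large deg by simp
  next
    case False
    have "partial_degree m z = 0" by (rule partial_degree_exps_0[OF z(1)]) (use m in \<open>auto simp: Z_def\<close>)
    moreover have "m \<le> n" using m k by simp
    then have "partial_degree m u \<le> partial_degree m (a + single k N + z)"
      using u(2) by (simp add: dominates_def)
    ultimately show ?thesis using False m k by (simp add: partial_degree_add partial_degree_single)
  qed
  \<comment> \<open>A power of the first variable after \<open>k\<close>, large enough for all later
    partial degrees. If \<open>k = n\<close> there is no such variable, and no later partial degree
    to correct.\<close>
  define z' where "z' = (if k < n then single (k + 1) (partial_degree n u) else 0)"
  have z': "z' \<in> exps Z" using k by (auto simp: z'_def Z_def intro!: single_in_exps)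
  have "partial_degree m u \<le> partial_degree m (a + z')" if m: "m \<le> n" for m
  proof (cases "m \<le> k")
    case True
    then show ?thesis using below[OF True] by (simp add: partial_degree_add)
  next
    case False
    then have "partial_degree m z' = partial_degree n u" using m
        by (simp add: z'_def partial_degree_single)
    then show ?thesis using partial_degree_mono[OF m, of u] by (simp add: partial_degree_add)
  qed
  then have "dominates n (a + z') u" by (simp add: dominates_def)
  moreover have "a + z' \<in> exps {1..n}" using aA z' exps_A_sub exps_Z_sub by auto
  ultimately have "a + z' \<in> E" using dominating_in_stable[OF E_ideal E_stable] u(1) U by blast
  then show False using aA z' by (auto simp: sat_exps_def)
qed

text \<open>Homogenization: a slack variable turns the monomials of degree below \<open>L\<close> in
  \<open>k\<close> variables into monomials of degree exactly \<open>L - 1\<close> in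
  \<open>k + 1\<close> variables. For \<open>L = 0\<close> there is nothing to count.\<close>

lemma card_exps_degree_less:
  shows "finite {v \<in> exps {1..k}. mon_degree v < L}"
    and "1 \<le> k \<Longrightarrow> card {v \<in> exps {1..k}. mon_degree v < L} \<le> (L + k - 1) choose k"
proof -
  let ?X = "{v \<in> exps {1..k}. mon_degree v < L}"
  have "?X = (\<Union>t<L. {v \<in> exps {1..k}. mon_degree v = t})" by auto
  then show fin: "finite ?X" by (simp add: card_exps_degree)
  assume k: "1 \<le> k"
  show "card ?X \<le> (L + k - 1) choose k"
  proof (cases L)
    case (Suc M)
    \<comment> \<open>Index 0 is free to serve as the slack variable, because the variables are
      numbered from 1.\<close>
    let ?f = "\<lambda>v. v + single 0 (M - mon_degree v)"
    let ?Y = "{v \<in> exps {0..k}. mon_degree v = M}"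
    have lookup_0: "lookup v 0 = 0" if "v \<in> exps {1..k}" for v
      using that by (auto simp: exps_def in_keys_iff)
    have "inj_on ?f ?X"
    proof (rule inj_onI)
      fix v w assume v: "v \<in> ?X" and w: "w \<in> ?X" and eq: "?f v = ?f w"
      have "lookup (?f v) i = lookup (?f w) i" for i using eq by simp
      then show "v = w"
        using lookup_0[of v] lookup_0[of w] v w
        by (intro poly_mapping_eqI) (metis (mono_tags, lifting) add.right_neutral lookup_add
            lookup_single_not_eq mem_Collect_eq)
    qed
    moreover have "?f ` ?X \<subseteq> ?Y"
    proof safe
      fix v assume v: "v \<in> exps {1..k}" "mon_degree v < L"
      have sub: "exps {1..k} \<subseteq> exps {0..k}" by (rule exps_mono) auto
      then show fv: "?f v \<in> exps {0..k}" using v by (auto simp: single_in_exps)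
      have "mon_degree (?f v)
          = (\<Sum>i=0..k. lookup v i) + (\<Sum>i=0..k. lookup (single 0 (M - mon_degree v)) i)"
        unfolding mon_degree_eq_sum[OF fv finite_atLeastAtMost] by (simp add: lookup_add sum.distrib)
      also have "(\<Sum>i=0..k. lookup v i) = mon_degree v"
        using mon_degree_eq_sum[of v "{0..k}"] v sub by auto
      also have "(\<Sum>i=0..k. lookup (single 0 (M - mon_degree v)) i) = M - mon_degree v"
        by (simp add: lookup_single when_def)
      finally show "mon_degree (?f v) = M" using v Suc by simp
    qed
    ultimately have "card ?X \<le> card ?Y" by (rule card_inj_on_le) (simp add: card_exps_degree)
    also have "card ?Y = (M + k) choose M" by (simp add: card_exps_degree)
    also have "\<dots> = (L + k - 1) choose k" using Suc by (simp add: binomial_symmetric[of M "M + k"])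
    finally show ?thesis .
  qed simp
qed

theorem corollary4p7:
  fixes n s :: nat
    and u :: "nat \<Rightarrow> nat \<Rightarrow>\<^sub>0 nat"
    and I :: "'k::field mpoly set"
  assumes "\<forall>i\<in>{1..s}. Poly_Mapping.keys (u i) \<subseteq> {1..n}"
    and "strongly_stable n I"
    and "\<forall>i\<in>{1..s}. monomial (u i) \<in> I"
    and "\<forall>J. strongly_stable n J \<and> (\<forall>i\<in>{1..s}. monomial (u i) \<in> J) \<longrightarrow> I \<subseteq> J"
  shows "\<forall>r<n.
    arith_deg n r I = of_nat (std n r I) \<and>
    std n r I \<le>
      (Max {\<Sum>k=1..n-r. Poly_Mapping.lookup (u i) k | i. i \<in> {1..s}} + (n - r) - 1) choose (n - r)"
proof (intro allI impI)
  fix r assume r: "r < n"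
  obtain E where E: "expo_ideal {1..n} E" "I = polys_over E"
    using assms(2) by (auto simp: strongly_stable_def monomial_ideal_iff)
  have stable: "expo_stable E" using assms(2) E by (simp add: strongly_stable_polys_over)
  let ?U = "u ` {1..s}"
  \<comment> \<open>By minimality \<open>I\<close> lies in the ideal with exponents
    \<open>D\<close>, so every exponent in \<open>E\<close> dominates some generator.\<close>
  define D where "D = {w \<in> exps {1..n}. \<exists>u\<in>?U. dominates n w u}"
  have "expo_ideal {1..n} D" "expo_stable D" unfolding D_def by (rule dominating_exps_stable)+
  then have "strongly_stable n (polys_over D :: 'k mpoly set)" by (simp add: strongly_stable_polys_over)
  moreover have "\<forall>i\<in>{1..s}. monomial (u i) \<in> (polys_over D :: 'k mpoly set)"
    using assms(1) by (auto simp: D_def exps_def dominates_def)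
  ultimately have "I \<subseteq> polys_over D" using assms(4) by blast
  then have E_D: "E \<subseteq> D" unfolding E(2) by (simp add: polys_over_subset_iff)
  define k where "k = n - r"
  have k: "1 \<le> k" "k \<le> n" using r by (auto simp: k_def)
  \<comment> \<open>For \<open>s = 0\<close> this is \<open>Max\<close> of the empty set, of
    unspecified value. The bound holds regardless: \<open>D\<close> and with it \<open>E\<close> are
    then empty, so \<open>?B\<close> is empty as well.\<close>
  define L where "L = Max {\<Sum>k=1..n-r. lookup (u i) k | i. i \<in> {1..s}}"
  have L_eq: "L = Max ((\<lambda>i. partial_degree k (u i)) ` {1..s})"
    unfolding L_def k_def partial_degree_def by (rule arg_cong[of _ _ Max]) auto
  let ?B = "monomial_localization.std_exps n E {1..k}"
  have "?B \<subseteq> {v \<in> exps {1..k}. mon_degree v < L}"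
  proof
    fix a assume a: "a \<in> ?B"
    have loc: "monomial_localization n E {1..k}" using E k by unfold_locales auto
    have "mon_degree a < L"
    proof (rule std_exps_degree_bound[OF E(1) stable _ _ _ k a])
      show "?U \<subseteq> E" using assms(3) E(2) by auto
      show "\<exists>u\<in>?U. dominates n w u" if "w \<in> E" for w using E_D that by (auto simp: D_def)
      show "partial_degree k v \<le> L" if "v \<in> ?U" for v
        unfolding L_eq using that by (intro Max_ge) auto
    qed
    then show "a \<in> {v \<in> exps {1..k}. mon_degree v < L}"
      using a by (simp add: monomial_localization.std_exps_def[OF loc])
  qed
  then have card_B: "card ?B \<le> (L + k - 1) choose k"
    using card_mono[OF card_exps_degree_less(1)] card_exps_degree_less(2)[OF k(1)] order.trans by blast
  let ?F = "{Y. Y \<subseteq> {1..n} \<and> card Y = r}"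
  have fin: "finite ?F" by (rule finite_subset[of _ "Pow {1..n}"]) auto
  have "std n r I = (\<Sum>Y\<in>?F. card (monomial_localization.std_exps n E ({1..n} - Y)))"
    unfolding E(2) by (rule std_eq_sum[OF E(1)])
  \<comment> \<open>By \<open>std_exps_initial\<close> only the final segment of length
    \<open>r\<close> can occur as the \<open>Z\<close> of a standard pair, so the sum has at most
    one nonzero term.\<close>
  also have "\<dots> \<le> (\<Sum>Y\<in>?F. if Y = {1..n} - {1..k} then card ?B else 0)"
  proof (rule sum_mono)
    fix Y assume Y: "Y \<in> ?F"
    then have card: "card ({1..n} - Y) = k" by (auto simp: card_Diff_subset finite_subset k_def)
    show "card (monomial_localization.std_exps n E ({1..n} - Y)) \<le> (if Y
        = {1..n} - {1..k} then card ?B else 0)"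
    proof (cases "monomial_localization.std_exps n E ({1..n} - Y) = {}")
      case False
      then have eq: "{1..n} - Y = {1..k}"
        using std_exps_initial[OF E(1) stable _ False] card by simp
      then have "Y = {1..n} - {1..k}" using Y by blast
      then show ?thesis using eq by simp
    qed simp
  qed
  also have "\<dots> \<le> card ?B" using fin by (simp add: sum.delta)
  also note card_B
  finally have "std n r I \<le> (L + k - 1) choose k" .
  then show "arith_deg n r I = of_nat (std n r I) \<and> std n r I \<le>
      (Max {\<Sum>k=1..n-r. lookup (u i) k | i. i \<in> {1..s}} + (n - r) - 1) choose (n - r)"
    unfolding E(2) by (simp add: arith_deg_eq_std[OF E(1)] L_def k_def)
qed

end
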